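(* For each Carter diagram $\Gamma$ below, the linkage system $\mathscr{L}(\Gamma)$ has the stated number of components, numbers of linkage diagrams, and values of $\mathscr{B}^{\vee}_L(\gamma^{\vee})$ on the linkage diagrams $\gamma^{\vee}$. 1. $\Gamma=D_4(a_1), D_4$: 3 components. $E$-type components: $\mathscr{B}^{\vee}_L(\gamma^{\vee})=1$, $16\ (=8\times2)$ linkage diagrams. $D$-type component: $\mathscr{B}^{\vee}_L(\gamma^{\vee})=1$, $8$ linkage diagrams. 2. $\Gamma=D_5(a_1), D_5$: 3 components. $E$-type components: $\mathscr{B}^{\vee}_L(\gamma^{\vee})=\frac54$, $32\ (=16\times2)$ linkage diagrams. $D$-type component: $\mathscr{B}^{\vee}_L(\gamma^{\vee})=1$, $10$ linkage diagrams. 3. $\Gamma=E_6(a_1),E_6(a_2),E_6$: 2 components, both of $E$-type: $\mathscr{B}^{\vee}_L(\gamma^{\vee})=\frac43$, $54\ (=27\times2)$ linkage diagrams. 4. $\Gamma=D_6(a_1),D_6(a_2),D_6$: 3 components. $E$-type components: $\mathscr{B}^{\vee}_L(\gamma^{\vee})=\frac32$, $64\ (=32\times2)$ linkage diagrams. $D$-type component: $\mathscr{B}^{\vee}_L(\gamma^{\vee})=1$, $12$ linkage diagrams. 5. $\Gamma=E_7(a_1),E_7(a_2),E_7(a_3),E_7(a_4),E_7$: 1 component, of $E$-type: $\mathscr{B}^{\vee}_L(\gamma^{\vee})=\frac32$, $56$ linkage diagrams. 6. $\Gamma=D_7(a_1),D_7(a_2),D_7$: 3 components. $E$-type components: $\mathscr{B}^{\vee}_L(\gamma^{\vee})=\frac74$,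 $128\ (=64\times2)$ linkage diagrams. $D$-type component: $\mathscr{B}^{\vee}_L(\gamma^{\vee})=1$, $14$ linkage diagrams. 7. $\Gamma=D_l(a_k)$ and $\Gamma=D_l$ with $l>7$: 1 component, of $D$-type: $\mathscr{B}^{\vee}_L(\gamma^{\vee})=1$, $2l$ linkage diagrams. (Here "$n\times2$" means two components with $n$ linkage diagrams each.)
   Context: Root systems are finite and simply-laced, with $(\alpha,\alpha)=2$ for every root. A simply-laced Carter diagram $\Gamma$ is a graph with vertices $\tau_1,\dots,\tau_l$ and solid/dotted edges, all of whose cycles have even length, realized by linearly independent (not necessarily simple) roots $\tau_i$ with $(\tau_i,\tau_j)=-1$ (solid), $+1$ (dotted), $0$ (no edge). Its partial Cartan matrix is $B_L=((\tau_i,\tau_j))$, positive definite, and $\mathscr{B}^{\vee}_L(u)={}^t u B_L^{-1}u$ for $u\in L^{\vee}=\mathbb{R}^l$. Diagrams: $D_l,E_6,E_7$ are the Dynkin diagrams (all edges solid). In the diagrams below every 4-cycle contains an odd number of dotted edges (the choice is immaterial up to replacing roots by their negatives). $D_4(a_1)$: a 4-cycle. $D_l(a_k)$ ($1\le k\le l-3$): a 4-cycle with a chain of $k-1$ vertices attached by its end to one vertex of the cycle, and a chain of $l-k-3$ vertices attached to the opposite vertex. $E_6(a_1)$: a 4-cycle with one pendant vertex attached to each of two adjacent vertices of the cycle. $E_6(a_2)$: two 4-cycles sharing an edge ($2\times3$ grid). $E_7(a_1)$: a 4-cycle with a chain of 2 vertices attached to one vertex and a pendant vertex attached to an adjacent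 vertex. $E_7(a_2)$: a 4-cycle with one pendant vertex attached to each of three of its vertices. $E_7(a_3)$: the $2\times 3$ grid $E_6(a_2)$ with a pendant vertex attached to a corner. $E_7(a_4)$: the graph of the cube with one vertex removed. A linkage labels vector (= linkage diagram) of $\Gamma$ is a nonzero vector $\gamma^{\vee}=((\gamma,\tau_1),\dots,(\gamma,\tau_l))^t$, where $\tau_1,\dots,\tau_l$ are linearly independent roots with diagram $\Gamma$ in some finite simply-laced root system $\varPhi$ and $\gamma\in\varPhi$ is a root not in $L=\mathrm{span}(\tau_1,\dots,\tau_l)$. The dual partial Weyl group $W_L^{\vee}$ is generated by the dual reflections $s^*_{\tau_i}u=u-u_i\,B_L\tau_i$ on $L^{\vee}$, where $u_i$ is the $i$-th coordinate and $B_L\tau_i$ is the $i$-th column of $B_L$. The linkage system $\mathscr{L}(\Gamma)$ is the set of all linkage diagrams of $\Gamma$ with this action; its components are the $W_L^{\vee}$-orbits. A component is of $E$-type (resp. $D$-type) if adjoining $\gamma$ to $\tau_1,\dots,\tau_l$, for $\gamma^{\vee}$ in it, gives an extension to a root system of type $E$ (resp. $D$) of rank $l+1$. For $l=4$ the two types overlap: for $D_4(a_1)$ the two components counted as $E$-type are also $D$-type, and the third is counted only as $D$-type; for $D_4$ each of the three components is both of $D$-type and of $E$-type. *)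

theory Defs
  imports
    "HOL-Algebra.Bij"
    "HOL-Algebra.Generated_Groups"
    "Jordan_Normal_Form.Gauss_Jordan_Elimination"
    "Jordan_Normal_Form.VS_Connect"
begin

section \<open>Root systems\<close>

text \<open>The ambient Euclidean space of dimension \<open>n\<close> is \<open>carrier_vec n\<close> with \<open>scalar_prod\<close>, so that
  one can quantify over the dimension.\<close>

abbreviation rspan :: "nat \<Rightarrow> real vec set \<Rightarrow> real vec set" where
  "rspan n \<equiv> LinearCombinations.module.span class_ring (module_vec TYPE(real) n)"

abbreviation rlin_dep :: "nat \<Rightarrow> real vec set \<Rightarrow> bool" where
  "rlin_dep n \<equiv> LinearCombinations.module.lin_dep class_ring (module_vec TYPE(real) n)"

definition reflect :: "real vec \<Rightarrow> real vec \<Rightarrow> real vec" where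
  "reflect \<alpha> v = v - (2 * (v \<bullet> \<alpha>) / (\<alpha> \<bullet> \<alpha>)) \<cdot>\<^sub>v \<alpha>"

definition root_system :: "nat \<Rightarrow> real vec set \<Rightarrow> bool" where
  "root_system n \<Phi> \<longleftrightarrow>
     finite \<Phi> \<and> \<Phi> \<subseteq> carrier_vec n \<and> rspan n \<Phi> = carrier_vec n \<and> 0\<^sub>v n \<notin> \<Phi> \<and>
     (\<forall>\<alpha>\<in>\<Phi>. \<forall>c. c \<cdot>\<^sub>v \<alpha> \<in> \<Phi> \<longleftrightarrow> c = 1 \<or> c = - 1) \<and>
     (\<forall>\<alpha>\<in>\<Phi>. reflect \<alpha> ` \<Phi> = \<Phi>) \<and>
     (\<forall>\<alpha>\<in>\<Phi>. \<forall>\<beta>\<in>\<Phi>. 2 * (\<beta> \<bullet> \<alpha>) / (\<alpha> \<bullet> \<alpha>) \<in> \<int>)"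

definition simply_laced_root_system :: "nat \<Rightarrow> real vec set \<Rightarrow> bool" where
  "simply_laced_root_system n \<Phi> \<longleftrightarrow> root_system n \<Phi> \<and> (\<forall>\<alpha>\<in>\<Phi>. \<alpha> \<bullet> \<alpha> = 2)"

text \<open>The smallest set containing \<open>S\<close> and closed under the reflections in its own elements. Closure
  under negation is automatic, since \<open>reflect \<alpha> \<alpha> = - \<alpha>\<close>. For a set \<open>S\<close> of roots this is the root
  system generated by \<open>S\<close> in its span.\<close>

inductive_set generated_roots :: "real vec set \<Rightarrow> real vec set" for S where
  base: "\<alpha> \<in> S \<Longrightarrow> \<alpha> \<in> generated_roots S"
| reflection: "\<lbrakk>\<alpha> \<in> generated_roots S; \<beta> \<in> generated_roots S\<rbrakk>
    \<Longrightarrow> reflect \<alpha> \<beta> \<in> generated_roots S"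


section \<open>Diagrams\<close>

text \<open>The vertices of a diagram are \<open>0, \<dots>, l - 1\<close> where \<open>l = rank\<close>; an edge is a two-element set.\<close>

datatype diagram = Diagram (rank: nat) (solid: "nat set set") (dotted: "nat set set")

definition cartan :: "diagram \<Rightarrow> real mat" where
  "cartan \<Gamma> = mat (rank \<Gamma>) (rank \<Gamma>) (\<lambda>(i, j).
     if i = j then 2 else if {i, j} \<in> solid \<Gamma> then - 1 else if {i, j} \<in> dotted \<Gamma> then 1 else 0)"

definition realizes :: "nat \<Rightarrow> diagram \<Rightarrow> real vec list \<Rightarrow> bool" where
  "realizes n \<Gamma> \<tau>s \<longleftrightarrow>
     length \<tau>s = rank \<Gamma> \<and> set \<tau>s \<subseteq> carrier_vec n \<and> distinct \<tau>s \<and> \<not> rlin_dep n (set \<tau>s) \<and>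
     (\<forall>i<rank \<Gamma>. \<forall>j<rank \<Gamma>. \<tau>s ! i \<bullet> \<tau>s ! j = cartan \<Gamma> $$ (i, j))"

fun path :: "nat list \<Rightarrow> nat set set" where
  "path (x # y # xs) = insert {x, y} (path (y # xs))"
| "path _ = {}"

text \<open>All ways of dotting the edges of the graph \<open>({..<l}, E)\<close> such that every 4-cycle contains an
  odd number of dotted edges.\<close>

definition carter_diagrams :: "nat \<Rightarrow> nat set set \<Rightarrow> diagram set" where
  "carter_diagrams l E = {Diagram l (E - F) F | F. F \<subseteq> E \<and>
     (\<forall>a b c d. distinct [a, b, c, d] \<and> path [a, b, c, d, a] \<subseteq> E
        \<longrightarrow> odd (card (path [a, b, c, d, a] \<inter> F)))}"

definition dynkin_D :: "nat \<Rightarrow> diagram" where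
  "dynkin_D l = Diagram l (path [0..<l - 1] \<union> {{l - 3, l - 1}}) {}"

text \<open>A branch vertex with arms of lengths \<open>1\<close>, \<open>2\<close> and \<open>l - 4\<close>. In particular \<open>E_5 = D_5\<close> as
  graphs, which is the source of the overlap of the two extension types for diagrams of rank 4.
  For \<open>l \<ge> 9\<close> the matrix of this diagram is not positive definite, so nothing realizes it.\<close>

definition dynkin_E :: "nat \<Rightarrow> diagram" where
  "dynkin_E l = Diagram l (path [0..<l - 1] \<union> {{2, l - 1}}) {}"

definition Da :: "nat \<Rightarrow> nat \<Rightarrow> diagram set" where
  "Da l k = carter_diagrams l
     (path [0, 1, 2, 3, 0] \<union> path (0 # [4..<k + 3]) \<union> path (2 # [k + 3..<l]))"

definition E6a1 :: "diagram set" where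
  "E6a1 = carter_diagrams 6 (path [0, 1, 2, 3, 0] \<union> {{0, 4}, {1, 5}})"

definition E6a2 :: "diagram set" where
  "E6a2 = carter_diagrams 6 (path [0, 1, 2, 3, 0] \<union> path [1, 4, 5, 2])"

definition E7a1 :: "diagram set" where
  "E7a1 = carter_diagrams 7 (path [0, 1, 2, 3, 0] \<union> path [0, 4, 5] \<union> {{1, 6}})"

definition E7a2 :: "diagram set" where
  "E7a2 = carter_diagrams 7 (path [0, 1, 2, 3, 0] \<union> {{0, 4}, {1, 5}, {2, 6}})"

definition E7a3 :: "diagram set" where
  "E7a3 = carter_diagrams 7 (path [0, 1, 2, 3, 0] \<union> path [1, 4, 5, 2] \<union> {{0, 6}})"

text \<open>The vertices of the cube other than \<open>111\<close>, read as binary numbers.\<close>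

definition E7a4 :: "diagram set" where
  "E7a4 = carter_diagrams 7
     {{0, 1}, {0, 2}, {0, 4}, {1, 3}, {1, 5}, {2, 3}, {2, 6}, {4, 5}, {4, 6}}"


section \<open>Linkage systems\<close>

definition labels :: "real vec list \<Rightarrow> real vec \<Rightarrow> real vec" where
  "labels \<tau>s \<gamma> = vec (length \<tau>s) (\<lambda>i. \<gamma> \<bullet> \<tau>s ! i)"

definition linked :: "nat \<Rightarrow> real vec set \<Rightarrow> diagram \<Rightarrow> real vec list \<Rightarrow> real vec \<Rightarrow> bool" where
  "linked n \<Phi> \<Gamma> \<tau>s \<gamma> \<longleftrightarrow>
     simply_laced_root_system n \<Phi> \<and> set \<tau>s \<subseteq> \<Phi> \<and> realizes n \<Gamma> \<tau>s \<and>
     \<gamma> \<in> \<Phi> \<and> \<gamma> \<notin> rspan n (set \<tau>s) \<and> labels \<tau>s \<gamma> \<noteq> 0\<^sub>v (rank \<Gamma>)"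

definition linkage_system :: "diagram \<Rightarrow> real vec set" where
  "linkage_system \<Gamma> = {labels \<tau>s \<gamma> | n \<Phi> \<tau>s \<gamma>. linked n \<Phi> \<Gamma> \<tau>s \<gamma>}"

definition dual_reflection :: "diagram \<Rightarrow> nat \<Rightarrow> real vec \<Rightarrow> real vec" where
  "dual_reflection \<Gamma> i u = u - u $ i \<cdot>\<^sub>v col (cartan \<Gamma>) i"

definition dual_weyl_group :: "diagram \<Rightarrow> (real vec \<Rightarrow> real vec) set" where
  "dual_weyl_group \<Gamma> = generate (BijGroup (carrier_vec (rank \<Gamma>)))
     {restrict (dual_reflection \<Gamma> i) (carrier_vec (rank \<Gamma>)) | i. i < rank \<Gamma>}"

definition components :: "diagram \<Rightarrow> real vec set set" where
  "components \<Gamma> = {{w u | w. w \<in> dual_weyl_group \<Gamma>} | u. u \<in> linkage_system \<Gamma>}"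

text \<open>For singular \<open>cartan \<Gamma>\<close> the value is irrelevant; for a realizable diagram the matrix is
  positive definite.\<close>

definition dual_form :: "diagram \<Rightarrow> real vec \<Rightarrow> real" where
  "dual_form \<Gamma> u = u \<bullet> (the (mat_inverse (cartan \<Gamma>)) *\<^sub>v u)"

text \<open>The set \<open>\<Psi>\<close> of roots has a base with the (all solid) Dynkin diagram \<open>\<Delta>\<close>.\<close>

definition has_dynkin_type :: "nat \<Rightarrow> diagram \<Rightarrow> real vec set \<Rightarrow> bool" where
  "has_dynkin_type n \<Delta> \<Psi> \<longleftrightarrow> (\<exists>\<beta>s. set \<beta>s \<subseteq> \<Psi> \<and> realizes n \<Delta> \<beta>s \<and>
     (\<forall>\<alpha>\<in>\<Psi>. \<exists>c\<in>carrier_vec (rank \<Delta>). \<alpha> = mat_of_cols n \<beta>s *\<^sub>v c \<and>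
        ((\<forall>i<rank \<Delta>. c $ i \<in> \<nat>) \<or> (\<forall>i<rank \<Delta>. - c $ i \<in> \<nat>))))"

text \<open>The requirement \<open>u \<in> linkage_system \<Gamma>\<close> keeps the inner quantifier from being vacuous. All
  realizations of \<open>u\<close> have the same Gram matrix, so quantifying over all of them is the same as
  taking one.\<close>

definition components_of_type :: "(nat \<Rightarrow> diagram) \<Rightarrow> diagram \<Rightarrow> real vec set set" where
  "components_of_type \<Delta> \<Gamma> = {C \<in> components \<Gamma>. \<forall>u\<in>C. u \<in> linkage_system \<Gamma> \<and>
     (\<forall>n \<Phi> \<tau>s \<gamma>. linked n \<Phi> \<Gamma> \<tau>s \<gamma> \<and> labels \<tau>s \<gamma> = u
        \<longrightarrow> has_dynkin_type n (\<Delta> (rank \<Gamma> + 1)) (generated_roots (insert \<gamma> (set \<tau>s))))}"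

abbreviation E_components :: "diagram \<Rightarrow> real vec set set" where
  "E_components \<equiv> components_of_type dynkin_E"

abbreviation D_components :: "diagram \<Rightarrow> real vec set set" where
  "D_components \<equiv> components_of_type dynkin_D"

end

theory Submission
  imports Defs "Jordan_Normal_Form.DL_Rank"
begin

text \<open>Realize \<open>\<Gamma>\<close> by roots \<open>\<tau>\<^sub>i\<close> spanning a Euclidean space of dimension \<open>l\<close>, and let \<open>\<Lambda>\<close> be the root
  lattice they generate. Projecting a root \<open>\<gamma>\<close> outside the span, and conversely completing a vector by
  an orthogonal part, identifies the linkage diagrams with the nonzero vectors \<open>x\<close> of the dual lattice
  of \<open>\<Lambda>\<close> with \<open>x \<bullet> x < 2\<close>, and the dual form with \<open>x \<bullet> x\<close>. Two such vectors lie in the same component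
  iff they are congruent modulo \<open>\<Lambda>\<close>. So everything depends only on \<open>\<Lambda>\<close>, which is the lattice
  \<open>D_l\<close>, \<open>E_6\<close> or \<open>E_7\<close>, where these vectors can be listed in coordinates. The type of an extension is
  read off from the Dynkin diagram obtained by attaching a vertex to a base of \<open>\<Lambda>\<close>; the types \<open>D\<close>
  and \<open>E\<close> exclude each other in rank at least 6, since only a \<open>D\<close> lattice contains a vector of norm 4
  whose product with every lattice vector is even.\<close>

section \<open>Integral lattices\<close>

text \<open>The linkage system ranges over root systems of all dimensions. The norm bound comes from
  the part of \<gamma> orthogonal to the span: it is nonzero and has norm 2 - x \<bullet> x.
  Conversely one extra coordinate restores norm 2, so dimension l + 1 already exhibits every linkage
  diagram. The same bound gives connectedness: by Cauchy-Schwarz a vector of norm below 2 has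
  product -1, 0 or 1 with a root, so a reflection moves it by at most one root, and a difference in
  \<Lambda> can be worked off root by root. All admissible dottings must be treated at once.
  Replacing roots by their negatives turns them into each other, because the parity condition makes
  the product of the edge signs around each 4-cycle equal to -1; negation does not change \<Lambda>.
  In coordinates, the vector of norm 4 that marks a D lattice is twice a unit vector. Its half lies
  in the dual lattice and has norm 1, whereas nonzero vectors in the duals of E_6, E_7 and E_8 have
  norm at least 4/3, 3/2 and 2.\<close>

definition comb :: "nat \<Rightarrow> real vec list \<Rightarrow> (nat \<Rightarrow> real) \<Rightarrow> real vec" where
  "comb n vs c = vec n (\<lambda>k. \<Sum>i<length vs. c i * vs ! i $ k)"

definition zlat :: "nat \<Rightarrow> real vec list \<Rightarrow> real vec set" where
  "zlat n vs = {comb n vs (\<lambda>i. of_int (c i)) | c. True}"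

lemma comb_carrier [simp]: "comb n vs c \<in> carrier_vec n"
  by (simp add: comb_def)

lemma dim_comb [simp]: "dim_vec (comb n vs c) = n"
  by (simp add: comb_def)

lemma comb_cong: "(\<And>i. i < length vs \<Longrightarrow> c i = d i) \<Longrightarrow> comb n vs c = comb n vs d"
  by (simp add: comb_def)

lemma comb_add: "comb n vs (\<lambda>i. c i + d i) = comb n vs c + comb n vs d"
  by (rule eq_vecI) (simp_all add: comb_def sum.distrib ring_distribs)

lemma comb_diff: "comb n vs (\<lambda>i. c i - d i) = comb n vs c - comb n vs d"
  by (rule eq_vecI) (simp_all add: comb_def sum_subtractf ring_distribs)

lemma comb_scale: "comb n vs (\<lambda>i. a * c i) = a \<cdot>\<^sub>v comb n vs c"
  by (rule eq_vecI) (simp_all add: comb_def sum_distrib_left mult.assoc)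

lemma comb_zero [simp]: "comb n vs (\<lambda>i. 0) = 0\<^sub>v n"
  by (rule eq_vecI) (simp_all add: comb_def)

lemma comb_unit:
  assumes "j < length vs" "set vs \<subseteq> carrier_vec n"
  shows "comb n vs (\<lambda>i. if i = j then a else 0) = a \<cdot>\<^sub>v vs ! j"
proof (rule eq_vecI)
  have "dim_vec (vs ! j) = n"
    using assms nth_mem carrier_vecD by blast
  then show "dim_vec (comb n vs (\<lambda>i. if i = j then a else 0)) = dim_vec (a \<cdot>\<^sub>v vs ! j)"
    by simp
  fix k assume "k < dim_vec (a \<cdot>\<^sub>v vs ! j)"
  then have "k < n" using \<open>dim_vec (vs ! j) = n\<close> by simp
  have "(\<Sum>i<length vs. (if i = j then a else 0) * vs ! i $ k)
      = (\<Sum>i<length vs. if i = j then a * vs ! j $ k else 0)"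
    by (rule sum.cong) auto
  then show "comb n vs (\<lambda>i. if i = j then a else 0) $ k = (a \<cdot>\<^sub>v vs ! j) $ k"
    using \<open>k < n\<close> \<open>dim_vec (vs ! j) = n\<close> assms(1) by (simp add: comb_def)
qed

lemma comb_dot:
  assumes "w \<in> carrier_vec n"
  shows "comb n vs c \<bullet> w = (\<Sum>i<length vs. c i * (vs ! i \<bullet> w))"
proof -
  have "comb n vs c \<bullet> w = (\<Sum>k<n. (\<Sum>i<length vs. c i * vs ! i $ k) * w $ k)"
    using assms by (simp add: comb_def scalar_prod_def lessThan_atLeast0)
  also have "\<dots> = (\<Sum>i<length vs. \<Sum>k<n. c i * vs ! i $ k * w $ k)"
    by (subst sum.swap) (simp add: sum_distrib_right)
  also have "\<dots> = (\<Sum>i<length vs. c i * (vs ! i \<bullet> w))"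
    using assms
    by (simp add: scalar_prod_def lessThan_atLeast0 sum_distrib_left mult.assoc)
  finally show ?thesis .
qed

lemma mat_of_cols_mult_vec:
  assumes "set vs \<subseteq> carrier_vec n" "c \<in> carrier_vec (length vs)"
  shows "mat_of_cols n vs *\<^sub>v c = comb n vs (($) c)"
  using assms
  by (intro eq_vecI)
    (simp_all add: comb_def scalar_prod_def lessThan_atLeast0 mat_of_cols_def mult.commute)

text \<open>Bridge from linear dependence of a set of vectors to coefficients indexed by list
  positions; distinctness makes the two views agree.\<close>

lemma lin_indep_iff:
  assumes "set vs \<subseteq> carrier_vec n" "distinct vs"
  shows "\<not> rlin_dep n (set vs) \<longleftrightarrow>
    (\<forall>c. comb n vs c = 0\<^sub>v n \<longrightarrow> (\<forall>i<length vs. c i = 0))" (is "?L \<longleftrightarrow> ?R")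
proof -
  interpret vec_space "TYPE(real)" n .
  let ?A = "mat_of_cols n vs"
  have A: "?A \<in> carrier_mat n (length vs)" by simp
  have cols: "cols ?A = vs"
    using assms(1) by (simp add: cols_mat_of_cols)
  show ?thesis
  proof
    assume L: ?L
    show ?R
    proof (intro allI impI, rule ccontr)
      fix c i assume c: "comb n vs c = 0\<^sub>v n" "i < length vs" "c i \<noteq> 0"
      let ?v = "vec (length vs) c"
      have "?A *\<^sub>v ?v = comb n vs c"
        using mat_of_cols_mult_vec[OF assms(1), of ?v] by (simp add: comb_def)
      moreover have "?v \<noteq> 0\<^sub>v (length vs)"
        using c by (metis index_vec index_zero_vec(1))
      ultimately have "lin_dep (set (cols ?A))"
        using lin_depI[OF A, of ?v] c cols assms(2) by simp
      with L cols show False by simp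
    qed
  next
    assume R: ?R
    show ?L
    proof
      assume "lin_dep (set vs)"
      then obtain v where v: "v \<in> carrier_vec (length vs)" "v \<noteq> 0\<^sub>v (length vs)"
        "?A *\<^sub>v v = 0\<^sub>v n"
        using lin_depE[OF A] cols assms(2) by metis
      then have "comb n vs (($) v) = 0\<^sub>v n"
        using mat_of_cols_mult_vec[OF assms(1)] by simp
      with R have "\<forall>i<length vs. v $ i = 0" by blast
      with v(1) have "v = 0\<^sub>v (length vs)" by (intro eq_vecI) auto
      with v(2) show False by simp
    qed
  qed
qed

lemma comb_in_span:
  assumes "set vs \<subseteq> carrier_vec n"
  shows "comb n vs c \<in> rspan n (set vs)"
proof -
  interpret vec_space "TYPE(real)" n .
  have dims: "\<forall>w\<in>set vs. dim_vec w = n"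
    using assms by auto
  have "comb n vs c = lincomb_list c vs"
    using lincomb_list_as_mat_mult[OF dims] mat_of_cols_mult_vec[OF assms, of "vec (length vs) c"]
    by (simp add: comb_def)
  then have "comb n vs c \<in> span_list vs"
    by (auto simp: span_list_def)
  then show ?thesis
    using span_list_as_span[OF assms] by simp
qed

lemma span_carrierI:
  assumes "S \<subseteq> carrier_vec n" "\<And>k. k < n \<Longrightarrow> unit_vec n k \<in> rspan n S"
  shows "rspan n S = carrier_vec n"
proof -
  interpret vec_space "TYPE(real)" n .
  have "set (unit_vecs n) \<subseteq> span S"
    using assms(2) by (auto simp: unit_vecs_def)
  then have "span (set (unit_vecs n)) \<subseteq> span S"
    by (rule span_subsetI[OF assms(1)])
  then show ?thesis
    using span_unit_vecs_is_carrier span_is_subset2[OF assms(1)] by auto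
qed

lemma zlat_carrier: "zlat n vs \<subseteq> carrier_vec n"
  by (auto simp: zlat_def)

lemma comb_in_zlat [simp]: "comb n vs (\<lambda>i. of_int (c i)) \<in> zlat n vs"
  by (auto simp: zlat_def)

lemma zlat_add:
  assumes "v \<in> zlat n vs" "w \<in> zlat n vs"
  shows "v + w \<in> zlat n vs"
proof -
  obtain c d where "v = comb n vs (\<lambda>i. of_int (c i))" "w = comb n vs (\<lambda>i. of_int (d i))"
    using assms by (auto simp: zlat_def)
  then show ?thesis
    using comb_in_zlat[of n vs "\<lambda>i. c i + d i"] by (simp add: comb_add)
qed

lemma zlat_diff:
  assumes "v \<in> zlat n vs" "w \<in> zlat n vs"
  shows "v - w \<in> zlat n vs"
proof -
  obtain c d where "v = comb n vs (\<lambda>i. of_int (c i))" "w = comb n vs (\<lambda>i. of_int (d i))"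
    using assms by (auto simp: zlat_def)
  then show ?thesis
    using comb_in_zlat[of n vs "\<lambda>i. c i - d i"] by (simp add: comb_diff)
qed

lemma zlat_smult:
  assumes "v \<in> zlat n vs"
  shows "of_int a \<cdot>\<^sub>v v \<in> zlat n vs"
proof -
  obtain c where "v = comb n vs (\<lambda>i. of_int (c i))"
    using assms by (auto simp: zlat_def)
  then show ?thesis
    using comb_in_zlat[of n vs "\<lambda>i. a * c i"] by (simp add: comb_scale)
qed

lemma zlat_zero [simp]: "0\<^sub>v n \<in> zlat n vs"
  using comb_in_zlat[of n vs "\<lambda>_. 0"] by simp

lemma zlat_smult_nth:
  assumes "j < length vs" "set vs \<subseteq> carrier_vec n"
  shows "of_int a \<cdot>\<^sub>v vs ! j \<in> zlat n vs"
proof -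
  have "(\<lambda>i. of_int (if i = j then a else 0)) = (\<lambda>i. if i = j then real_of_int a else 0)"
    by auto
  then show ?thesis
    using comb_in_zlat[of n vs "\<lambda>i. if i = j then a else 0"] comb_unit[OF assms, of "of_int a"]
    by simp
qed

lemma zlat_nth: "j < length vs \<Longrightarrow> set vs \<subseteq> carrier_vec n \<Longrightarrow> vs ! j \<in> zlat n vs"
  using zlat_smult_nth[of j vs n 1] by simp

lemma zlat_base: "set vs \<subseteq> carrier_vec n \<Longrightarrow> set vs \<subseteq> zlat n vs"
  using zlat_nth by (metis in_set_conv_nth subsetI)

section \<open>Descent and induction over lattice vectors\<close>

lemma comb_step:
  assumes "j < length vs" "set vs \<subseteq> carrier_vec n"
  shows "comb n vs (\<lambda>i. c i - (if i = j then a else 0)) = comb n vs c - a \<cdot>\<^sub>v vs ! j"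
  using comb_diff[of n vs c "\<lambda>i. if i = j then a else 0"] comb_unit[OF assms] by simp

text \<open>The termination measure of the descent: one nonzero coefficient moves a unit towards
  zero.\<close>

lemma sum_abs_step:
  fixes c :: "nat \<Rightarrow> int"
  assumes "j < m" "c j \<noteq> 0"
  shows "(\<Sum>i<m. nat \<bar>c i - (if i = j then sgn (c j) else 0)\<bar>) < (\<Sum>i<m. nat \<bar>c i\<bar>)"
proof (rule sum_strict_mono_ex1)
  show "\<forall>i\<in>{..<m}. nat \<bar>c i - (if i = j then sgn (c j) else 0)\<bar> \<le> nat \<bar>c i\<bar>"
    by (auto simp: sgn_if)
  show "\<exists>i\<in>{..<m}. nat \<bar>c i - (if i = j then sgn (c j) else 0)\<bar> < nat \<bar>c i\<bar>"
    using assms by (intro bexI[of _ j]) (auto simp: sgn_if)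
qed simp

lemma scalar_prod_self_pos:
  fixes v :: "real vec"
  assumes "v \<in> carrier_vec n" "v \<noteq> 0\<^sub>v n"
  shows "0 < v \<bullet> v"
proof -
  obtain k where k: "k < n" "v $ k \<noteq> 0"
    using assms by (metis carrier_vecD eq_vecI index_zero_vec)
  have "0 < (\<Sum>i = 0..<n. v $ i * v $ i)"
    using k by (intro sum_pos2[of _ k]) (auto simp: zero_less_mult_iff)
  then show ?thesis
    using assms by (simp add: scalar_prod_def)
qed

lemma scalar_prod_self_nonneg: "0 \<le> v \<bullet> (v :: real vec)"
  by (simp add: scalar_prod_def sum_nonneg)

text \<open>For nonzero v, expanding v \<bullet> v = \<Sum> c_i (v_i \<bullet> v) > 0 shows that
  some summand is positive. Subtracting that generator with the sign of its coefficient shortens the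
  combination and, at the same time, the removed signed generator has positive product with v. Plain
  induction on coefficients would lose this second fact, on which the arguments about roots and
  weights rest.\<close>

lemma zlat_descent [consumes 2, case_names zero step]:
  assumes "v \<in> zlat n vs" "set vs \<subseteq> carrier_vec n"
    and zero: "P (0\<^sub>v n)"
    and step: "\<And>v j s. v \<in> zlat n vs \<Longrightarrow> v \<noteq> 0\<^sub>v n \<Longrightarrow> j < length vs \<Longrightarrow> s = 1 \<or> s = -1
      \<Longrightarrow> 0 < s * (v \<bullet> vs ! j) \<Longrightarrow> P (v - s \<cdot>\<^sub>v vs ! j) \<Longrightarrow> P v"
  shows "P v"
proof -
  from assms(1) obtain c :: "nat \<Rightarrow> int" where c: "v = comb n vs (\<lambda>i. of_int (c i))"
    by (auto simp: zlat_def)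
  show ?thesis
    unfolding c
  proof (induction "\<Sum>i<length vs. nat \<bar>c i\<bar>" arbitrary: c rule: less_induct)
    case less
    let ?v = "comb n vs (\<lambda>i. of_int (c i))"
    show ?case
    proof (cases "?v = 0\<^sub>v n")
      case True
      with zero show ?thesis by simp
    next
      case False
      then have "0 < ?v \<bullet> ?v"
        by (rule scalar_prod_self_pos[OF comb_carrier])
      also have "?v \<bullet> ?v = (\<Sum>i<length vs. of_int (c i) * (vs ! i \<bullet> ?v))"
        by (rule comb_dot) simp
      finally obtain j where j: "j < length vs" "0 < of_int (c j) * (vs ! j \<bullet> ?v)"
        by (metis (no_types, lifting) lessThan_iff not_less sum_nonpos)
      have vj: "vs ! j \<in> carrier_vec n" using j(1) assms(2) by auto
      have cj: "c j \<noteq> 0" using j(2) by auto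
      define d where "d i = c i - (if i = j then sgn (c j) else 0)" for i
      have "P (comb n vs (\<lambda>i. of_int (d i)))"
        using sum_abs_step[of j "length vs" c] j cj
        by (intro less.hyps) (simp add: d_def)
      moreover have "comb n vs (\<lambda>i. of_int (d i)) = ?v - of_int (sgn (c j)) \<cdot>\<^sub>v vs ! j"
        using comb_step[OF j(1) assms(2), of "\<lambda>i. of_int (c i)" "of_int (sgn (c j))"]
        by (simp add: d_def if_distrib cong: if_cong)
      moreover have "0 < of_int (sgn (c j)) * (?v \<bullet> vs ! j)"
        using j(2) cj comm_scalar_prod[OF vj comb_carrier[of n vs "\<lambda>i. of_int (c i)"]]
        by (auto simp: sgn_if zero_less_mult_iff mult_less_0_iff split: if_splits)
      moreover have "of_int (sgn (c j)) = (1 :: real) \<or> of_int (sgn (c j)) = (-1 :: real)"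
        using cj by (auto simp: sgn_if)
      ultimately show ?thesis
        using step[OF comb_in_zlat False j(1)] by metis
    qed
  qed
qed

lemma zlat_induct [consumes 2, case_names zero step]:
  assumes "v \<in> zlat n vs" "set vs \<subseteq> carrier_vec n"
    and "P (0\<^sub>v n)"
    and step: "\<And>v j s. v \<in> zlat n vs \<Longrightarrow> P v \<Longrightarrow> j < length vs \<Longrightarrow> s = 1 \<or> s = -1
      \<Longrightarrow> P (v + s \<cdot>\<^sub>v vs ! j)"
  shows "P v"
  using assms(1-3)
proof (induction rule: zlat_descent)
  case (step v j s)
  have vj: "vs ! j \<in> carrier_vec n" "v \<in> carrier_vec n"
    using step(1,3) assms(2) zlat_carrier by auto
  have "s \<cdot>\<^sub>v vs ! j \<in> zlat n vs"
    using zlat_smult_nth[OF step(3) assms(2), of 1] zlat_smult_nth[OF step(3) assms(2), of "-1"] step(4)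
    by auto
  then have "v - s \<cdot>\<^sub>v vs ! j \<in> zlat n vs"
    using step(1) zlat_diff by blast
  then have "P (v - s \<cdot>\<^sub>v vs ! j + s \<cdot>\<^sub>v vs ! j)"
    using assms(4) step by blast
  moreover have "v - s \<cdot>\<^sub>v vs ! j + s \<cdot>\<^sub>v vs ! j = v"
    using vj by (intro eq_vecI) auto
  ultimately show ?case by simp
qed

lemma zlat_least:
  assumes "set vs \<subseteq> carrier_vec n" "set ws \<subseteq> carrier_vec n" "set vs \<subseteq> zlat n ws"
  shows "zlat n vs \<subseteq> zlat n ws"
proof
  fix v assume "v \<in> zlat n vs"
  then show "v \<in> zlat n ws"
    using assms(1)
  proof (induction rule: zlat_induct)
    case (step v j s)
    have "vs ! j \<in> zlat n ws" using step assms(3) by auto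
    then show ?case
      using step zlat_add zlat_smult[of "vs ! j" n ws 1] zlat_smult[of "vs ! j" n ws "-1"] by auto
  qed simp
qed

section \<open>Root lattices\<close>

definition root_list :: "nat \<Rightarrow> real vec list \<Rightarrow> bool" where
  "root_list n vs \<longleftrightarrow> set vs \<subseteq> carrier_vec n \<and> (\<forall>i<length vs. vs ! i \<bullet> vs ! i = 2) \<and>
     (\<forall>i<length vs. \<forall>j<length vs. vs ! i \<bullet> vs ! j \<in> \<int>)"

lemma root_listD:
  assumes "root_list n vs"
  shows "set vs \<subseteq> carrier_vec n" "\<And>i. i < length vs \<Longrightarrow> vs ! i \<in> carrier_vec n"
    "\<And>i. i < length vs \<Longrightarrow> vs ! i \<bullet> vs ! i = 2"
    "\<And>i j. i < length vs \<Longrightarrow> j < length vs \<Longrightarrow> vs ! i \<bullet> vs ! j \<in> \<int>"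
  using assms by (auto simp: root_list_def)

lemma eq_if_norm_diff_0:
  fixes v w :: "real vec"
  assumes "v \<in> carrier_vec n" "w \<in> carrier_vec n" "(v - w) \<bullet> (v - w) = 0"
  shows "v = w"
proof -
  have "v - w = 0\<^sub>v n"
    using assms scalar_prod_self_pos[of "v - w" n] by (metis less_irrefl minus_carrier_vec)
  then have "v $ k - w $ k = 0" if "k < n" for k
    using that assms by (metis carrier_vecD index_minus_vec(1) index_zero_vec(1))
  then show ?thesis using assms by (intro eq_vecI) auto
qed

lemma zlat_dot_Ints:
  assumes "v \<in> zlat n vs" "w \<in> carrier_vec n" "\<And>i. i < length vs \<Longrightarrow> vs ! i \<bullet> w \<in> \<int>"
  shows "v \<bullet> w \<in> \<int>"
  using assms by (auto simp: zlat_def comb_dot intro!: Ints_sum Ints_mult)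

lemma zlat_Ints:
  assumes "root_list n vs" "v \<in> zlat n vs" "w \<in> zlat n vs"
  shows "v \<bullet> w \<in> \<int>"
proof (rule zlat_dot_Ints[OF assms(2)])
  note R = root_listD[OF assms(1)]
  show w: "w \<in> carrier_vec n" using assms zlat_carrier by blast
  fix i assume i: "i < length vs"
  have "w \<bullet> vs ! i \<in> \<int>"
    by (rule zlat_dot_Ints[OF assms(3)]) (use R i in auto)
  then show "vs ! i \<bullet> w \<in> \<int>" using comm_scalar_prod[OF w R(2)[OF i]] by simp
qed

lemma norm_add_smult:
  fixes v w :: "real vec"
  assumes "v \<in> carrier_vec n" "w \<in> carrier_vec n"
  shows "(v + a \<cdot>\<^sub>v w) \<bullet> (v + a \<cdot>\<^sub>v w) = v \<bullet> v + 2 * a * (v \<bullet> w) + a * a * (w \<bullet> w)"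
  using assms comm_scalar_prod[of w n v]
  by (simp add: add_scalar_prod_distrib[of _ n] scalar_prod_add_distrib[of _ n] algebra_simps)

lemma norm_diff_smult:
  fixes v w :: "real vec"
  assumes "v \<in> carrier_vec n" "w \<in> carrier_vec n"
  shows "(v - a \<cdot>\<^sub>v w) \<bullet> (v - a \<cdot>\<^sub>v w) = v \<bullet> v - 2 * a * (v \<bullet> w) + a * a * (w \<bullet> w)"
  using assms comm_scalar_prod[of w n v]
  by (simp add: minus_scalar_prod_distrib[of _ n] scalar_prod_minus_distrib[of _ n] algebra_simps)

text \<open>Adding s times a generator with s = \<plusminus>1 changes the norm by 2 * s * (v
  \<bullet> vs ! j) + 2, an even integer.\<close>

lemma zlat_even_norm:
  assumes "v \<in> zlat n vs" "root_list n vs"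
  shows "\<exists>k::int. v \<bullet> v = 2 * of_int k"
  using assms(1) root_listD(1)[OF assms(2)]
proof (induction rule: zlat_induct)
  case zero
  then show ?case by (auto intro: exI[of _ 0])
next
  case (step v j s)
  note R = root_listD[OF assms(2)]
  obtain k where k: "v \<bullet> v = 2 * of_int k" using step by blast
  have "v \<bullet> vs ! j \<in> \<int>"
    using zlat_Ints[OF assms(2) step(1) zlat_nth[OF step(2) R(1)]] .
  then obtain m where m: "v \<bullet> vs ! j = of_int m" by (auto elim: Ints_cases)
  have "v \<in> carrier_vec n" using step zlat_carrier by blast
  then have "(v + s \<cdot>\<^sub>v vs ! j) \<bullet> (v + s \<cdot>\<^sub>v vs ! j)
      = 2 * of_int k + 2 * s * of_int m + s * s * 2"
    using norm_add_smult[of v n "vs ! j" s] step R k m by simp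
  then have "(v + s \<cdot>\<^sub>v vs ! j) \<bullet> (v + s \<cdot>\<^sub>v vs ! j) = 2 * of_int (k + (if s = 1 then m else -m) + 1)"
    using step(3) by auto
  then show ?case by blast
qed

section \<open>Reflections and the norm 2 vectors of a lattice\<close>

lemma reflect_norm2: "\<alpha> \<bullet> \<alpha> = 2 \<Longrightarrow> reflect \<alpha> v = v - (v \<bullet> \<alpha>) \<cdot>\<^sub>v \<alpha>"
  by (simp add: reflect_def)

lemma reflect_isometry:
  assumes "\<alpha> \<bullet> \<alpha> = 2" "\<alpha> \<in> carrier_vec n" "v \<in> carrier_vec n"
  shows "reflect \<alpha> v \<bullet> reflect \<alpha> v = v \<bullet> v"
  using assms norm_diff_smult[of v n \<alpha> "v \<bullet> \<alpha>"] by (simp add: reflect_norm2)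

lemma reflect_involution:
  assumes "\<alpha> \<bullet> \<alpha> = 2" "\<alpha> \<in> carrier_vec n" "v \<in> carrier_vec n"
  shows "reflect \<alpha> (reflect \<alpha> v) = v"
proof -
  have "(v - (v \<bullet> \<alpha>) \<cdot>\<^sub>v \<alpha>) \<bullet> \<alpha> = - (v \<bullet> \<alpha>)"
    using assms by (simp add: minus_scalar_prod_distrib[of _ n])
  then show ?thesis
    using assms by (intro eq_vecI) (auto simp: reflect_norm2)
qed

definition lattice_roots :: "nat \<Rightarrow> real vec list \<Rightarrow> real vec set" where
  "lattice_roots n vs = {v \<in> zlat n vs. v \<bullet> v = 2}"

lemma reflect_lattice_roots:
  assumes "root_list n vs" "\<alpha> \<in> lattice_roots n vs" "\<beta> \<in> lattice_roots n vs"
  shows "reflect \<alpha> \<beta> \<in> lattice_roots n vs"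
proof -
  have *: "\<alpha> \<bullet> \<alpha> = 2" "\<alpha> \<in> zlat n vs" "\<beta> \<in> zlat n vs" "\<beta> \<bullet> \<beta> = 2"
    using assms by (auto simp: lattice_roots_def)
  obtain m where m: "\<beta> \<bullet> \<alpha> = of_int m"
    using zlat_Ints[OF assms(1) *(3) *(2)] by (auto elim: Ints_cases)
  have "reflect \<alpha> \<beta> \<in> zlat n vs"
    using * m zlat_diff[OF *(3) zlat_smult[OF *(2)], of m] by (simp add: reflect_norm2)
  moreover have "\<alpha> \<in> carrier_vec n" "\<beta> \<in> carrier_vec n"
    using * zlat_carrier by auto
  ultimately show ?thesis
    using *(4) reflect_isometry[OF *(1)] by (simp add: lattice_roots_def)
qed

text \<open>A signed generator s r with positive product against a norm 2 vector v has product 1 or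
  2. If it is 2, then v = s r; if it is 1, then v - s r has norm 2 again, is a shorter combination,
  and is mapped to v by the reflection in r. Hence the generated root system depends on the lattice
  only, which later allows a change of base.\<close>

lemma generated_roots_eq:
  assumes "root_list n vs"
  shows "generated_roots (set vs) = lattice_roots n vs"
proof
  note R = root_listD[OF assms]
  show "generated_roots (set vs) \<subseteq> lattice_roots n vs"
  proof
    fix \<alpha> assume "\<alpha> \<in> generated_roots (set vs)"
    then show "\<alpha> \<in> lattice_roots n vs"
    proof induction
      case (base \<alpha>)
      then show ?case
        using zlat_nth[OF _ R(1)] R(3) by (auto simp: lattice_roots_def in_set_conv_nth)
    next
      case (reflection \<alpha> \<beta>)
      then show ?case using reflect_lattice_roots[OF assms] by blast
    qed
  qed
  show "lattice_roots n vs \<subseteq> generated_roots (set vs)"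
  proof
    fix \<alpha> assume "\<alpha> \<in> lattice_roots n vs"
    then have "\<alpha> \<in> zlat n vs" "\<alpha> \<bullet> \<alpha> = 2" by (auto simp: lattice_roots_def)
    from this(1) R(1) this(2) show "\<alpha> \<in> generated_roots (set vs)"
    proof (induction rule: zlat_descent)
      case zero
      then show ?case by simp
    next
      case (step v j s)
      let ?r = "vs ! j"
      have r: "?r \<in> carrier_vec n" "?r \<bullet> ?r = 2" "?r \<in> generated_roots (set vs)"
        using R step(3) by (auto intro: generated_roots.base)
      have v: "v \<in> carrier_vec n" using step zlat_carrier by blast
      obtain m where m: "v \<bullet> ?r = of_int m"
        using zlat_Ints[OF assms step(1) zlat_nth[OF step(3) R(1)]] by (auto elim: Ints_cases)
      have ss: "s * s = 1" using step(4) by auto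
      have nrm: "(v - s \<cdot>\<^sub>v ?r) \<bullet> (v - s \<cdot>\<^sub>v ?r) = 4 - 2 * s * of_int m"
        using norm_diff_smult[OF v r(1), of s] ss r m step.prems by simp
      obtain t :: int where t: "s = of_int t" "t = 1 \<or> t = -1"
        using step(4) by (metis of_int_1 of_int_minus)
      have "0 < t * m" using step(5) m t by (metis of_int_0_less_iff of_int_mult)
      \<comment> \<open>Cauchy-Schwarz in the form that the norm 4 - 2 * t * m of the difference is
        nonnegative.\<close>
      moreover have "t * m \<le> 2"
      proof -
        have "0 \<le> 4 - 2 * s * of_int m"
          using nrm scalar_prod_self_nonneg by metis
        then have "of_int (t * m) \<le> (2 :: real)" using t by (simp add: mult.commute)
        then show ?thesis by linarith
      qed
      ultimately consider "t * m = 2" | "t * m = 1" by linarith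
      then show ?case
      proof cases
        case 1
        then have "s * of_int m = 2" using t by (metis of_int_mult of_int_numeral)
        then have "(v - s \<cdot>\<^sub>v ?r) \<bullet> (v - s \<cdot>\<^sub>v ?r) = 0"
          using nrm by (simp add: mult.assoc)
        then have vr: "v = s \<cdot>\<^sub>v ?r"
          using eq_if_norm_diff_0[of v n "s \<cdot>\<^sub>v ?r"] v r by simp
        show ?thesis
        proof (cases "s = 1")
          case True
          then show ?thesis using vr r by simp
        next
          case False
          \<comment> \<open>The negative of a generator is obtained by reflecting the generator in
            itself.\<close>
          then have "v = reflect ?r ?r"
            using step(4) vr r by (auto simp: reflect_norm2 intro!: eq_vecI)
          then show ?thesis using r generated_roots.reflection by metis
        qed
      next
        case 2
        then have mt: "m = t" using t by auto
        have "v - s \<cdot>\<^sub>v ?r \<in> generated_roots (set vs)"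
          using step.IH nrm ss t mt by simp
        then have "reflect ?r (v - s \<cdot>\<^sub>v ?r) \<in> generated_roots (set vs)"
          using r generated_roots.reflection by blast
        moreover have "(v - s \<cdot>\<^sub>v ?r) \<bullet> ?r = - s"
          using v r m mt t by (simp add: minus_scalar_prod_distrib[of _ n])
        then have "reflect ?r (v - s \<cdot>\<^sub>v ?r) = v"
          using v r by (intro eq_vecI) (auto simp: reflect_norm2)
        ultimately show ?thesis by simp
      qed
    qed
  qed
qed

lemma lattice_roots_root_system:
  assumes "root_list n vs" "finite (lattice_roots n vs)" "rspan n (set vs) = carrier_vec n"
  shows "simply_laced_root_system n (lattice_roots n vs)"
proof -
  let ?R = "lattice_roots n vs"
  note R = root_listD[OF assms(1)]
  interpret vec_space "TYPE(real)" n .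
  have sub: "?R \<subseteq> carrier_vec n" using zlat_carrier by (auto simp: lattice_roots_def)
  have "set vs \<subseteq> ?R"
    using zlat_nth[OF _ R(1)] R(3) by (auto simp: lattice_roots_def in_set_conv_nth)
  then have "span ?R = carrier_vec n"
    using span_is_monotone[of "set vs" ?R] assms(3) span_is_subset2[OF sub] by auto
  moreover have "0\<^sub>v n \<notin> ?R" by (auto simp: lattice_roots_def)
  moreover have "\<forall>\<alpha>\<in>?R. \<forall>c::real. c \<cdot>\<^sub>v \<alpha> \<in> ?R \<longleftrightarrow> c = 1 \<or> c = - 1"
  proof (intro ballI allI iffI)
    fix \<alpha> and c :: real assume a: "\<alpha> \<in> ?R" "c \<cdot>\<^sub>v \<alpha> \<in> ?R"
    then have "\<alpha> \<in> carrier_vec n" using sub by blast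
    with a have "c * c = 1" by (auto simp: lattice_roots_def)
    then show "c = 1 \<or> c = - 1" by (simp add: square_eq_1_iff)
  next
    fix \<alpha> and c :: real assume a: "\<alpha> \<in> ?R" "c = 1 \<or> c = - 1"
    then have "\<alpha> \<in> carrier_vec n" using sub by blast
    with a show "c \<cdot>\<^sub>v \<alpha> \<in> ?R"
      using zlat_smult[of \<alpha> n vs 1] zlat_smult[of \<alpha> n vs "-1"] by (auto simp: lattice_roots_def)
  qed
  moreover have "\<forall>\<alpha>\<in>?R. reflect \<alpha> ` ?R = ?R"
  proof (intro ballI equalityI subsetI)
    fix \<alpha> \<beta> assume a: "\<alpha> \<in> ?R" "\<beta> \<in> ?R"
    then have "\<beta> = reflect \<alpha> (reflect \<alpha> \<beta>)"
      using reflect_involution[of \<alpha> n \<beta>] subsetD[OF sub] by (simp add: lattice_roots_def)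
    then show "\<beta> \<in> reflect \<alpha> ` ?R"
      using reflect_lattice_roots[OF assms(1) a] by blast
  qed (use reflect_lattice_roots[OF assms(1)] in auto)
  moreover have "\<forall>\<alpha>\<in>?R. \<forall>\<beta>\<in>?R. 2 * (\<beta> \<bullet> \<alpha>) / (\<alpha> \<bullet> \<alpha>) \<in> \<int>"
    using zlat_Ints[OF assms(1)] by (auto simp: lattice_roots_def)
  ultimately show ?thesis
    using assms(2) sub
    unfolding simply_laced_root_system_def root_system_def by (auto simp: lattice_roots_def)
qed

lemma comb_inner:
  assumes "set vs \<subseteq> carrier_vec n"
  shows "comb n vs c \<bullet> comb n vs d = (\<Sum>i<length vs. \<Sum>j<length vs. c i * d j * (vs ! i \<bullet> vs ! j))"
proof -
  have "vs ! i \<bullet> comb n vs d = (\<Sum>j<length vs. d j * (vs ! i \<bullet> vs ! j))" if i: "i < length vs" for i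
  proof -
    have "vs ! i \<in> carrier_vec n" using assms i by auto
    then have "vs ! i \<bullet> comb n vs d = (\<Sum>j<length vs. d j * (vs ! j \<bullet> vs ! i))"
      using comb_dot[of "vs ! i" n vs d] comm_scalar_prod[of "vs ! i" n "comb n vs d"] by simp
    also have "\<dots> = (\<Sum>j<length vs. d j * (vs ! i \<bullet> vs ! j))"
      using assms i by (intro sum.cong) (auto intro!: comm_scalar_prod[of _ n])
    finally show ?thesis .
  qed
  then show ?thesis
    by (auto simp: comb_dot[OF comb_carrier] sum_distrib_left mult.assoc intro!: sum.cong)
qed

text \<open>Writing a root as \<open>p - q\<close> with nonnegative combinations \<open>p\<close>, \<open>q\<close> of disjoint support gives
  \<open>p \<bullet> q \<le> 0\<close>, hence \<open>p \<bullet> p + q \<bullet> q \<le> 2\<close>, and evenness of the lattice forces \<open>p = 0\<close> or \<open>q = 0\<close>.\<close>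

lemma lattice_root_sign:
  assumes "root_list n vs" "\<alpha> \<in> lattice_roots n vs"
    and indep: "\<And>c. comb n vs c = 0\<^sub>v n \<Longrightarrow> \<forall>i<length vs. c i = 0"
    and obtuse: "\<And>i j. i < length vs \<Longrightarrow> j < length vs \<Longrightarrow> i \<noteq> j \<Longrightarrow> vs ! i \<bullet> vs ! j \<le> 0"
  obtains c :: "nat \<Rightarrow> int" where "\<alpha> = comb n vs (\<lambda>i. of_int (c i))"
    "(\<forall>i<length vs. 0 \<le> c i) \<or> (\<forall>i<length vs. c i \<le> 0)"
proof -
  note R = root_listD[OF assms(1)]
  obtain c :: "nat \<Rightarrow> int" where c: "\<alpha> = comb n vs (\<lambda>i. of_int (c i))" "\<alpha> \<bullet> \<alpha> = 2"
    using assms(2) by (auto simp: lattice_roots_def zlat_def)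
  define p q where "p = comb n vs (\<lambda>i. of_int (max (c i) 0))" and "q = comb n vs (\<lambda>i. of_int (max (- c i) 0))"
  have mem: "p \<in> zlat n vs" "q \<in> zlat n vs"
    unfolding p_def q_def by (rule comb_in_zlat)+
  then have car: "p \<in> carrier_vec n" "q \<in> carrier_vec n" using zlat_carrier by auto
  have "(\<lambda>i. real_of_int (max (c i) 0) - real_of_int (max (- c i) 0)) = (\<lambda>i. of_int (c i))"
    by (auto simp: max_def)
  then have \<alpha>: "\<alpha> = p - q"
    using comb_diff[of n vs "\<lambda>i. of_int (max (c i) 0)" "\<lambda>i. of_int (max (- c i) 0)"] c
    by (simp add: p_def q_def)
  have pq: "p \<bullet> q \<le> 0"
    unfolding p_def q_def comb_inner[OF R(1)]
  proof (intro sum_nonpos)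
    fix i j assume "i \<in> {..<length vs}" "j \<in> {..<length vs}"
    then show "real_of_int (max (c i) 0) * real_of_int (max (- c j) 0) * (vs ! i \<bullet> vs ! j) \<le> 0"
      using obtuse[of i j] by (cases "i = j") (auto simp: max_def mult_le_0_iff zero_le_mult_iff)
  qed
  have "2 = p \<bullet> p - 2 * (p \<bullet> q) + q \<bullet> q"
    using c(2) norm_diff_smult[OF car, of 1] unfolding \<alpha> by simp
  then have le: "p \<bullet> p + q \<bullet> q \<le> 2" using pq by linarith
  have two: "v = 0\<^sub>v n \<or> 2 \<le> v \<bullet> v" if v: "v \<in> zlat n vs" for v
  proof -
    obtain k :: int where k: "v \<bullet> v = 2 * of_int k" using zlat_even_norm[OF v assms(1)] by blast
    have "v = 0\<^sub>v n \<or> 0 < v \<bullet> v" using scalar_prod_self_pos v zlat_carrier by blast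
    then show ?thesis
    proof
      assume "0 < v \<bullet> v"
      then have "1 \<le> k" using k by auto
      then show ?thesis using k by auto
    qed simp
  qed
  have "p = 0\<^sub>v n \<or> q = 0\<^sub>v n"
    using two[OF mem(1)] two[OF mem(2)] le by auto
  then show thesis
  proof
    assume "p = 0\<^sub>v n"
    then have "\<forall>i<length vs. c i \<le> 0"
      using indep[of "\<lambda>i. of_int (max (c i) 0)"] by (auto simp: p_def max_def split: if_splits)
    then show thesis using that c by blast
  next
    assume "q = 0\<^sub>v n"
    then have "\<forall>i<length vs. 0 \<le> c i"
      using indep[of "\<lambda>i. of_int (max (- c i) 0)"] by (auto simp: q_def max_def split: if_splits)
    then show thesis using that c by blast
  qed
qed

section \<open>Bases, labels and finiteness\<close>

text \<open>For a list of length n this amounts to being a basis, in a form that is checked by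
  scalar products alone.\<close>

definition nondeg :: "nat \<Rightarrow> real vec list \<Rightarrow> bool" where
  "nondeg n vs \<longleftrightarrow> (\<forall>v\<in>carrier_vec n. (\<forall>i<length vs. v \<bullet> vs ! i = 0) \<longrightarrow> v = 0\<^sub>v n)"

lemma labels_carrier [simp]: "labels vs v \<in> carrier_vec (length vs)"
  by (simp add: labels_def)

lemma labels_nth [simp]: "i < length vs \<Longrightarrow> labels vs v $ i = v \<bullet> vs ! i"
  by (simp add: labels_def)

lemma nth_carrier: "set vs \<subseteq> carrier_vec n \<Longrightarrow> i < length vs \<Longrightarrow> vs ! i \<in> carrier_vec n"
  by auto

lemma labels_zero:
  assumes "set vs \<subseteq> carrier_vec n"
  shows "labels vs (0\<^sub>v n) = 0\<^sub>v (length vs)"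
  using nth_carrier[OF assms] by (intro eq_vecI) (simp_all add: labels_def)

lemma labels_inj:
  assumes "nondeg n vs" "set vs \<subseteq> carrier_vec n"
  shows "inj_on (labels vs) (carrier_vec n)"
proof (rule inj_onI)
  fix v w assume *: "v \<in> carrier_vec n" "w \<in> carrier_vec n" "labels vs v = labels vs w"
  have "(v - w) \<bullet> vs ! i = 0" if i: "i < length vs" for i
  proof -
    have "v \<bullet> vs ! i = w \<bullet> vs ! i" using *(3) i by (metis labels_nth)
    then show ?thesis
      using *(1,2) nth_carrier[OF assms(2) i] minus_scalar_prod_distrib[of v n w "vs ! i"] by simp
  qed
  then have "v - w = 0\<^sub>v n"
    using assms(1) * by (auto simp: nondeg_def)
  then show "v = w" using eq_if_norm_diff_0[OF *(1,2)] by simp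
qed

text \<open>If A has the rows \<open>vs\<close>, then \<open>labels\<close> is multiplication by A
  and \<open>comb\<close> is multiplication by the transpose of A. So one inverse matrix yields
  spanning, solvability of prescribed labels, and independence.\<close>

lemma square_basis:
  assumes "length vs = n" "set vs \<subseteq> carrier_vec n" "nondeg n vs"
  shows "v \<in> carrier_vec n \<Longrightarrow> \<exists>c. v = comb n vs c"
    and "u \<in> carrier_vec n \<Longrightarrow> \<exists>x\<in>carrier_vec n. labels vs x = u"
    and "comb n vs c = 0\<^sub>v n \<Longrightarrow> \<forall>i<length vs. c i = 0"
proof -
  define A where "A = mat_of_rows n vs"
  have A: "A \<in> carrier_mat n n" using assms(1) by (auto simp: A_def)
  have Av: "A *\<^sub>v v = labels vs v" if v: "v \<in> carrier_vec n" for v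
    using assms(1,2) v
    by (intro eq_vecI) (auto simp: A_def labels_def nth_carrier[OF assms(2)]
      intro!: comm_scalar_prod[of _ n])
  have AT: "transpose_mat A = mat_of_cols n vs"
    using assms(1,2) by (simp add: A_def transpose_mat_of_rows)
  have "det A \<noteq> 0"
  proof
    assume "det A = 0"
    then obtain v where v: "v \<in> carrier_vec n" "v \<noteq> 0\<^sub>v n" "A *\<^sub>v v = 0\<^sub>v n"
      using det_0_iff_vec_prod_zero[OF A] by blast
    then have "labels vs v = 0\<^sub>v n" using Av by simp
    then have "\<forall>i<length vs. v \<bullet> vs ! i = 0"
      using assms(1) by (metis index_zero_vec(1) labels_nth)
    with v assms(3) show False by (auto simp: nondeg_def)
  qed
  then have "A \<in> Units (ring_mat TYPE(real) n undefined)"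
    by (rule det_non_zero_imp_unit[OF A])
  then obtain B where B: "B \<in> carrier_mat n n" "A * B = 1\<^sub>m n" "B * A = 1\<^sub>m n"
    by (auto simp: Units_def ring_mat_simps)
  have BT: "transpose_mat B \<in> carrier_mat n n" using B by simp
  have AB: "transpose_mat A * transpose_mat B = 1\<^sub>m n" "transpose_mat B * transpose_mat A = 1\<^sub>m n"
    using B(2,3) transpose_mult[OF A B(1)] transpose_mult[OF B(1) A] transpose_one by metis+
  have comb: "comb n vs (($) w) = transpose_mat A *\<^sub>v w" if "w \<in> carrier_vec n" for w
    using mat_of_cols_mult_vec[OF assms(2), of w] that AT assms(1) by simp
  {
    assume v: "v \<in> carrier_vec n"
    let ?c = "transpose_mat B *\<^sub>v v"
    have c: "?c \<in> carrier_vec n" using BT v by auto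
    have "comb n vs (($) ?c) = (transpose_mat A * transpose_mat B) *\<^sub>v v"
      using comb[OF c] A BT v by (simp add: assoc_mult_mat_vec[of _ n n])
    then have "v = comb n vs (($) ?c)"
      using AB v by simp
    then show "\<exists>c. v = comb n vs c" by blast
  }
  {
    assume u: "u \<in> carrier_vec n"
    have "A *\<^sub>v (B *\<^sub>v u) = u"
      using assoc_mult_mat_vec[OF A B(1) u] B(2) u by simp
    then have "labels vs (B *\<^sub>v u) = u" using Av[of "B *\<^sub>v u"] B u by simp
    then show "\<exists>x\<in>carrier_vec n. labels vs x = u" using B u by (intro bexI[of _ "B *\<^sub>v u"]) auto
  }
  {
    assume z: "comb n vs c = 0\<^sub>v n"
    let ?w = "vec n c"
    have "transpose_mat A *\<^sub>v ?w = 0\<^sub>v n"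
      using comb[of ?w] z assms(1) by (simp add: comb_def)
    then have "(transpose_mat B * transpose_mat A) *\<^sub>v ?w = transpose_mat B *\<^sub>v 0\<^sub>v n"
      using A BT by (simp add: assoc_mult_mat_vec[of _ n n])
    then have "?w = 0\<^sub>v n" using AB BT by auto
    then have "c i = 0" if "i < n" for i
      using that by (metis index_vec index_zero_vec(1))
    then show "\<forall>i<length vs. c i = 0" using assms(1) by simp
  }
qed

lemma finite_bounded_vecs:
  assumes "finite S"
  shows "finite {u \<in> carrier_vec n. \<forall>i<n. u $ i \<in> S}"
proof -
  have "{u \<in> carrier_vec n. \<forall>i<n. u $ i \<in> S} \<subseteq> vec n ` PiE {..<n} (\<lambda>_. S)"
  proof
    fix u assume u: "u \<in> {u \<in> carrier_vec n. \<forall>i<n. u $ i \<in> S}"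
    then have "u = vec n (restrict (($) u) {..<n})" by (intro eq_vecI) auto
    moreover have "restrict (($) u) {..<n} \<in> PiE {..<n} (\<lambda>_. S)" using u by auto
    ultimately show "u \<in> vec n ` PiE {..<n} (\<lambda>_. S)" by blast
  qed
  then show ?thesis
    by (rule finite_subset) (intro finite_imageI finite_PiE assms finite_lessThan)
qed

text \<open>Labels embed the roots into the vectors with integer entries between -2 and 2.
  Injectivity comes from \<open>nondeg\<close>, the bounds from the nonnegative norms of v - vs ! i
  and v + vs ! i.\<close>

lemma lattice_roots_finite:
  assumes "root_list n vs" "nondeg n vs"
  shows "finite (lattice_roots n vs)"
proof -
  note R = root_listD[OF assms(1)]
  let ?S = "of_int ` {-2..2} :: real set"
  have "labels vs ` lattice_roots n vs \<subseteq> {u \<in> carrier_vec (length vs). \<forall>i<length vs. u $ i \<in> ?S}"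
  proof clarsimp
    fix v i assume v: "v \<in> lattice_roots n vs" and i: "i < length vs"
    have v': "v \<in> zlat n vs" "v \<in> carrier_vec n" "v \<bullet> v = 2"
      using v zlat_carrier by (auto simp: lattice_roots_def)
    obtain m where m: "v \<bullet> vs ! i = of_int m"
      using zlat_Ints[OF assms(1) v'(1) zlat_nth[OF i R(1)]] by (auto elim: Ints_cases)
    have "0 \<le> (v - 1 \<cdot>\<^sub>v vs ! i) \<bullet> (v - 1 \<cdot>\<^sub>v vs ! i)" "0 \<le> (v + 1 \<cdot>\<^sub>v vs ! i) \<bullet> (v + 1 \<cdot>\<^sub>v vs ! i)"
      by (rule scalar_prod_self_nonneg)+
    then have "\<bar>real_of_int m\<bar> \<le> 2"
      using norm_diff_smult[of v n "vs ! i" 1] norm_add_smult[of v n "vs ! i" 1] v' R i m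
      by simp
    then have "m \<in> {-2..2}" by auto
    then show "v \<bullet> vs ! i \<in> ?S" using m by auto
  qed
  then have "finite (labels vs ` lattice_roots n vs)"
    by (rule finite_subset) (intro finite_bounded_vecs finite_imageI, simp)
  moreover have "inj_on (labels vs) (lattice_roots n vs)"
    by (rule inj_on_subset[OF labels_inj[OF assms(2) R(1)]])
      (use zlat_carrier in \<open>auto simp: lattice_roots_def\<close>)
  ultimately show ?thesis by (rule finite_imageD)
qed

section \<open>Models of a diagram\<close>

definition short_weights :: "nat \<Rightarrow> real vec set \<Rightarrow> real vec set" where
  "short_weights l \<Lambda> = {x \<in> carrier_vec l. (\<forall>w\<in>\<Lambda>. x \<bullet> w \<in> \<int>) \<and> x \<noteq> 0\<^sub>v l \<and> x \<bullet> x < 2}"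

definition weight_class :: "nat \<Rightarrow> real vec set \<Rightarrow> real vec \<Rightarrow> real vec set" where
  "weight_class l \<Lambda> x = {y \<in> short_weights l \<Lambda>. y - x \<in> \<Lambda>}"

lemma cartan_carrier: "cartan \<Gamma> \<in> carrier_mat (rank \<Gamma>) (rank \<Gamma>)"
  by (simp add: cartan_def)

lemma cartan_cases:
  assumes "i < rank \<Gamma>" "j < rank \<Gamma>"
  shows "i = j \<Longrightarrow> cartan \<Gamma> $$ (i, j) = 2"
    and "i \<noteq> j \<Longrightarrow> cartan \<Gamma> $$ (i, j) \<in> {-1, 0, 1}"
  using assms by (auto simp: cartan_def)

lemma cartan_Ints:
  assumes "i < rank \<Gamma>" "j < rank \<Gamma>"
  shows "cartan \<Gamma> $$ (i, j) \<in> \<int>"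
  using assms by (simp add: cartan_def)

lemma root_list_of_gram:
  assumes "length vs = rank \<Gamma>" "set vs \<subseteq> carrier_vec n"
    "\<And>i j. i < rank \<Gamma> \<Longrightarrow> j < rank \<Gamma> \<Longrightarrow> vs ! i \<bullet> vs ! j = cartan \<Gamma> $$ (i, j)"
  shows "root_list n vs"
  using assms cartan_cases[of _ \<Gamma>] cartan_Ints[of _ \<Gamma>] by (simp add: root_list_def)

text \<open>Two equal vectors would produce an off-diagonal Gram entry 2, while these entries lie in
  {-1, 0, 1}.\<close>

lemma distinct_of_gram:
  assumes "length vs = rank \<Gamma>"
    "\<And>i j. i < rank \<Gamma> \<Longrightarrow> j < rank \<Gamma> \<Longrightarrow> vs ! i \<bullet> vs ! j = cartan \<Gamma> $$ (i, j)"
  shows "distinct vs"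
  unfolding distinct_conv_nth
proof (intro allI impI notI)
  fix i j assume *: "i < length vs" "j < length vs" "i \<noteq> j" "vs ! i = vs ! j"
  then have "cartan \<Gamma> $$ (i, j) = cartan \<Gamma> $$ (j, j)"
    using assms by metis
  then show False using cartan_cases[of i \<Gamma> j] cartan_cases[of j \<Gamma> j] * assms(1) by auto
qed

section \<open>Adjoining an orthogonal coordinate; linkage diagrams as short weights\<close>

definition extend :: "nat \<Rightarrow> real vec \<Rightarrow> real \<Rightarrow> real vec" where
  "extend l v t = vec (l + 1) (\<lambda>i. if i < l then v $ i else t)"

lemma extend_carrier [simp]: "extend l v t \<in> carrier_vec (Suc l)" "dim_vec (extend l v t) = Suc l"
  by (simp_all add: extend_def)

lemma extend_nth: "i < l \<Longrightarrow> extend l v t $ i = v $ i" "extend l v t $ l = t"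
  by (simp_all add: extend_def)

lemma extend_dot:
  assumes "w \<in> carrier_vec l"
  shows "extend l v s \<bullet> extend l w t = v \<bullet> w + s * t"
  using assms by (simp add: scalar_prod_def extend_def)

lemma extend_cases:
  assumes "x \<in> carrier_vec (l + 1)"
  obtains v t where "v \<in> carrier_vec l" "x = extend l v t"
proof
  show "vec l (($) x) \<in> carrier_vec l" by simp
  show "x = extend l (vec l (($) x)) (x $ l)"
    using assms by (intro eq_vecI) (auto simp: extend_def less_Suc_eq)
qed

lemma comb_extend:
  assumes "set vs \<subseteq> carrier_vec l"
  shows "comb (l + 1) (map (\<lambda>v. extend l v 0) vs) c = extend l (comb l vs c) 0"
  by (rule eq_vecI) (auto simp: comb_def extend_def)

text \<open>A reference realization in the smallest possible dimension. Every other realization has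
  the same Gram matrix, so statements about arbitrary ambient spaces are transported to this
  one.\<close>

locale model =
  fixes \<Gamma> :: diagram and \<tau>s :: "real vec list" and l :: nat
  assumes rank: "rank \<Gamma> = l" and len: "length \<tau>s = l" and car: "set \<tau>s \<subseteq> carrier_vec l"
    and gram: "i < l \<Longrightarrow> j < l \<Longrightarrow> \<tau>s ! i \<bullet> \<tau>s ! j = cartan \<Gamma> $$ (i, j)"
    and nondeg: "nondeg l \<tau>s"
begin

abbreviation "\<Lambda> \<equiv> zlat l \<tau>s"

lemma root_list: "root_list l \<tau>s"
  by (rule root_list_of_gram[of _ \<Gamma>]) (use rank len car gram in auto)

lemmas R = root_listD[OF root_list, unfolded len]
lemmas square = square_basis[OF len car nondeg]
lemmas lin_indep = square(3)

lemma labels_car [simp]: "labels \<tau>s x \<in> carrier_vec l"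
  using labels_carrier[of \<tau>s x] len by simp

lemma inj_labels: "inj_on (labels \<tau>s) (carrier_vec l)"
  using labels_inj[OF nondeg car] .

lemma short_weights_iff:
  "x \<in> short_weights l \<Lambda> \<longleftrightarrow>
     x \<in> carrier_vec l \<and> (\<forall>i<l. x \<bullet> \<tau>s ! i \<in> \<int>) \<and> x \<noteq> 0\<^sub>v l \<and> x \<bullet> x < 2" (is "_ \<longleftrightarrow> ?R")
proof
  assume "x \<in> short_weights l \<Lambda>"
  then show ?R using zlat_nth[of _ \<tau>s l] car len by (auto simp: short_weights_def)
next
  assume r: ?R
  have "x \<bullet> w \<in> \<int>" if w: "w \<in> \<Lambda>" for w
  proof -
    have wc: "w \<in> carrier_vec l" using w zlat_carrier by blast
    have "w \<bullet> x \<in> \<int>"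
    proof (rule zlat_dot_Ints[OF w])
      fix i assume "i < length \<tau>s"
      then show "\<tau>s ! i \<bullet> x \<in> \<int>" using r comm_scalar_prod[of x l "\<tau>s ! i"] R len by auto
    qed (use r in simp)
    then show ?thesis using comm_scalar_prod[OF wc, of x] r by simp
  qed
  with r show "x \<in> short_weights l \<Lambda>"
    by (simp add: short_weights_def)
qed

lemma realizes_gram:
  assumes "realizes n \<Gamma> ts"
  shows "length ts = l" "set ts \<subseteq> carrier_vec n"
    "\<And>i j. i < l \<Longrightarrow> j < l \<Longrightarrow> ts ! i \<bullet> ts ! j = \<tau>s ! i \<bullet> \<tau>s ! j"
  using assms rank gram by (auto simp: realizes_def)

text \<open>Equal coefficients define an isometry between the span of any realization and the model
  space.\<close>

lemma realizes_comb_inner: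
  assumes "realizes n \<Gamma> ts"
  shows "comb n ts c \<bullet> comb n ts d = comb l \<tau>s c \<bullet> comb l \<tau>s d"
  using realizes_gram[OF assms] len by (simp add: comb_inner car)

lemma linked_label:
  assumes "linked n \<Phi> \<Gamma> ts \<gamma>"
  obtains x where "x \<in> short_weights l \<Lambda>" "labels ts \<gamma> = labels \<tau>s x"
proof -
  have \<Phi>: "simply_laced_root_system n \<Phi>" "set ts \<subseteq> \<Phi>" and re: "realizes n \<Gamma> ts"
    and \<gamma>: "\<gamma> \<in> \<Phi>" "\<gamma> \<notin> rspan n (set ts)" "labels ts \<gamma> \<noteq> 0\<^sub>v l"
    using assms rank by (auto simp: linked_def)
  note G = realizes_gram[OF re]
  have \<gamma>c: "\<gamma> \<in> carrier_vec n" and \<gamma>2: "\<gamma> \<bullet> \<gamma> = 2"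
    using \<Phi> \<gamma> by (auto simp: simply_laced_root_system_def root_system_def)
  obtain x where x: "x \<in> carrier_vec l" "labels \<tau>s x = labels ts \<gamma>"
    using square(2)[of "labels ts \<gamma>"] labels_carrier[of ts \<gamma>] G(1) by auto
  have xi: "x \<bullet> \<tau>s ! i = \<gamma> \<bullet> ts ! i" if "i < l" for i
    using x(2) that G(1) len by (metis labels_nth)
  have int: "\<gamma> \<bullet> ts ! i \<in> \<int>" if i: "i < l" for i
  proof -
    have "ts ! i \<in> \<Phi>" using i G \<Phi>(2) by auto
    then have "2 * (\<gamma> \<bullet> ts ! i) / (ts ! i \<bullet> ts ! i) \<in> \<int>" "ts ! i \<bullet> ts ! i = 2"
      using \<Phi>(1) \<gamma>(1) by (auto simp: simply_laced_root_system_def root_system_def)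
    then show ?thesis by simp
  qed
  have "x \<noteq> 0\<^sub>v l"
  proof
    assume "x = 0\<^sub>v l"
    then have "labels \<tau>s x = 0\<^sub>v l" using len labels_zero[OF car] by simp
    with x \<gamma> show False by simp
  qed
  obtain c where c: "x = comb l \<tau>s c" using square(1) x(1) by blast
  \<comment> \<open>The orthogonal projection of \<gamma> to the span, copied from the model by
    using the coefficients of x. The next computations give \<gamma> \<bullet> ?p = ?p \<bullet> ?p
    = x \<bullet> x, so the orthogonal part has norm 2 - x \<bullet> x.\<close>
  let ?p = "comb n ts c"
  have "?p \<bullet> \<gamma> = (\<Sum>i<l. c i * (ts ! i \<bullet> \<gamma>))" using comb_dot[OF \<gamma>c] G(1) by simp
  also have "\<dots> = (\<Sum>i<l. c i * (\<tau>s ! i \<bullet> x))"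
  proof (intro sum.cong refl)
    fix i assume "i \<in> {..<l}"
    then show "c i * (ts ! i \<bullet> \<gamma>) = c i * (\<tau>s ! i \<bullet> x)"
      using xi[of i] comm_scalar_prod[of "ts ! i" n \<gamma>] comm_scalar_prod[of "\<tau>s ! i" l x]
        nth_carrier[OF G(2)] G(1) R \<gamma>c x(1)
      by simp
  qed
  also have "\<dots> = x \<bullet> x" using comb_dot[OF x(1), of \<tau>s c] c len by simp
  finally have p\<gamma>: "\<gamma> \<bullet> ?p = x \<bullet> x" using comm_scalar_prod[OF \<gamma>c, of ?p] by simp
  have pp: "?p \<bullet> ?p = x \<bullet> x" using realizes_comb_inner[OF re] c by simp
  \<comment> \<open>Here \<gamma> lying outside the span is turned into the strict
    inequality.\<close>
  have "\<gamma> \<noteq> ?p" using comb_in_span[OF G(2)] \<gamma>(2) by metis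
  then have "(\<gamma> - ?p) \<bullet> (\<gamma> - ?p) \<noteq> 0" using eq_if_norm_diff_0[OF \<gamma>c] by auto
  then have "0 < (\<gamma> - ?p) \<bullet> (\<gamma> - ?p)" using scalar_prod_self_nonneg[of "\<gamma> - ?p"] by linarith
  also have "\<dots> = 2 - x \<bullet> x"
    using norm_diff_smult[OF \<gamma>c, of ?p 1] p\<gamma> pp \<gamma>2 by simp
  finally have "x \<bullet> x < 2" by simp
  then show thesis
    using that[of x] short_weights_iff x xi int \<open>x \<noteq> 0\<^sub>v l\<close> by auto
qed

text \<open>The new root is x completed by a last coordinate h, and the root system consists of all
  norm 2 vectors of the lattice generated together with the lifted roots. Integrality of the labels
  of x is what makes this enlarged list integral.\<close>

lemma linked_exists:
  assumes x: "x \<in> short_weights l \<Lambda>"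
  shows "\<exists>n \<Phi> ts \<gamma>. linked n \<Phi> \<Gamma> ts \<gamma> \<and> labels ts \<gamma> = labels \<tau>s x"
proof -
  have x': "x \<in> carrier_vec l" "\<And>i. i < l \<Longrightarrow> x \<bullet> \<tau>s ! i \<in> \<int>" "x \<noteq> 0\<^sub>v l" "x \<bullet> x < 2"
    using x short_weights_iff by auto
  define h where "h = sqrt (2 - x \<bullet> x)"
  have h: "0 < h" "h * h = 2 - x \<bullet> x" using x'(4) by (auto simp: h_def)
  define ts where "ts = map (\<lambda>v. extend l v 0) \<tau>s"
  define \<gamma> where "\<gamma> = extend l x h"
  define W where "W = ts @ [\<gamma>]"
  have lents: "length ts = l" by (simp add: ts_def len)
  have ts_i: "ts ! i = extend l (\<tau>s ! i) 0" if "i < l" for i using that len by (simp add: ts_def)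
  have tscar: "set ts \<subseteq> carrier_vec (l + 1)" by (auto simp: ts_def)
  have tsdot: "ts ! i \<bullet> ts ! j = cartan \<Gamma> $$ (i, j)" if "i < l" "j < l" for i j
    using that ts_i R gram extend_dot by simp
  have tsg: "ts ! i \<bullet> \<gamma> = \<tau>s ! i \<bullet> x" "\<gamma> \<bullet> ts ! i = x \<bullet> \<tau>s ! i" if "i < l" for i
    using that ts_i R x' extend_dot by (simp_all add: \<gamma>_def)
  have gg: "\<gamma> \<bullet> \<gamma> = 2" using x' h extend_dot by (simp add: \<gamma>_def)
  have lenW: "length W = l + 1" using lents by (simp add: W_def)
  have Wcar: "set W \<subseteq> carrier_vec (l + 1)" using tscar by (auto simp: W_def \<gamma>_def)
  have W_i: "W ! i = ts ! i" if "i < l" for i using that lents by (simp add: W_def nth_append)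
  have W_l: "W ! l = \<gamma>" using lents by (simp add: W_def nth_append)
  have rlW: "root_list (l + 1) W"
    unfolding root_list_def lenW
  proof (intro conjI allI impI Wcar)
    fix i assume "i < l + 1"
    then consider "i < l" | "i = l" by linarith
    then show "W ! i \<bullet> W ! i = 2"
      by cases (use W_i W_l tsdot cartan_cases rank gg in auto)
    fix j assume "j < l + 1"
    have "\<tau>s ! i \<bullet> x \<in> \<int>" if "i < l" for i
      using x'(1) x'(2)[OF that] comm_scalar_prod[of x l "\<tau>s ! i"] R that by simp
    then show "W ! i \<bullet> W ! j \<in> \<int>"
      using \<open>i < l + 1\<close> \<open>j < l + 1\<close> W_i W_l tsdot tsg x'(2) gg cartan_Ints rank
      by (cases "i < l"; cases "j < l") (auto simp: less_Suc_eq)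
  qed
  have ndW: "nondeg (l + 1) W"
    unfolding nondeg_def lenW
  proof (intro ballI impI)
    fix v assume v: "v \<in> carrier_vec (l + 1)" "\<forall>i<l + 1. v \<bullet> W ! i = 0"
    obtain y t where y: "y \<in> carrier_vec l" "v = extend l y t" using extend_cases[OF v(1)] by blast
    have "y \<bullet> \<tau>s ! i = 0" if i: "i < l" for i
    proof -
      have "v \<bullet> W ! i = 0" using v(2) i by simp
      then show ?thesis using i W_i ts_i y extend_dot[of "\<tau>s ! i" l y t 0] R by simp
    qed
    then have y0: "y = 0\<^sub>v l" using nondeg y(1) len by (auto simp: nondeg_def)
    have "v \<bullet> \<gamma> = 0" using v(2) W_l by auto
    then have "t * h = 0" using y y0 extend_dot[of x l y t h] x' by (simp add: \<gamma>_def)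
    then have "t = 0" using h by simp
    then show "v = 0\<^sub>v (l + 1)" using y y0 by (intro eq_vecI) (auto simp: extend_def)
  qed
  let ?\<Phi> = "lattice_roots (l + 1) W"
  have "rspan (l + 1) (set W) = carrier_vec (l + 1)"
  proof (rule span_carrierI[OF Wcar])
    fix k assume "k < l + 1"
    have "unit_vec (l + 1) k \<in> carrier_vec (l + 1)" by simp
    then obtain c where "unit_vec (l + 1) k = comb (l + 1) W c"
      using square_basis(1)[OF lenW Wcar ndW] by blast
    then show "unit_vec (l + 1) k \<in> rspan (l + 1) (set W)" using comb_in_span[OF Wcar] by metis
  qed
  then have sl: "simply_laced_root_system (l + 1) ?\<Phi>"
    using lattice_roots_root_system[OF rlW lattice_roots_finite[OF rlW ndW]] by blast
  have W\<Phi>: "set W \<subseteq> ?\<Phi>"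
    using zlat_base[OF Wcar] root_listD(3)[OF rlW] by (auto simp: lattice_roots_def in_set_conv_nth)
  have dts: "distinct ts"
    by (rule distinct_of_gram[of _ \<Gamma>]) (use rank lents tsdot in auto)
  have "\<not> rlin_dep (l + 1) (set ts)"
    unfolding lin_indep_iff[OF tscar dts]
  proof (intro allI impI)
    fix c i assume c: "comb (l + 1) ts c = 0\<^sub>v (l + 1)" and i: "i < length ts"
    have "extend l (comb l \<tau>s c) 0 = 0\<^sub>v (l + 1)" using c comb_extend[OF car] by (simp add: ts_def)
    then have "comb l \<tau>s c $ k = 0" if "k < l" for k
      using that extend_nth(1)[of k l "comb l \<tau>s c" 0] by simp
    then have "comb l \<tau>s c = 0\<^sub>v l" by (intro eq_vecI) auto
    then show "c i = 0" using lin_indep i lents len by auto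
  qed
  then have re: "realizes (l + 1) \<Gamma> ts"
    using lents rank tscar dts tsdot by (simp add: realizes_def)
  have lab: "labels ts \<gamma> = labels \<tau>s x"
    using lents len tsg by (intro eq_vecI) (auto simp: labels_def)
  have "\<gamma> \<notin> rspan (l + 1) (set ts)"
  proof
    interpret vec_space "TYPE(real)" "l + 1" .
    assume "\<gamma> \<in> span (set ts)"
    then obtain a A where A: "\<gamma> = lincomb a A" "finite A" "A \<subseteq> set ts" using in_spanE by blast
    \<comment> \<open>All lifted roots have last coordinate 0, while that of \<gamma> is h >
      0.\<close>
    then have "\<gamma> $ l = (\<Sum>v\<in>A. a v * v $ l)" using lincomb_index[of l A a] tscar by auto
    also have "\<dots> = 0" using A(3) by (intro sum.neutral) (auto simp: ts_def extend_nth)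
    finally show False using h by (simp add: \<gamma>_def extend_nth)
  qed
  moreover have "labels \<tau>s x \<noteq> 0\<^sub>v l"
  proof
    assume "labels \<tau>s x = 0\<^sub>v l"
    then have "\<forall>i<length \<tau>s. x \<bullet> \<tau>s ! i = 0" using len by (metis index_zero_vec(1) labels_nth)
    then show False using nondeg x' by (auto simp: nondeg_def)
  qed
  ultimately have "linked (l + 1) ?\<Phi> \<Gamma> ts \<gamma>"
    using sl W\<Phi> re lab rank by (auto simp: linked_def W_def)
  then show ?thesis using lab by blast
qed

lemma linkage_system_eq: "linkage_system \<Gamma> = labels \<tau>s ` short_weights l \<Lambda>"
proof
  show "linkage_system \<Gamma> \<subseteq> labels \<tau>s ` short_weights l \<Lambda>"
    unfolding linkage_system_def using linked_label by blast
  show "labels \<tau>s ` short_weights l \<Lambda> \<subseteq> linkage_system \<Gamma>"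
    unfolding linkage_system_def using linked_exists by (smt (verit) image_subsetI mem_Collect_eq)
qed

lemma labels_comb:
  assumes "y \<in> carrier_vec l"
  shows "labels \<tau>s (comb l \<tau>s (($) y)) = cartan \<Gamma> *\<^sub>v y"
proof (rule eq_vecI)
  show d: "dim_vec (labels \<tau>s (comb l \<tau>s (($) y))) = dim_vec (cartan \<Gamma> *\<^sub>v y)"
    using len rank cartan_carrier[of \<Gamma>] by (simp add: labels_def)
  fix i assume "i < dim_vec (cartan \<Gamma> *\<^sub>v y)"
  then have i: "i < l" using cartan_carrier[of \<Gamma>] rank by auto
  have "labels \<tau>s (comb l \<tau>s (($) y)) $ i = (\<Sum>j<l. y $ j * cartan \<Gamma> $$ (j, i))"
    using i len comb_dot[of "\<tau>s ! i" l \<tau>s] R gram by simp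
  also have "\<dots> = (\<Sum>j<l. cartan \<Gamma> $$ (i, j) * y $ j)"
  proof (intro sum.cong refl)
    fix j assume "j \<in> {..<l}"
    then show "y $ j * cartan \<Gamma> $$ (j, i) = cartan \<Gamma> $$ (i, j) * y $ j"
      using gram[of i j] gram[of j i] comm_scalar_prod[of "\<tau>s ! i" l "\<tau>s ! j"] R i by auto
  qed
  also have "\<dots> = (cartan \<Gamma> *\<^sub>v y) $ i"
    using i assms rank cartan_carrier[of \<Gamma>] by (simp add: scalar_prod_def lessThan_atLeast0)
  finally show "labels \<tau>s (comb l \<tau>s (($) y)) $ i = (cartan \<Gamma> *\<^sub>v y) $ i" .
qed

text \<open>By \<open>labels_comb\<close> the Cartan matrix turns coefficients into labels, so its
  inverse recovers the coefficients y of x. The form then pairs coefficients with labels, and \<Sum>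
  y_i (\<tau>_i \<bullet> x) is x \<bullet> x.\<close>

lemma dual_form_labels:
  assumes x: "x \<in> carrier_vec l"
  shows "dual_form \<Gamma> (labels \<tau>s x) = x \<bullet> x"
proof -
  have C: "cartan \<Gamma> \<in> carrier_mat l l" using cartan_carrier[of \<Gamma>] rank by simp
  have "det (cartan \<Gamma>) \<noteq> 0"
  proof
    assume "det (cartan \<Gamma>) = 0"
    then obtain y where y: "y \<in> carrier_vec l" "y \<noteq> 0\<^sub>v l" "cartan \<Gamma> *\<^sub>v y = 0\<^sub>v l"
      using det_0_iff_vec_prod_zero[OF C] by blast
    have "labels \<tau>s (comb l \<tau>s (($) y)) = labels \<tau>s (0\<^sub>v l)"
      using y len by (simp add: labels_comb labels_zero[OF car])
    then have "comb l \<tau>s (($) y) = 0\<^sub>v l" using inj_onD[OF inj_labels] by auto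
    then have "\<forall>i<l. y $ i = 0" using lin_indep len by auto
    with y show False by (metis carrier_vecD eq_vecI index_zero_vec)
  qed
  then have U: "cartan \<Gamma> \<in> Units (ring_mat TYPE(real) l ())"
    by (rule det_non_zero_imp_unit[OF C])
  then obtain B where B: "mat_inverse (cartan \<Gamma>) = Some B"
    using mat_inverse(1)[OF C, where b = "()"] by fastforce
  have CB: "cartan \<Gamma> * B = 1\<^sub>m l" "B \<in> carrier_mat l l"
    using mat_inverse(2)[OF C B] by auto
  let ?u = "labels \<tau>s x"
  define y where "y = B *\<^sub>v ?u"
  have y: "y \<in> carrier_vec l" using CB by (auto simp: y_def)
  have "labels \<tau>s (comb l \<tau>s (($) y)) = (cartan \<Gamma> * B) *\<^sub>v ?u"
    using labels_comb[OF y] assoc_mult_mat_vec[OF C CB(2) labels_car] by (simp add: y_def)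
  also have "\<dots> = ?u" using CB by simp
  finally have cx: "comb l \<tau>s (($) y) = x" using inj_onD[OF inj_labels] x by auto
  have "?u \<bullet> y = (\<Sum>i<l. (x \<bullet> \<tau>s ! i) * y $ i)"
    using y len by (simp add: scalar_prod_def[of ?u] lessThan_atLeast0)
  also have "\<dots> = (\<Sum>i<l. y $ i * (\<tau>s ! i \<bullet> x))"
    using R x by (intro sum.cong) (auto simp: comm_scalar_prod[of x l])
  also have "\<dots> = comb l \<tau>s (($) y) \<bullet> x" using comb_dot[OF x, of \<tau>s] len by simp
  also have "\<dots> = x \<bullet> x" using cx by simp
  finally show ?thesis using B by (simp add: dual_form_def y_def)
qed

end

section \<open>Components as cosets of the lattice\<close>

text \<open>Generators that are their own inverses make closure under the generators the same as
  closure under the generated group. Orbits can then be handled one reflection at a time, without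
  words in the group.\<close>

lemma orbit_of_involutions:
  fixes F :: "('a \<Rightarrow> 'a) set"
  assumes F: "\<And>f x. f \<in> F \<Longrightarrow> x \<in> S \<Longrightarrow> f x \<in> S" "\<And>f x. f \<in> F \<Longrightarrow> x \<in> S \<Longrightarrow> f (f x) = x"
    and u: "u \<in> S"
  defines "W \<equiv> generate (BijGroup S) {restrict f S | f. f \<in> F}"
  shows "u \<in> {w u | w. w \<in> W}"
    and "v \<in> {w u | w. w \<in> W} \<Longrightarrow> f \<in> F \<Longrightarrow> f v \<in> {w u | w. w \<in> W}"
    and "C \<subseteq> S \<Longrightarrow> u \<in> C \<Longrightarrow> (\<And>f v. f \<in> F \<Longrightarrow> v \<in> C \<Longrightarrow> f v \<in> C) \<Longrightarrow> {w u | w. w \<in> W} \<subseteq> C"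
proof -
  interpret group "BijGroup S" by (rule group_BijGroup)
  let ?H = "{restrict f S | f. f \<in> F}"
  have inv: "restrict f S \<in> Bij S" if f: "f \<in> F" for f
  proof -
    have "bij_betw f S S"
      by (rule bij_betw_byWitness[of _ f]) (use F f in auto)
    then show ?thesis by (simp add: Bij_def cong: bij_betw_cong)
  qed
  have carB: "carrier (BijGroup S) = Bij S" by (simp add: BijGroup_def)
  have H: "?H \<subseteq> carrier (BijGroup S)" unfolding carB using inv by blast
  have mult: "(g \<otimes>\<^bsub>BijGroup S\<^esub> h) x = g (h x)" if "g \<in> Bij S" "h \<in> Bij S" "x \<in> S" for g h x
    using that by (simp add: BijGroup_def compose_def)
  have WB: "w \<in> Bij S" if "w \<in> W" for w
    using generate_in_carrier[OF H] that carB by (simp add: W_def)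
  have "\<one>\<^bsub>BijGroup S\<^esub> u = u" using u by (simp add: BijGroup_def)
  moreover have "\<one>\<^bsub>BijGroup S\<^esub> \<in> W" unfolding W_def by (rule generate.one)
  ultimately show "u \<in> {w u | w. w \<in> W}"
    by (intro CollectI exI[of _ "\<one>\<^bsub>BijGroup S\<^esub>"] conjI) (rule sym)
  {
    assume v: "v \<in> {w u | w. w \<in> W}" and f: "f \<in> F"
    then obtain w where w: "w \<in> W" "v = w u" by blast
    have "restrict f S \<otimes>\<^bsub>BijGroup S\<^esub> w \<in> W"
      using w(1) f unfolding W_def by (blast intro: generate.eng generate.incl)
    moreover have "(restrict f S \<otimes>\<^bsub>BijGroup S\<^esub> w) u = f v"
      using mult[OF inv[OF f] WB[OF w(1)] u] w u WB[OF w(1)] Bij_imp_funcset[of w S] by auto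
    ultimately show "f v \<in> {w u | w. w \<in> W}"
      by (intro CollectI exI[of _ "restrict f S \<otimes>\<^bsub>BijGroup S\<^esub> w"] conjI) (rule sym)
  }
  {
    assume C: "C \<subseteq> S" "u \<in> C" "\<And>f v. f \<in> F \<Longrightarrow> v \<in> C \<Longrightarrow> f v \<in> C"
    have "\<forall>v\<in>C. w v \<in> C" if "w \<in> W" for w
      using that unfolding W_def
    proof induction
      case one
      then show ?case using C(1) by (auto simp: BijGroup_def)
    next
      case (incl h)
      then show ?case using C by auto
    next
      case (inv h)
      then obtain f where f: "f \<in> F" "h = restrict f S" by blast
      have hB: "h \<in> Bij S" using H inv carB by blast
      have "h \<otimes>\<^bsub>BijGroup S\<^esub> h = compose S h h" using hB by (simp add: BijGroup_def)
      also have "\<dots> = (\<lambda>x\<in>S. x)"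
        using f F by (auto simp: compose_def restrict_def)
      finally have "h \<otimes>\<^bsub>BijGroup S\<^esub> h = \<one>\<^bsub>BijGroup S\<^esub>" by (simp add: BijGroup_def)
      then have "inv\<^bsub>BijGroup S\<^esub> h = h" using hB carB by (intro inv_equality) auto
      then show ?case using f C by auto
    next
      case (eng h1 h2)
      then have "h1 \<in> Bij S" "h2 \<in> Bij S" using WB by (auto simp: W_def)
      then show ?case using eng C(1) mult by auto
    qed
    then show "{w u | w. w \<in> W} \<subseteq> C" using C(2) by blast
  }
qed

context model
begin

lemma reflect_weight:
  assumes i: "i < l" and x: "x \<in> short_weights l \<Lambda>"
  shows "reflect (\<tau>s ! i) x \<in> short_weights l \<Lambda>"
    and "\<exists>m::int. x \<bullet> \<tau>s ! i = of_int m \<and> \<bar>m\<bar> \<le> 1"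
    and "reflect (\<tau>s ! i) x = x - (x \<bullet> \<tau>s ! i) \<cdot>\<^sub>v \<tau>s ! i"
proof -
  let ?r = "\<tau>s ! i"
  have r: "?r \<in> carrier_vec l" "?r \<bullet> ?r = 2" using R i by auto
  have x': "x \<in> carrier_vec l" "\<And>i. i < l \<Longrightarrow> x \<bullet> \<tau>s ! i \<in> \<int>" "x \<noteq> 0\<^sub>v l" "x \<bullet> x < 2"
    using x short_weights_iff by auto
  show eq: "reflect ?r x = x - (x \<bullet> ?r) \<cdot>\<^sub>v ?r" using r by (simp add: reflect_norm2)
  have nr: "reflect ?r x \<bullet> reflect ?r x = x \<bullet> x" using reflect_isometry[OF r(2,1) x'(1)] .
  obtain m where m: "x \<bullet> ?r = of_int m" using x'(2)[OF i] by (auto elim: Ints_cases)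
  have "reflect ?r x \<bullet> \<tau>s ! j \<in> \<int>" if j: "j < l" for j
  proof -
    have "reflect ?r x \<bullet> \<tau>s ! j = x \<bullet> \<tau>s ! j - of_int m * (?r \<bullet> \<tau>s ! j)"
      using minus_scalar_prod_distrib[of x l "(x \<bullet> ?r) \<cdot>\<^sub>v ?r" "\<tau>s ! j"] R x' r j m eq by simp
    then show ?thesis using x'(2)[OF j] R(4)[OF i j] by simp
  qed
  moreover have "reflect ?r x \<noteq> 0\<^sub>v l"
    using nr scalar_prod_self_pos[OF x'(1,3)] by auto
  moreover have "reflect ?r x \<in> carrier_vec l" using eq x' r by auto
  ultimately show "reflect ?r x \<in> short_weights l \<Lambda>" using nr x' short_weights_iff by auto
  \<comment> \<open>Cauchy-Schwarz: m / 2 is the multiple of the root closest to x, and the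
    resulting bound is m^2 \<le> 2 (x \<bullet> x) < 4.\<close>
  have "0 \<le> (x - (of_int m / 2) \<cdot>\<^sub>v ?r) \<bullet> (x - (of_int m / 2) \<cdot>\<^sub>v ?r)"
    by (rule scalar_prod_self_nonneg)
  then have "(real_of_int m)\<^sup>2 \<le> 2 * (x \<bullet> x)"
    using norm_diff_smult[OF x'(1) r(1), of "of_int m / 2"] r m
    by (simp add: power2_eq_square field_simps)
  then have "(real_of_int m)\<^sup>2 < 2\<^sup>2" using x' by simp
  then have "\<bar>real_of_int m\<bar> < 2" by (metis abs_numeral power2_less_imp_less abs_ge_zero power2_abs zero_le_numeral)
  then have "\<bar>m\<bar> \<le> 1" by linarith
  with m show "\<exists>m::int. x \<bullet> \<tau>s ! i = of_int m \<and> \<bar>m\<bar> \<le> 1" by blast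
qed

lemma short_weights_car: "x \<in> short_weights l \<Lambda> \<Longrightarrow> x \<in> carrier_vec l"
  by (simp add: short_weights_def)

text \<open>Two short weights in the same coset of the lattice are connected: if \<open>v = x - y\<close> and
  \<open>\<plusminus>\<tau>\<close> has positive product with \<open>v\<close>, then reflecting one of \<open>x\<close>, \<open>y\<close> in \<open>\<tau>\<close> shortens \<open>v\<close> by
  the term \<open>\<plusminus>\<tau>\<close>, since weights of norm less than 2 have product at most 1 with a root.\<close>

lemma connected:
  assumes "v \<in> \<Lambda>" "x \<in> short_weights l \<Lambda>" "y \<in> short_weights l \<Lambda>" "x - y = v"
    and "y \<in> Q" and Q: "\<And>x i. x \<in> short_weights l \<Lambda> \<Longrightarrow> x \<in> Q \<Longrightarrow> i < l \<Longrightarrow> reflect (\<tau>s ! i) x \<in> Q"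
  shows "x \<in> Q"
  using assms(1) car assms(2-5)
proof (induction arbitrary: x y rule: zlat_descent)
  case zero
  then have "x = y"
    using eq_if_norm_diff_0[of x l y] short_weights_car by auto
  with zero show ?case by simp
next
  case (step v j s)
  let ?r = "\<tau>s ! j"
  have j: "j < l" using step len by simp
  have r: "?r \<in> carrier_vec l" "?r \<bullet> ?r = 2" using R j by auto
  have xc: "x \<in> carrier_vec l" and yc: "y \<in> carrier_vec l" using step short_weights_car by auto
  obtain a where a: "x \<bullet> ?r = of_int a" "\<bar>a\<bar> \<le> 1" using reflect_weight(2)[OF j] step by blast
  obtain b where b: "y \<bullet> ?r = of_int b" "\<bar>b\<bar> \<le> 1" using reflect_weight(2)[OF j] step by blast
  obtain t :: int where t: "s = of_int t" "t = 1 \<or> t = -1"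
    using step.hyps by (metis of_int_1 of_int_minus)
  have "v \<bullet> ?r = of_int (a - b)"
    using minus_scalar_prod_distrib[OF xc yc r(1)] step.prems a b by simp
  then have "0 < t * (a - b)"
    using step.hyps t by (metis of_int_0_less_iff of_int_mult)
  \<comment> \<open>With a and b in {-1, 0, 1}, a positive t * (a - b) forces one of them to be
    extreme in the direction t.\<close>
  then consider "a = t" | "b = -t" using t a b by fastforce
  then show ?case
  proof cases
    case 1
    let ?x = "reflect ?r x"
    have "?x - y = v - s \<cdot>\<^sub>v ?r"
      using reflect_weight(3)[OF j] step.prems a t 1 xc yc r by (intro eq_vecI) auto
    then have "?x \<in> Q"
      using step.IH[of ?x y] reflect_weight(1)[OF j] step.prems by blast
    then have "reflect ?r ?x \<in> Q" using Q reflect_weight(1)[OF j] step.prems j by blast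
    then show ?thesis using reflect_involution[OF r(2,1) xc] by simp
  next
    case 2
    let ?y = "reflect ?r y"
    have "x - ?y = v - s \<cdot>\<^sub>v ?r"
      using reflect_weight(3)[OF j, of y] step.prems b t 2 xc yc r by (intro eq_vecI) auto
    then show ?thesis
      using step.IH[of x ?y] reflect_weight(1)[OF j] step.prems Q[of y j] j by blast
  qed
qed

text \<open>Column i of the Cartan matrix is the label vector of \<tau>_i, so the dual reflection is
  the ordinary one read through labels.\<close>

lemma dual_reflection_labels:
  assumes "i < l" "x \<in> carrier_vec l"
  shows "dual_reflection \<Gamma> i (labels \<tau>s x) = labels \<tau>s (reflect (\<tau>s ! i) x)"
proof (rule eq_vecI)
  show "dim_vec (dual_reflection \<Gamma> i (labels \<tau>s x)) = dim_vec (labels \<tau>s (reflect (\<tau>s ! i) x))"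
    using len rank cartan_carrier[of \<Gamma>] by (simp add: dual_reflection_def labels_def)
  fix j assume "j < dim_vec (labels \<tau>s (reflect (\<tau>s ! i) x))"
  then have j: "j < l" using len by (simp add: labels_def)
  have "reflect (\<tau>s ! i) x \<bullet> \<tau>s ! j = x \<bullet> \<tau>s ! j - (x \<bullet> \<tau>s ! i) * (\<tau>s ! i \<bullet> \<tau>s ! j)"
    using minus_scalar_prod_distrib[of x l "(x \<bullet> \<tau>s ! i) \<cdot>\<^sub>v \<tau>s ! i" "\<tau>s ! j"]
      smult_scalar_prod_distrib[of "\<tau>s ! i" l "\<tau>s ! j"] R assms j
    by (simp add: reflect_norm2)
  moreover have "\<tau>s ! i \<bullet> \<tau>s ! j = cartan \<Gamma> $$ (j, i)"
    using gram[of j i] comm_scalar_prod[of "\<tau>s ! i" l "\<tau>s ! j"] R assms j by auto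
  ultimately show "dual_reflection \<Gamma> i (labels \<tau>s x) $ j = labels \<tau>s (reflect (\<tau>s ! i) x) $ j"
    using j assms len rank cartan_carrier[of \<Gamma>] by (simp add: dual_reflection_def)
qed

text \<open>A reflection subtracts an integer multiple of a root, which keeps orbits inside a coset;
  \<open>connected\<close> shows that they fill its short vectors.\<close>

lemma orbit_eq:
  assumes x: "x \<in> short_weights l \<Lambda>"
  shows "{w (labels \<tau>s x) | w. w \<in> dual_weyl_group \<Gamma>} = labels \<tau>s ` weight_class l \<Lambda> x"
proof -
  let ?F = "{dual_reflection \<Gamma> i | i. i < l}"
  let ?u = "labels \<tau>s x"
  let ?Orb = "{w ?u | w. w \<in> dual_weyl_group \<Gamma>}"
  have W: "dual_weyl_group \<Gamma> = generate (BijGroup (carrier_vec l)) {restrict f (carrier_vec l) | f. f \<in> ?F}"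
    unfolding dual_weyl_group_def rank by (rule arg_cong[where f = "generate _"]) blast
  have F: "f u \<in> carrier_vec l \<and> f (f u) = u" if f: "f \<in> ?F" and u: "u \<in> carrier_vec l" for f u
  proof -
    obtain i where i: "i < l" "f = dual_reflection \<Gamma> i" using f by blast
    obtain z where z: "z \<in> carrier_vec l" "labels \<tau>s z = u" using square(2)[OF u] by blast
    have zr: "reflect (\<tau>s ! i) z \<in> carrier_vec l" using R i z by (simp add: reflect_norm2)
    show ?thesis
      using dual_reflection_labels[OF i(1) z(1)] dual_reflection_labels[OF i(1) zr] z i
        reflect_involution[of "\<tau>s ! i" l z] R by (metis labels_car)
  qed
  have uc: "?u \<in> carrier_vec l" by simp
  note orb = orbit_of_involutions[of ?F "carrier_vec l" ?u, folded W]
  have x0: "x \<in> weight_class l \<Lambda> x"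
    using x short_weights_car[OF x] by (simp add: weight_class_def)
  show ?thesis
  proof
    show "?Orb \<subseteq> labels \<tau>s ` weight_class l \<Lambda> x"
    proof (rule orb(3))
      show "labels \<tau>s ` weight_class l \<Lambda> x \<subseteq> carrier_vec l" by auto
      show "?u \<in> labels \<tau>s ` weight_class l \<Lambda> x" using x0 by blast
      fix f v assume "f \<in> ?F" "v \<in> labels \<tau>s ` weight_class l \<Lambda> x"
      then obtain i y where iy: "i < l" "f = dual_reflection \<Gamma> i" "v = labels \<tau>s y"
        "y \<in> weight_class l \<Lambda> x" by blast
      then have y: "y \<in> short_weights l \<Lambda>" "y - x \<in> \<Lambda>" by (auto simp: weight_class_def)
      have yc: "y \<in> carrier_vec l" using y short_weights_car by blast
      have xc: "x \<in> carrier_vec l" using x short_weights_car by blast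
      have rc: "\<tau>s ! i \<in> carrier_vec l" using R(2) iy by blast
      obtain m where m: "y \<bullet> \<tau>s ! i = of_int m" using reflect_weight(2)[OF iy(1) y(1)] by blast
      have "reflect (\<tau>s ! i) y - x = (y - x) - of_int m \<cdot>\<^sub>v \<tau>s ! i"
        using reflect_weight(3)[OF iy(1) y(1)] m xc yc rc by (intro eq_vecI) auto
      then have "reflect (\<tau>s ! i) y - x \<in> \<Lambda>"
        using zlat_diff[OF y(2) zlat_smult_nth[of i \<tau>s l m]] iy len car by simp
      then have "reflect (\<tau>s ! i) y \<in> weight_class l \<Lambda> x"
        using reflect_weight(1)[OF iy(1) y(1)] by (simp add: weight_class_def)
      then show "f v \<in> labels \<tau>s ` weight_class l \<Lambda> x"
        using dual_reflection_labels[OF iy(1) yc] iy by auto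
    qed (use F uc in auto)
    show "labels \<tau>s ` weight_class l \<Lambda> x \<subseteq> ?Orb"
    proof
      fix u assume "u \<in> labels \<tau>s ` weight_class l \<Lambda> x"
      then obtain y where y: "u = labels \<tau>s y" "y \<in> short_weights l \<Lambda>" "y - x \<in> \<Lambda>"
        by (auto simp: weight_class_def)
      have "y \<in> {y. labels \<tau>s y \<in> ?Orb}"
      proof (rule connected[OF y(3,2) x refl])
        show "x \<in> {y. labels \<tau>s y \<in> ?Orb}" using orb(1) F uc by auto
        fix z i assume z: "z \<in> short_weights l \<Lambda>" "z \<in> {y. labels \<tau>s y \<in> ?Orb}" and i: "i < l"
        have "dual_reflection \<Gamma> i (labels \<tau>s z) \<in> ?Orb"
          by (rule orb(2)) (use F uc z i in auto)
        then show "reflect (\<tau>s ! i) z \<in> {y. labels \<tau>s y \<in> ?Orb}"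
          using dual_reflection_labels[OF i short_weights_car[OF z(1)]] by simp
      qed
      then show "u \<in> ?Orb" using y by simp
    qed
  qed
qed

lemma components_eq:
  "components \<Gamma> = (\<lambda>x. labels \<tau>s ` weight_class l \<Lambda> x) ` short_weights l \<Lambda>"
proof -
  have "components \<Gamma> = (\<lambda>u. {w u | w. w \<in> dual_weyl_group \<Gamma>}) ` labels \<tau>s ` short_weights l \<Lambda>"
    unfolding components_def linkage_system_eq by blast
  also have "\<dots> = (\<lambda>x. labels \<tau>s ` weight_class l \<Lambda> x) ` short_weights l \<Lambda>"
    unfolding image_image by (rule image_cong[OF refl orbit_eq])
  finally show ?thesis .
qed

end

section \<open>Dynkin types\<close>

lemma path_iff: "e \<in> path xs \<longleftrightarrow> (\<exists>m. Suc m < length xs \<and> e = {xs ! m, xs ! Suc m})"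
proof (induction xs rule: path.induct)
  case (1 x y xs)
  show ?case (is "_ = ?R")
  proof
    assume "e \<in> path (x # y # xs)"
    then consider "e = {x, y}" | m where "Suc m < length (y # xs)" "e = {(y # xs) ! m, (y # xs) ! Suc m}"
      using 1 by auto
    then show ?R
    proof cases
      case 1
      then show ?thesis by (intro exI[of _ 0]) simp
    next
      case 2
      then show ?thesis by (intro exI[of _ "Suc m"]) simp
    qed
  next
    assume ?R
    then obtain m where m: "Suc m < length (x # y # xs)"
      "e = {(x # y # xs) ! m, (x # y # xs) ! Suc m}" by blast
    show "e \<in> path (x # y # xs)"
    proof (cases m)
      case 0
      then show ?thesis using m by simp
    next
      case (Suc k)
      then show ?thesis using m 1 by auto
    qed
  qed
qed auto

lemma path_upt_iff: "{i, j} \<in> path [a..<b] \<longleftrightarrow>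
    (j = Suc i \<and> a \<le> i \<and> j < b) \<or> (i = Suc j \<and> a \<le> j \<and> i < b)"
proof -
  have "{i, j} \<in> path [a..<b] \<longleftrightarrow> (\<exists>m. Suc m < b - a \<and> {i, j} = {a + m, Suc (a + m)})"
    unfolding path_iff by (intro ex_cong1 conj_cong) auto
  also have "\<dots> \<longleftrightarrow> (j = Suc i \<and> a \<le> i \<and> j < b) \<or> (i = Suc j \<and> a \<le> j \<and> i < b)" (is "?L \<longleftrightarrow> ?R")
  proof
    assume ?R
    then show ?L
    proof
      assume "j = Suc i \<and> a \<le> i \<and> j < b"
      then show ?thesis by (intro exI[of _ "i - a"]) auto
    next
      assume "i = Suc j \<and> a \<le> j \<and> i < b"
      then show ?thesis by (intro exI[of _ "j - a"]) auto
    qed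
  qed (auto simp: doubleton_eq_iff)
  finally show ?thesis .
qed

text \<open>Closed integer formulas for the Cartan entries, here and for type E, so that identities
  in small ranks can be decided by evaluation.\<close>

definition D_entry :: "nat \<Rightarrow> nat \<Rightarrow> nat \<Rightarrow> int" where
  "D_entry m i j = (if i = j then 2
    else if (j = Suc i \<and> j < m - 1) \<or> (i = Suc j \<and> i < m - 1) \<or>
      (i = m - 3 \<and> j = m - 1) \<or> (j = m - 3 \<and> i = m - 1) then -1 else 0)"

definition E_entry :: "nat \<Rightarrow> nat \<Rightarrow> nat \<Rightarrow> int" where
  "E_entry m i j = (if i = j then 2
    else if (j = Suc i \<and> j < m - 1) \<or> (i = Suc j \<and> i < m - 1) \<or>
      (i = 2 \<and> j = m - 1) \<or> (j = 2 \<and> i = m - 1) then -1 else 0)"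

lemma cartan_dynkin_entry:
  assumes "i < m" "j < m"
  shows "cartan (dynkin_D m) $$ (i, j) = of_int (D_entry m i j)"
    and "cartan (dynkin_E m) $$ (i, j) = of_int (E_entry m i j)"
  using assms
  by (auto simp: cartan_def dynkin_D_def dynkin_E_def path_upt_iff doubleton_eq_iff D_entry_def E_entry_def)

lemma rank_dynkin [simp]: "rank (dynkin_D m) = m" "rank (dynkin_E m) = m"
  by (simp_all add: dynkin_D_def dynkin_E_def)

lemma comb_comb:
  "comb n (map (\<lambda>j. comb n vs (q j)) [0..<m]) p = comb n vs (\<lambda>k. \<Sum>j<m. p j * q j k)"
proof (rule eq_vecI)
  fix i assume "i < dim_vec (comb n vs (\<lambda>k. \<Sum>j<m. p j * q j k))"
  then have i: "i < n" by simp
  have "comb n (map (\<lambda>j. comb n vs (q j)) [0..<m]) p $ i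
      = (\<Sum>j<m. \<Sum>k<length vs. p j * (q j k * vs ! k $ i))"
    using i by (simp add: comb_def sum_distrib_left)
  also have "\<dots> = (\<Sum>k<length vs. \<Sum>j<m. p j * (q j k * vs ! k $ i))"
    by (rule sum.swap)
  also have "\<dots> = comb n vs (\<lambda>k. \<Sum>j<m. p j * q j k) $ i"
    using i by (simp add: comb_def sum_distrib_right mult.assoc)
  finally show "comb n (map (\<lambda>j. comb n vs (q j)) [0..<m]) p $ i
    = comb n vs (\<lambda>k. \<Sum>j<m. p j * q j k) $ i" .
qed simp

lemma comb_append_singleton:
  assumes "length vs = l" "set vs \<subseteq> carrier_vec n" "w \<in> carrier_vec n"
  shows "comb n (vs @ [w]) c = comb n vs c + c l \<cdot>\<^sub>v w"
  using assms by (intro eq_vecI) (auto simp: comb_def nth_append)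

text \<open>Without dotted edges the given roots have pairwise nonpositive products, so
  \<open>lattice_root_sign\<close> makes them a base for all norm 2 vectors of their
  lattice.\<close>

lemma has_dynkin_typeI:
  assumes re: "realizes n \<Delta> \<beta>s" and dot: "dotted \<Delta> = {}"
    and sub: "set \<beta>s \<subseteq> \<Psi>" "\<Psi> \<subseteq> lattice_roots n \<beta>s"
  shows "has_dynkin_type n \<Delta> \<Psi>"
  unfolding has_dynkin_type_def
proof (intro exI[of _ \<beta>s] conjI ballI)
  show "set \<beta>s \<subseteq> \<Psi>" "realizes n \<Delta> \<beta>s" by (fact sub(1), fact re)
  fix \<alpha> assume "\<alpha> \<in> \<Psi>"
  then have \<alpha>: "\<alpha> \<in> lattice_roots n \<beta>s" using sub by blast
  have B: "length \<beta>s = rank \<Delta>" "set \<beta>s \<subseteq> carrier_vec n" "distinct \<beta>s" "\<not> rlin_dep n (set \<beta>s)"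
    "\<And>i j. i < rank \<Delta> \<Longrightarrow> j < rank \<Delta> \<Longrightarrow> \<beta>s ! i \<bullet> \<beta>s ! j = cartan \<Delta> $$ (i, j)"
    using re by (auto simp: realizes_def)
  have rl: "root_list n \<beta>s" using root_list_of_gram[of \<beta>s \<Delta> n] B by blast
  have indep: "\<forall>i<length \<beta>s. c i = 0" if "comb n \<beta>s c = 0\<^sub>v n" for c
    using lin_indep_iff[OF B(2,3)] B(4) that by blast
  obtain c :: "nat \<Rightarrow> int" where c: "\<alpha> = comb n \<beta>s (\<lambda>i. of_int (c i))"
    "(\<forall>i<length \<beta>s. 0 \<le> c i) \<or> (\<forall>i<length \<beta>s. c i \<le> 0)"
  proof (rule lattice_root_sign[OF rl \<alpha> indep])
    fix i j assume "i < length \<beta>s" "j < length \<beta>s" "i \<noteq> j"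
    then show "\<beta>s ! i \<bullet> \<beta>s ! j \<le> 0" using B dot by (simp add: cartan_def)
  qed auto
  have nat: "real_of_int a \<in> \<nat>" if "0 \<le> a" for a
    using that by (metis of_int_of_nat_eq of_nat_in_Nats zero_le_imp_eq_int)
  let ?c = "vec (rank \<Delta>) (\<lambda>i. real_of_int (c i))"
  show "\<exists>c\<in>carrier_vec (rank \<Delta>). \<alpha> = mat_of_cols n \<beta>s *\<^sub>v c \<and>
      ((\<forall>i<rank \<Delta>. c $ i \<in> \<nat>) \<or> (\<forall>i<rank \<Delta>. - c $ i \<in> \<nat>))"
  proof (intro bexI[of _ ?c] conjI)
    show "\<alpha> = mat_of_cols n \<beta>s *\<^sub>v ?c"
      using mat_of_cols_mult_vec[OF B(2), of ?c] B(1) c(1) by (simp add: comb_def)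
    show "(\<forall>i<rank \<Delta>. ?c $ i \<in> \<nat>) \<or> (\<forall>i<rank \<Delta>. - ?c $ i \<in> \<nat>)"
      using c(2) B(1) nat nat[of "- c _"] by auto
  qed simp
qed

context model
begin

text \<open>Against the span, \<gamma> acts like its projection y; this moves products with \<gamma>
  into the model.\<close>

lemma linked_dot:
  assumes "linked n \<Phi> \<Gamma> ts \<gamma>" "labels ts \<gamma> = labels \<tau>s y" "y \<in> carrier_vec l"
  shows "\<gamma> \<bullet> comb n ts c = y \<bullet> comb l \<tau>s c"
proof -
  have re: "realizes n \<Gamma> ts" using assms by (simp add: linked_def)
  note G = realizes_gram[OF re]
  have \<gamma>: "\<gamma> \<in> carrier_vec n"
    using assms(1) by (auto simp: linked_def simply_laced_root_system_def root_system_def)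
  have "\<gamma> \<bullet> ts ! i = y \<bullet> \<tau>s ! i" if "i < l" for i
    using assms(2) that G(1) len by (metis labels_nth)
  then have *: "ts ! i \<bullet> \<gamma> = \<tau>s ! i \<bullet> y" if "i < l" for i
    using that comm_scalar_prod[of "ts ! i" n \<gamma>] comm_scalar_prod[of "\<tau>s ! i" l y]
      nth_carrier[OF G(2)] G(1) R \<gamma> assms(3) by simp
  have "\<gamma> \<bullet> comb n ts c = comb n ts c \<bullet> \<gamma>" using comm_scalar_prod[OF \<gamma> comb_carrier] .
  also have "\<dots> = comb l \<tau>s c \<bullet> y" using comb_dot[OF \<gamma>] comb_dot[OF assms(3)] * G(1) len by simp
  also have "\<dots> = y \<bullet> comb l \<tau>s c" using comm_scalar_prod[OF comb_carrier assms(3)] .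
  finally show ?thesis .
qed

text \<open>Index l stands for a root whose projection is x. Its diagonal entry is therefore 2 and
  not x \<bullet> x.\<close>

definition extended_gram :: "real vec list \<Rightarrow> real vec \<Rightarrow> nat \<Rightarrow> nat \<Rightarrow> real" where
  "extended_gram bs x i j = (if i < l \<and> j < l then bs ! i \<bullet> bs ! j
     else if i < l then x \<bullet> bs ! i else if j < l then x \<bullet> bs ! j else 2)"

text \<open>Subtracting from \<open>\<gamma>\<close> the lattice vector that corresponds to \<open>y - x0\<close> gives a root with labels
  \<open>x0\<close> without changing the lattice generated together with \<open>ts\<close>, and hence without changing its
  vectors of norm 2. So one suitable \<open>x0\<close> determines the type for its whole coset.\<close>

lemma dynkin_type_of_extension:
  assumes bs: "length bs = l" "set bs \<subseteq> carrier_vec l" "zlat l bs = \<Lambda>"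
    and x0: "x0 \<in> carrier_vec l"
    and \<Delta>: "rank \<Delta> = l + 1" "dotted \<Delta> = {}" "bij_betw f {..<l + 1} {..<l + 1}"
      "\<And>a b. a < l + 1 \<Longrightarrow> b < l + 1 \<Longrightarrow> cartan \<Delta> $$ (a, b) = extended_gram bs x0 (f a) (f b)"
    and lk: "linked n \<Phi> \<Gamma> ts \<gamma>" "labels ts \<gamma> = labels \<tau>s y"
    and y: "y \<in> weight_class l \<Lambda> x0" "y \<bullet> y = x0 \<bullet> x0"
  shows "has_dynkin_type n \<Delta> (generated_roots (insert \<gamma> (set ts)))"
proof -
  have re: "realizes n \<Gamma> ts" and \<gamma>s: "\<gamma> \<notin> rspan n (set ts)" using lk by (auto simp: linked_def)
  note G = realizes_gram[OF re]
  have \<gamma>: "\<gamma> \<in> carrier_vec n" "\<gamma> \<bullet> \<gamma> = 2"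
    using lk by (auto simp: linked_def simply_laced_root_system_def root_system_def)
  have yc: "y \<in> carrier_vec l" and yx: "y - x0 \<in> \<Lambda>"
    using y by (auto simp: weight_class_def short_weights_def)
  note ldot = linked_dot[OF lk yc]
  have "\<forall>j<l. \<exists>q::nat \<Rightarrow> int. bs ! j = comb l \<tau>s (\<lambda>i. of_int (q i))"
    using zlat_nth[of _ bs l] bs by (auto simp: zlat_def)
  then obtain q :: "nat \<Rightarrow> nat \<Rightarrow> int" where q: "\<And>j. j < l \<Longrightarrow> bs ! j = comb l \<tau>s (\<lambda>i. of_int (q j i))"
    by metis
  have "\<forall>j<l. \<exists>p::nat \<Rightarrow> int. \<tau>s ! j = comb l bs (\<lambda>i. of_int (p i))"
    using zlat_nth[of _ \<tau>s l] car len bs(3) by (auto simp: zlat_def)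
  then obtain p :: "nat \<Rightarrow> nat \<Rightarrow> int" where p: "\<And>j. j < l \<Longrightarrow> \<tau>s ! j = comb l bs (\<lambda>i. of_int (p j i))"
    by metis
  obtain d :: "nat \<Rightarrow> int" where d: "y - x0 = comb l \<tau>s (\<lambda>i. of_int (d i))"
    using yx by (auto simp: zlat_def)
  define b where "b j = comb n ts (\<lambda>i. of_int (q j i))" for j
  define \<delta> where "\<delta> = comb n ts (\<lambda>i. of_int (d i))"
  define \<gamma>' where "\<gamma>' = \<gamma> - \<delta>"
  define B where "B = map b [0..<l]"
  define vs where "vs = B @ [\<gamma>']"
  define \<beta>s where "\<beta>s = map (\<lambda>a. vs ! f a) [0..<l + 1]"
  have bc: "b j \<in> carrier_vec n" for j by (simp add: b_def)
  have \<delta>c: "\<delta> \<in> carrier_vec n" by (simp add: \<delta>_def)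
  have \<gamma>'c: "\<gamma>' \<in> carrier_vec n" using \<gamma> \<delta>c by (simp add: \<gamma>'_def)
  have Bc: "set B \<subseteq> carrier_vec n" "length B = l" using bc by (auto simp: B_def)
  have vsc: "set vs \<subseteq> carrier_vec n" "length vs = l + 1" using Bc \<gamma>'c by (auto simp: vs_def)
  have vs_nth: "vs ! i = b i" if "i < l" for i using that by (simp add: vs_def B_def nth_append)
  have vs_l: "vs ! l = \<gamma>'" by (simp add: vs_def B_def nth_append)
  have bs_l: "bs ! j \<in> carrier_vec l" if "j < l" for j using nth_carrier[OF bs(2)] bs(1) that by simp
  have bb: "b i \<bullet> b j = bs ! i \<bullet> bs ! j" if "i < l" "j < l" for i j
    using that q realizes_comb_inner[OF re] by (simp add: b_def)
  have \<delta>b: "\<delta> \<bullet> b j = (y - x0) \<bullet> bs ! j" if "j < l" for j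
    using that q d realizes_comb_inner[OF re] by (simp add: b_def \<delta>_def)
  have \<gamma>b: "\<gamma> \<bullet> b j = y \<bullet> bs ! j" if "j < l" for j
    using that q ldot by (simp add: b_def)
  have \<gamma>'b: "\<gamma>' \<bullet> b j = x0 \<bullet> bs ! j" if "j < l" for j
    using minus_scalar_prod_distrib[OF \<gamma>(1) \<delta>c bc, of j] \<delta>b[OF that] \<gamma>b[OF that]
      minus_scalar_prod_distrib[OF yc x0 bs_l[OF that]] by (simp add: \<gamma>'_def)
  have "\<gamma> \<bullet> \<delta> = y \<bullet> (y - x0)" using ldot d by (simp add: \<delta>_def)
  moreover have "\<delta> \<bullet> \<delta> = (y - x0) \<bullet> (y - x0)" using realizes_comb_inner[OF re] d by (simp add: \<delta>_def)
  moreover have "y \<bullet> (y - x0) = y \<bullet> y - y \<bullet> x0" using scalar_prod_minus_distrib[OF yc yc x0] .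
  \<comment> \<open>Subtracting \<delta> changes the norm by x0 \<bullet> x0 - y \<bullet> y, which
    is 0 by hypothesis.\<close>
  ultimately have \<gamma>'\<gamma>': "\<gamma>' \<bullet> \<gamma>' = 2"
    using norm_diff_smult[OF \<gamma>(1) \<delta>c, of 1] norm_diff_smult[OF yc x0, of 1] \<gamma>(2) y(2)
    by (simp add: \<gamma>'_def)
  have vv: "vs ! i \<bullet> vs ! j = extended_gram bs x0 i j" if "i < l + 1" "j < l + 1" for i j
  proof -
    have "b i \<bullet> \<gamma>' = x0 \<bullet> bs ! i" if "i < l"
      using \<gamma>'b[OF that] comm_scalar_prod[OF \<gamma>'c bc, of i] by simp
    then show ?thesis
      using that vs_nth vs_l bb \<gamma>'b \<gamma>'\<gamma>'
      by (cases "i < l"; cases "j < l") (auto simp: extended_gram_def less_Suc_eq)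
  qed
  have f: "f a < l + 1" if "a < l + 1" for a using \<Delta>(3) that by (auto dest: bij_betwE)
  have len\<beta>: "length \<beta>s = rank \<Delta>" using \<Delta>(1) by (simp add: \<beta>s_def)
  have \<beta>nth: "\<beta>s ! a = vs ! f a" if "a < l + 1" for a using that by (simp add: \<beta>s_def del: upt_Suc)
  have \<beta>g: "\<beta>s ! i \<bullet> \<beta>s ! j = cartan \<Delta> $$ (i, j)" if "i < rank \<Delta>" "j < rank \<Delta>" for i j
    using that \<Delta>(1) \<beta>nth vv[OF f f] \<Delta>(4) by simp
  have "set \<beta>s = (\<lambda>a. vs ! f a) ` {..<l + 1}"
    by (simp add: \<beta>s_def lessThan_atLeast0 del: upt_Suc)
  also have "\<dots> = (!) vs ` (f ` {..<l + 1})" by (simp add: image_image)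
  also have "f ` {..<l + 1} = {..<length vs}" using \<Delta>(3) vsc(2) by (simp add: bij_betw_def)
  also have "(!) vs ` {..<length vs} = set vs" by (auto simp: set_conv_nth)
  finally have set\<beta>: "set \<beta>s = set vs" .
  have \<beta>c: "set \<beta>s \<subseteq> carrier_vec n" using set\<beta> vsc by simp
  have dist: "distinct \<beta>s" using distinct_of_gram[OF len\<beta>] \<beta>g by blast
  then have distv: "distinct vs"
    using set\<beta> vsc(2) len\<beta> \<Delta>(1) distinct_card[of \<beta>s] by (intro card_distinct) simp
  have ndbs: "nondeg l bs"
    unfolding nondeg_def
  proof (intro ballI impI)
    fix v assume v: "v \<in> carrier_vec l" "\<forall>i<length bs. v \<bullet> bs ! i = 0"
    have "v \<bullet> \<tau>s ! i = 0" if i: "i < length \<tau>s" for i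
    proof -
      have "\<tau>s ! i \<bullet> v = (\<Sum>k<length bs. of_int (p i k) * (bs ! k \<bullet> v))"
        using p[of i] comb_dot[OF v(1)] i len by simp
      also have "\<dots> = 0"
        using v bs_l bs(1) by (intro sum.neutral) (auto simp: comm_scalar_prod[of _ l v])
      finally show ?thesis using comm_scalar_prod[OF v(1), of "\<tau>s ! i"] R(2) i len by simp
    qed
    then show "v = 0\<^sub>v l" using nondeg v(1) by (auto simp: nondeg_def)
  qed
  have bcomb: "comb n B c = comb n ts (\<lambda>k. \<Sum>j<l. c j * of_int (q j k))" for c
    unfolding B_def b_def by (rule comb_comb)
  have bseq: "bs = map (\<lambda>j. comb l \<tau>s (\<lambda>i. of_int (q j i))) [0..<l]"
    using q bs(1) by (intro nth_equalityI) auto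
  have bscomb: "comb l bs c = comb l \<tau>s (\<lambda>k. \<Sum>j<l. c j * of_int (q j k))" for c
    by (subst bseq) (rule comb_comb)
  have "\<not> rlin_dep n (set vs)"
    unfolding lin_indep_iff[OF vsc(1) distv]
  proof (intro allI impI)
    fix c i assume c: "comb n vs c = 0\<^sub>v n" and i: "i < length vs"
    let ?e = "\<lambda>k. \<Sum>j<l. c j * of_int (q j k)"
    have sum0: "comb n ts ?e + c l \<cdot>\<^sub>v \<gamma>' = 0\<^sub>v n"
      using c comb_append_singleton[OF Bc(2,1) \<gamma>'c] bcomb by (simp add: vs_def)
    have cl: "c l = 0"
    proof (rule ccontr)
      assume cl: "c l \<noteq> 0"
      \<comment> \<open>Solving the relation for \<gamma> puts it into the span of
        \<open>ts\<close>, contrary to the linkage hypothesis.\<close>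
      have "\<gamma> = comb n ts (\<lambda>k. of_int (d k) - (1 / c l) * ?e k)"
        unfolding comb_diff comb_scale \<delta>_def[symmetric]
      proof (rule eq_vecI)
        fix k assume "k < dim_vec (\<delta> - 1 / c l \<cdot>\<^sub>v comb n ts ?e)"
        then have k: "k < n" by simp
        then have "comb n ts ?e $ k + c l * (\<gamma> $ k - \<delta> $ k) = 0"
          using arg_cong[OF sum0, of "\<lambda>v. v $ k"] \<gamma>(1) \<delta>c by (simp add: \<gamma>'_def)
        then have "comb n ts ?e $ k = - c l * (\<gamma> $ k - \<delta> $ k)" by linarith
        then show "\<gamma> $ k = (\<delta> - 1 / c l \<cdot>\<^sub>v comb n ts ?e) $ k"
          using k cl \<delta>c by simp
      qed (use \<gamma>(1) in simp)
      then show False using comb_in_span[OF G(2)] \<gamma>s by metis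
    qed
    moreover have "0 \<cdot>\<^sub>v \<gamma>' = 0\<^sub>v n" using \<gamma>'c by (intro eq_vecI) auto
    ultimately have "comb n ts ?e = 0\<^sub>v n" using sum0 by simp
    then have "comb l \<tau>s ?e \<bullet> comb l \<tau>s ?e = 0"
      using realizes_comb_inner[OF re, of ?e ?e] by simp
    then have "comb l \<tau>s ?e = 0\<^sub>v l"
      using scalar_prod_self_pos[OF comb_carrier, of l \<tau>s ?e] by linarith
    then have "comb l bs c = 0\<^sub>v l" using bscomb by simp
    then have "\<forall>i<length bs. c i = 0" using square_basis(3)[OF bs(1,2) ndbs] by blast
    then show "c i = 0" using cl i vsc(2) bs(1) by (auto simp: less_Suc_eq)
  qed
  then have re\<beta>: "realizes n \<Delta> \<beta>s"
    using len\<beta> \<beta>c dist \<beta>g set\<beta> by (simp add: realizes_def)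
  have rl\<beta>: "root_list n \<beta>s" using root_list_of_gram[OF len\<beta> \<beta>c \<beta>g] .
  define W where "W = ts @ [\<gamma>]"
  have setW: "insert \<gamma> (set ts) = set W" by (simp add: W_def)
  have Wc: "set W \<subseteq> carrier_vec n" using G(2) \<gamma> by (simp add: W_def)
  have W_i: "W ! i = ts ! i" if "i < l" for i using that G(1) by (simp add: W_def nth_append)
  have W_l: "W ! l = \<gamma>" using G(1) by (simp add: W_def nth_append)
  have \<tau>int: "y \<bullet> \<tau>s ! i \<in> \<int>" if "i < l" for i
    using y(1) short_weights_iff that by (auto simp: weight_class_def)
  have \<gamma>ts: "\<gamma> \<bullet> ts ! i = y \<bullet> \<tau>s ! i" if "i < l" for i
    using lk(2) that G(1) len by (metis labels_nth)
  have rlW: "root_list n W"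
    unfolding root_list_def
  proof (intro conjI allI impI Wc)
    fix i assume i: "i < length W"
    have ts\<gamma>: "ts ! k \<bullet> \<gamma> = y \<bullet> \<tau>s ! k" if "k < l" for k
      using \<gamma>ts[OF that] comm_scalar_prod[OF \<gamma>(1), of "ts ! k"] nth_carrier[OF G(2)] G(1) that by simp
    show "W ! i \<bullet> W ! i = 2"
      using i W_i W_l G(1,3) R(3) \<gamma>(2) by (auto simp: W_def[THEN arg_cong[of _ _ length]] less_Suc_eq)
    fix j assume j: "j < length W"
    show "W ! i \<bullet> W ! j \<in> \<int>"
      using i j W_i W_l G(1,3) R(4) \<gamma>(2) \<gamma>ts ts\<gamma> \<tau>int
      by (auto simp: W_def[THEN arg_cong[of _ _ length]] less_Suc_eq)
  qed
  have lat: "comb n ts (\<lambda>i. of_int (c i)) \<in> zlat n M" if "set ts \<subseteq> zlat n M" "set M \<subseteq> carrier_vec n"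
    for c M
    using zlat_least[OF G(2) that(2,1)] by auto
  have ts\<beta>: "set ts \<subseteq> zlat n \<beta>s"
  proof
    fix t assume "t \<in> set ts"
    then obtain i where i: "i < l" "t = ts ! i" using G(1) by (auto simp: in_set_conv_nth)
    \<comment> \<open>Going from \<open>\<tau>s\<close> to \<open>bs\<close> and back gives a
      relation among the \<open>\<tau>s\<close>. By independence it holds already for the integer
      coefficients, and so it carries over to \<open>B\<close> and \<open>ts\<close>.\<close>
    let ?e = "\<lambda>k. \<Sum>j<l. of_int (p i j) * of_int (q j k)"
    let ?u = "\<lambda>k. if k = i then 1 else 0 :: real"
    have "comb l \<tau>s ?e = comb l \<tau>s ?u"
      using p[OF i(1)] bscomb[of "\<lambda>j. of_int (p i j)"] comb_unit[of i \<tau>s l 1] i len car by simp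
    then have "comb l \<tau>s (\<lambda>k. ?e k - ?u k) = 0\<^sub>v l"
      by (simp add: comb_diff)
    then have "\<forall>k<l. ?e k = ?u k" using lin_indep len by fastforce
    then have "comb n ts ?e = comb n ts ?u" using G(1) by (intro comb_cong) auto
    also have "\<dots> = t" using comb_unit[of i ts n 1] i G by simp
    finally have "t = comb n B (\<lambda>j. of_int (p i j))" using bcomb by simp
    moreover have "set B \<subseteq> zlat n \<beta>s" using zlat_base[OF \<beta>c] set\<beta> by (auto simp: vs_def)
    then have "zlat n B \<subseteq> zlat n \<beta>s" using zlat_least[OF Bc(1) \<beta>c] by blast
    ultimately show "t \<in> zlat n \<beta>s" by auto
  qed
  have "\<gamma>' \<in> zlat n \<beta>s" using zlat_base[OF \<beta>c] set\<beta> by (auto simp: vs_def)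
  then have "\<gamma>' + \<delta> \<in> zlat n \<beta>s" using zlat_add lat[OF ts\<beta> \<beta>c] by (simp add: \<delta>_def)
  moreover have "\<gamma>' + \<delta> = \<gamma>" using \<gamma> \<delta>c by (intro eq_vecI) (auto simp: \<gamma>'_def)
  ultimately have "\<gamma> \<in> zlat n \<beta>s" by simp
  then have "zlat n W \<subseteq> zlat n \<beta>s"
    using zlat_least[OF Wc \<beta>c] ts\<beta> by (simp add: W_def)
  then have sub: "lattice_roots n W \<subseteq> lattice_roots n \<beta>s" by (auto simp: lattice_roots_def)
  have tsW: "set ts \<subseteq> zlat n W" using zlat_base[OF Wc] by (simp add: W_def)
  have "set vs \<subseteq> zlat n W"
    using lat[OF tsW Wc] zlat_diff[of \<gamma> n W \<delta>] zlat_base[OF Wc]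
    by (auto simp: vs_def B_def b_def \<delta>_def \<gamma>'_def W_def)
  moreover have "v \<bullet> v = 2" if "v \<in> set \<beta>s" for v
    using that root_listD(3)[OF rl\<beta>] by (metis in_set_conv_nth)
  ultimately have "set \<beta>s \<subseteq> lattice_roots n W"
    using set\<beta> by (auto simp: lattice_roots_def)
  then show ?thesis
    using has_dynkin_typeI[OF re\<beta> \<Delta>(2)] sub generated_roots_eq[OF rlW] setW by simp
qed

end

section \<open>Types D and E exclude each other in ranks 6, 7 and 8\<close>

text \<open>Here c are the coefficients of v in the base and 2 * k i its products with the base, so
  the sum is half the norm of v. The Cartan determinant 3 is odd, so all c i are even; for v = 2a
  the sum is 4 times the integer (a \<bullet> a) / 2 and cannot be 2.\<close>

lemma E6_no_even_vector:
  fixes c :: "nat \<Rightarrow> int"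
  assumes "2 * c 0 - c 1 = 2 * k 0" "2 * c 1 - c 0 - c 2 = 2 * k 1"
    "2 * c 2 - c 1 - c 3 - c 5 = 2 * k 2" "2 * c 3 - c 2 - c 4 = 2 * k 3"
    "2 * c 4 - c 3 = 2 * k 4" "2 * c 5 - c 2 = 2 * k 5"
    and n: "c 0 * k 0 + c 1 * k 1 + c 2 * k 2 + c 3 * k 3 + c 4 * k 4 + c 5 * k 5 = 2"
  shows False
proof -
  have "even (c 0)" "even (c 1)" "even (c 2)" "even (c 3)" "even (c 4)" "even (c 5)"
    using assms(1-6) by presburger+
  then obtain a0 a1 a2 a3 a4 a5 where a: "c 0 = 2 * a0" "c 1 = 2 * a1" "c 2 = 2 * a2"
    "c 3 = 2 * a3" "c 4 = 2 * a4" "c 5 = 2 * a5"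
    by (metis dvd_def)
  have k: "k 0 = 2 * a0 - a1" "k 1 = 2 * a1 - a0 - a2" "k 2 = 2 * a2 - a1 - a3 - a5"
    "k 3 = 2 * a3 - a2 - a4" "k 4 = 2 * a4 - a3" "k 5 = 2 * a5 - a2"
    using assms(1-6) a by auto
  have "4 * (a0 * a0 + a1 * a1 + a2 * a2 + a3 * a3 + a4 * a4 + a5 * a5
      - a0 * a1 - a1 * a2 - a2 * a3 - a3 * a4 - a2 * a5) = 2"
    using n unfolding a k by (simp add: algebra_simps)
  then show False by presburger
qed

text \<open>The Cartan determinant is 2, so unlike for E_6 and E_8 the matrix has a kernel modulo 2.
  It is spanned by the sum of the base roots 3, 5 and 6. An odd multiple of this vector contributes
  3 modulo 4 to the sum, which again rules out 2.\<close>

lemma E7_no_even_vector: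
  fixes c :: "nat \<Rightarrow> int"
  assumes "2 * c 0 - c 1 = 2 * k 0" "2 * c 1 - c 0 - c 2 = 2 * k 1"
    "2 * c 2 - c 1 - c 3 - c 6 = 2 * k 2" "2 * c 3 - c 2 - c 4 = 2 * k 3"
    "2 * c 4 - c 3 - c 5 = 2 * k 4" "2 * c 5 - c 4 = 2 * k 5" "2 * c 6 - c 2 = 2 * k 6"
    and n: "c 0 * k 0 + c 1 * k 1 + c 2 * k 2 + c 3 * k 3 + c 4 * k 4 + c 5 * k 5 + c 6 * k 6 = 2"
  shows False
proof -
  \<comment> \<open>The common parity of the coefficients 3, 5 and 6. Since t * t = t, the quadratic
    equation becomes one that is decided modulo 4.\<close>
  define t where "t = c 3 mod 2"
  have t: "t * t = t" by (auto simp: t_def mod2_eq_if)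
  have "even (c 0)" "even (c 1)" "even (c 2)" "even (c 4)"
    "even (c 3 - t)" "even (c 5 - t)" "even (c 6 - t)"
    using assms(1-7) unfolding t_def by presburger+
  then obtain a0 a1 a2 a3 a4 a5 a6 where "c 0 = 2 * a0" "c 1 = 2 * a1" "c 2 = 2 * a2"
    "c 3 - t = 2 * a3" "c 4 = 2 * a4" "c 5 - t = 2 * a5" "c 6 - t = 2 * a6"
    by (metis dvd_def)
  then have a: "c 0 = 2 * a0" "c 1 = 2 * a1" "c 2 = 2 * a2"
    "c 3 = 2 * a3 + t" "c 4 = 2 * a4" "c 5 = 2 * a5 + t" "c 6 = 2 * a6 + t"
    by auto
  have k: "k 0 = 2 * a0 - a1" "k 1 = 2 * a1 - a0 - a2" "k 2 = 2 * a2 - a1 - a3 - a6 - t"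
    "k 3 = 2 * a3 + t - a2 - a4" "k 4 = 2 * a4 - a3 - a5 - t" "k 5 = 2 * a5 + t - a4"
    "k 6 = 2 * a6 + t - a2"
    using assms(1-7) a by auto
  have "4 * (a0 * a0 + a1 * a1 + a2 * a2 + a3 * a3 + a4 * a4 + a5 * a5 + a6 * a6
      - a0 * a1 - a1 * a2 - a2 * a3 - a3 * a4 - a4 * a5 - a2 * a6
      + t * a3 + t * a5 + t * a6 - t * a2 - t * a4) + 3 * (t * t) = 2"
    using n unfolding a k by (simp add: algebra_simps)
  then have "4 * (a0 * a0 + a1 * a1 + a2 * a2 + a3 * a3 + a4 * a4 + a5 * a5 + a6 * a6
      - a0 * a1 - a1 * a2 - a2 * a3 - a3 * a4 - a4 * a5 - a2 * a6
      + t * a3 + t * a5 + t * a6 - t * a2 - t * a4) + 3 * t = 2"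
    unfolding t .
  moreover have "t = 0 \<or> t = 1" unfolding t_def by presburger
  ultimately show False by presburger
qed

text \<open>As for E_6, now with Cartan determinant 1.\<close>

lemma E8_no_even_vector:
  fixes c :: "nat \<Rightarrow> int"
  assumes "2 * c 0 - c 1 = 2 * k 0" "2 * c 1 - c 0 - c 2 = 2 * k 1"
    "2 * c 2 - c 1 - c 3 - c 7 = 2 * k 2" "2 * c 3 - c 2 - c 4 = 2 * k 3"
    "2 * c 4 - c 3 - c 5 = 2 * k 4" "2 * c 5 - c 4 - c 6 = 2 * k 5" "2 * c 6 - c 5 = 2 * k 6"
    "2 * c 7 - c 2 = 2 * k 7"
    and n: "c 0 * k 0 + c 1 * k 1 + c 2 * k 2 + c 3 * k 3 + c 4 * k 4 + c 5 * k 5 + c 6 * k 6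
      + c 7 * k 7 = 2"
  shows False
proof -
  have "even (c 0)" "even (c 1)" "even (c 2)" "even (c 3)" "even (c 4)" "even (c 5)"
    "even (c 6)" "even (c 7)"
    using assms(1-8) by presburger+
  then obtain a0 a1 a2 a3 a4 a5 a6 a7 where a: "c 0 = 2 * a0" "c 1 = 2 * a1" "c 2 = 2 * a2"
    "c 3 = 2 * a3" "c 4 = 2 * a4" "c 5 = 2 * a5" "c 6 = 2 * a6" "c 7 = 2 * a7"
    by (metis dvd_def)
  have k: "k 0 = 2 * a0 - a1" "k 1 = 2 * a1 - a0 - a2" "k 2 = 2 * a2 - a1 - a3 - a7"
    "k 3 = 2 * a3 - a2 - a4" "k 4 = 2 * a4 - a3 - a5" "k 5 = 2 * a5 - a4 - a6"
    "k 6 = 2 * a6 - a5" "k 7 = 2 * a7 - a2"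
    using assms(1-8) a by auto
  have "4 * (a0 * a0 + a1 * a1 + a2 * a2 + a3 * a3 + a4 * a4 + a5 * a5 + a6 * a6 + a7 * a7
      - a0 * a1 - a1 * a2 - a2 * a3 - a3 * a4 - a4 * a5 - a5 * a6 - a2 * a7) = 2"
    using n unfolding a k by (simp add: algebra_simps)
  then show False by presburger
qed

lemma has_dynkin_typeE:
  assumes "has_dynkin_type n \<Delta> \<Psi>"
  obtains \<beta>s where "set \<beta>s \<subseteq> \<Psi>" "realizes n \<Delta> \<beta>s" "root_list n \<beta>s" "\<Psi> \<subseteq> zlat n \<beta>s"
proof -
  obtain \<beta>s where \<beta>: "set \<beta>s \<subseteq> \<Psi>" "realizes n \<Delta> \<beta>s"
    and c: "\<And>\<alpha>. \<alpha> \<in> \<Psi> \<Longrightarrow> \<exists>c\<in>carrier_vec (rank \<Delta>). \<alpha> = mat_of_cols n \<beta>s *\<^sub>v c \<and>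
        ((\<forall>i<rank \<Delta>. c $ i \<in> \<nat>) \<or> (\<forall>i<rank \<Delta>. - c $ i \<in> \<nat>))"
    using assms by (auto simp: has_dynkin_type_def)
  have B: "length \<beta>s = rank \<Delta>" "set \<beta>s \<subseteq> carrier_vec n"
    "\<And>i j. i < rank \<Delta> \<Longrightarrow> j < rank \<Delta> \<Longrightarrow> \<beta>s ! i \<bullet> \<beta>s ! j = cartan \<Delta> $$ (i, j)"
    using \<beta> by (auto simp: realizes_def)
  have "\<Psi> \<subseteq> zlat n \<beta>s"
  proof
    fix \<alpha> assume "\<alpha> \<in> \<Psi>"
    then obtain c where c: "c \<in> carrier_vec (rank \<Delta>)" "\<alpha> = mat_of_cols n \<beta>s *\<^sub>v c"
      "(\<forall>i<rank \<Delta>. c $ i \<in> \<nat>) \<or> (\<forall>i<rank \<Delta>. - c $ i \<in> \<nat>)"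
      using c by blast
    have "c $ i \<in> \<int>" if "i < rank \<Delta>" for i
      using c(1,3) that Nats_subset_Ints minus_in_Ints_iff by (metis carrier_vecD index_uminus_vec(1) subsetD)
    then have "\<And>i. i < rank \<Delta> \<Longrightarrow> c $ i = of_int \<lfloor>c $ i\<rfloor>" by (metis Ints_cases floor_of_int)
    then have "\<alpha> = comb n \<beta>s (\<lambda>i. of_int \<lfloor>c $ i\<rfloor>)"
      using mat_of_cols_mult_vec[OF B(2), of c] B(1) c by (auto intro!: comb_cong)
    then show "\<alpha> \<in> zlat n \<beta>s" by simp
  qed
  then show thesis using that \<beta> root_list_of_gram[of \<beta>s \<Delta> n] B by blast
qed

text \<open>Writing the rank as p + 4 removes the truncated subtractions from the entries.\<close>

lemma D_entry_add:
  "D_entry (p + 4) i j = (if i = j then 2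
    else if (j = Suc i \<and> j < p + 3) \<or> (i = Suc j \<and> i < p + 3) \<or>
      (i = p + 1 \<and> j = p + 3) \<or> (j = p + 1 \<and> i = p + 3) then -1 else 0)"
proof -
  have "p + 4 - 1 = p + 3" "p + 4 - 3 = p + 1" by simp_all
  then show ?thesis by (simp add: D_entry_def)
qed

lemma cartan_fork_difference:
  assumes "i < p + 4"
  shows "cartan (dynkin_D (p + 4)) $$ (i, p + 3) - cartan (dynkin_D (p + 4)) $$ (i, p + 2)
    = 2 * of_int (if i = p + 3 then 1 else if i = p + 2 then -1 else 0)"
  using assms cartan_dynkin_entry(1)[OF assms, of "p + 3"] cartan_dynkin_entry(1)[OF assms, of "p + 2"]
  by (simp add: D_entry_add)

text \<open>In a \<open>D_m\<close> lattice the difference of the two roots at the fork has norm 4 and even product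
  with every lattice vector.\<close>

lemma D_lattice_even_vector:
  assumes re: "realizes n (dynkin_D (p + 4)) \<beta>s"
  obtains v where "v \<in> zlat n \<beta>s" "v \<bullet> v = 4" "\<And>w. w \<in> zlat n \<beta>s \<Longrightarrow> \<exists>k::int. w \<bullet> v = 2 * of_int k"
proof
  have B: "length \<beta>s = p + 4" "set \<beta>s \<subseteq> carrier_vec n"
    and g: "\<And>i j. i < p + 4 \<Longrightarrow> j < p + 4 \<Longrightarrow> \<beta>s ! i \<bullet> \<beta>s ! j = cartan (dynkin_D (p + 4)) $$ (i, j)"
    using re by (auto simp: realizes_def)
  let ?v = "\<beta>s ! (p + 3) - \<beta>s ! (p + 2)"
  have c: "\<beta>s ! i \<in> carrier_vec n" if "i < p + 4" for i using nth_carrier[OF B(2)] B(1) that by simp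
  have vc: "?v \<in> carrier_vec n" using c by simp
  show "?v \<in> zlat n \<beta>s"
    using zlat_nth[OF _ B(2)] B(1) by (intro zlat_diff) auto
  have dv: "\<beta>s ! i \<bullet> ?v = 2 * of_int (if i = p + 3 then 1 else if i = p + 2 then -1 else 0)"
    if i: "i < p + 4" for i
    using scalar_prod_minus_distrib[OF c[OF i] c c, of "p + 3" "p + 2"] g[OF i]
      cartan_fork_difference[OF i] by simp
  have "?v \<bullet> ?v = \<beta>s ! (p + 3) \<bullet> ?v - \<beta>s ! (p + 2) \<bullet> ?v"
    using c vc by (intro minus_scalar_prod_distrib[of _ n]) auto
  then show "?v \<bullet> ?v = 4" using dv[of "p + 3"] dv[of "p + 2"] by simp
  fix w assume "w \<in> zlat n \<beta>s"
  then obtain d :: "nat \<Rightarrow> int" where d: "w = comb n \<beta>s (\<lambda>i. of_int (d i))" by (auto simp: zlat_def)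
  let ?k = "\<lambda>i. if i = p + 3 then 1 else if i = p + 2 then -1 else 0 :: int"
  have "w \<bullet> ?v = (\<Sum>i<p + 4. of_int (d i) * (\<beta>s ! i \<bullet> ?v))" using comb_dot[OF vc] d B(1) by simp
  also have "\<dots> = (\<Sum>i<p + 4. of_int (d i) * (2 * of_int (?k i)))"
    using dv by (intro sum.cong refl arg_cong2[where f = "(*)"]) auto
  also have "\<dots> = 2 * of_int (\<Sum>i<p + 4. d i * ?k i)"
    unfolding sum_distrib_left of_int_sum of_int_mult by (intro sum.cong) auto
  finally show "\<exists>k::int. w \<bullet> ?v = 2 * of_int k" by blast
qed

lemma not_both_dynkin_types:
  assumes m: "m \<in> {6, 7, 8}"
    and D: "has_dynkin_type n (dynkin_D m) \<Psi>" and E: "has_dynkin_type n (dynkin_E m) \<Psi>"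
  shows False
proof -
  obtain \<beta>s where \<beta>: "set \<beta>s \<subseteq> \<Psi>" "realizes n (dynkin_D m) \<beta>s" "root_list n \<beta>s" "\<Psi> \<subseteq> zlat n \<beta>s"
    using has_dynkin_typeE[OF D] .
  obtain \<epsilon>s where \<epsilon>: "set \<epsilon>s \<subseteq> \<Psi>" "realizes n (dynkin_E m) \<epsilon>s" "root_list n \<epsilon>s" "\<Psi> \<subseteq> zlat n \<epsilon>s"
    using has_dynkin_typeE[OF E] .
  note R = root_listD[OF \<epsilon>(3)]
  have len: "length \<epsilon>s = m" and g: "\<And>i j. i < m \<Longrightarrow> j < m \<Longrightarrow> \<epsilon>s ! i \<bullet> \<epsilon>s ! j = cartan (dynkin_E m) $$ (i, j)"
    using \<epsilon>(2) by (auto simp: realizes_def)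
  obtain p where "m = p + 4" using m by (auto intro: that[of "m - 4"])
  then obtain v where v: "v \<in> zlat n \<beta>s" "v \<bullet> v = 4"
    "\<And>w. w \<in> zlat n \<beta>s \<Longrightarrow> \<exists>k::int. w \<bullet> v = 2 * of_int k"
    using D_lattice_even_vector[of n p \<beta>s] \<beta>(2) by metis
  \<comment> \<open>Each base lies in \<Psi> and \<Psi> lies in the lattice of each base, so the
    even vector of the D base can be tested against the E base.\<close>
  have "zlat n \<beta>s \<subseteq> zlat n \<epsilon>s"
    using zlat_least[OF root_listD(1)[OF \<beta>(3)] R(1)] \<beta>(1) \<epsilon>(4) by blast
  then obtain c :: "nat \<Rightarrow> int" where c: "v = comb n \<epsilon>s (\<lambda>i. of_int (c i))"
    using v(1) by (auto simp: zlat_def)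
  have vc: "v \<in> carrier_vec n" using c by simp
  have "\<exists>k::int. \<epsilon>s ! i \<bullet> v = 2 * of_int k" if "i < m" for i
  proof -
    have "\<epsilon>s ! i \<in> set \<epsilon>s" using that len by simp
    then have "\<epsilon>s ! i \<in> zlat n \<beta>s" using \<epsilon>(1) \<beta>(4) by blast
    then show ?thesis using v(3) by blast
  qed
  then obtain k :: "nat \<Rightarrow> int" where k: "\<And>i. i < m \<Longrightarrow> \<epsilon>s ! i \<bullet> v = 2 * of_int (k i)" by metis
  \<comment> \<open>The product of v with base root i, computed from the coefficients; these are the
    linear hypotheses of the lemmas on E_6, E_7 and E_8.\<close>
  have lin: "(\<Sum>j<m. c j * E_entry m i j) = 2 * k i" if i: "i < m" for i
  proof -
    have "\<epsilon>s ! i \<bullet> v = v \<bullet> \<epsilon>s ! i" using comm_scalar_prod[OF vc, of "\<epsilon>s ! i"] R(2) i len by simp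
    also have "\<dots> = (\<Sum>j<m. of_int (c j) * (\<epsilon>s ! j \<bullet> \<epsilon>s ! i))" using comb_dot[of "\<epsilon>s ! i" n \<epsilon>s] c R(2) i len by simp
    also have "\<dots> = (\<Sum>j<m. of_int (c j) * (\<epsilon>s ! i \<bullet> \<epsilon>s ! j))"
      using R(2) i len by (intro sum.cong refl arg_cong2[where f = "(*)"] comm_scalar_prod[of _ n]) auto
    also have "\<dots> = real_of_int (\<Sum>j<m. c j * E_entry m i j)"
      using g[OF i] i by (auto simp: cartan_dynkin_entry intro!: sum.cong)
    finally show ?thesis using k[OF i] by linarith
  qed
  have "v \<bullet> v = (\<Sum>i<m. of_int (c i) * (\<epsilon>s ! i \<bullet> v))" using comb_dot[OF vc, of \<epsilon>s] c len by simp
  also have "\<dots> = 2 * of_int (\<Sum>i<m. c i * k i)" using k by (simp add: sum_distrib_left mult.left_commute)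
  finally have nrm: "(\<Sum>i<m. c i * k i) = 2" using v(2) by linarith
  from m consider "m = 6" | "m = 7" | "m = 8" by auto
  then show False
  proof cases
    case 1
    have sum6: "sum F {..<6} = F 0 + F 1 + F 2 + F 3 + F 4 + F 5" for F :: "nat \<Rightarrow> int"
      by (simp add: eval_nat_numeral)
    show False
      by (rule E6_no_even_vector[of c k])
        (use lin[of 0] lin[of 1] lin[of 2] lin[of 3] lin[of 4] lin[of 5] nrm in \<open>simp_all add: 1 sum6 E_entry_def\<close>)
  next
    case 2
    have sum7: "sum F {..<7} = F 0 + F 1 + F 2 + F 3 + F 4 + F 5 + F 6" for F :: "nat \<Rightarrow> int"
      by (simp add: eval_nat_numeral)
    show False
      by (rule E7_no_even_vector[of c k])
        (use lin[of 0] lin[of 1] lin[of 2] lin[of 3] lin[of 4] lin[of 5] lin[of 6] nrm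
          in \<open>simp_all add: 2 sum7 E_entry_def\<close>)
  next
    case 3
    have sum8: "sum F {..<8} = F 0 + F 1 + F 2 + F 3 + F 4 + F 5 + F 6 + F 7" for F :: "nat \<Rightarrow> int"
      by (simp add: eval_nat_numeral)
    show False
      by (rule E8_no_even_vector[of c k])
        (use lin[of 0] lin[of 1] lin[of 2] lin[of 3] lin[of 4] lin[of 5] lin[of 6] lin[of 7] nrm
          in \<open>simp_all add: 3 sum8 E_entry_def\<close>)
  qed
qed

context model
begin

lemma component_cases:
  assumes "C \<in> components \<Gamma>"
  obtains x where "x \<in> short_weights l \<Lambda>" "C = labels \<tau>s ` weight_class l \<Lambda> x"
    "labels \<tau>s x \<in> C"
proof -
  obtain x where x: "x \<in> short_weights l \<Lambda>" "C = labels \<tau>s ` weight_class l \<Lambda> x"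
    using assms components_eq by blast
  moreover have "x \<in> weight_class l \<Lambda> x" using x short_weights_car[OF x(1)] by (simp add: weight_class_def)
  ultimately show thesis using that by blast
qed

text \<open>The types quantify over all realizations, so a contradiction needs an actual one,
  supplied by \<open>linked_exists\<close>. Rank 4 is excluded because D_5 and E_5 are the same
  diagram.\<close>

lemma D_E_disjoint:
  assumes l: "l \<in> {5, 6, 7}"
  shows "D_components \<Gamma> \<inter> E_components \<Gamma> = {}"
proof (rule equals0I)
  fix C assume C: "C \<in> D_components \<Gamma> \<inter> E_components \<Gamma>"
  then have "C \<in> components \<Gamma>" by (simp add: components_of_type_def)
  then obtain x where x: "x \<in> short_weights l \<Lambda>" "labels \<tau>s x \<in> C"
    using component_cases by metis
  obtain n \<Phi> ts \<gamma> where "linked n \<Phi> \<Gamma> ts \<gamma>" "labels ts \<gamma> = labels \<tau>s x"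
    using linked_exists[OF x(1)] by blast
  then have "has_dynkin_type n (dynkin_D (l + 1)) (generated_roots (insert \<gamma> (set ts)))"
    "has_dynkin_type n (dynkin_E (l + 1)) (generated_roots (insert \<gamma> (set ts)))"
    using C x(2) rank by (auto simp: components_of_type_def)
  then show False using not_both_dynkin_types[of "l + 1"] l by auto
qed

lemma weight_class_of_type:
  assumes bs: "length bs = l" "set bs \<subseteq> carrier_vec l" "zlat l bs = \<Lambda>"
    and \<Delta>: "rank (\<Delta> (l + 1)) = l + 1" "dotted (\<Delta> (l + 1)) = {}" "bij_betw f {..<l + 1} {..<l + 1}"
      "\<And>a b. a < l + 1 \<Longrightarrow> b < l + 1 \<Longrightarrow> cartan (\<Delta> (l + 1)) $$ (a, b) = extended_gram bs x0 (f a) (f b)"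
    and x0: "x0 \<in> short_weights l \<Lambda>"
    and nrm: "\<And>y. y \<in> weight_class l \<Lambda> x0 \<Longrightarrow> y \<bullet> y = x0 \<bullet> x0"
  shows "labels \<tau>s ` weight_class l \<Lambda> x0 \<in> components_of_type \<Delta> \<Gamma>"
proof -
  let ?C = "labels \<tau>s ` weight_class l \<Lambda> x0"
  have "?C \<in> components \<Gamma>" using x0 components_eq by blast
  moreover have "u \<in> linkage_system \<Gamma>" if "u \<in> ?C" for u
    using that linkage_system_eq by (auto simp: weight_class_def)
  moreover have "has_dynkin_type n (\<Delta> (rank \<Gamma> + 1)) (generated_roots (insert \<gamma> (set ts)))"
    if "u \<in> ?C" "linked n \<Phi> \<Gamma> ts \<gamma>" "labels ts \<gamma> = u" for u n \<Phi> ts \<gamma>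
    using that dynkin_type_of_extension[OF bs short_weights_car[OF x0] \<Delta>] nrm rank by auto
  ultimately show ?thesis unfolding components_of_type_def by blast
qed

end

section \<open>The lattice \<open>D_l\<close>\<close>

definition DL :: "nat \<Rightarrow> nat \<Rightarrow> real vec set" where
  "DL n l = {x \<in> carrier_vec n. (\<exists>z :: nat \<Rightarrow> int. (\<forall>i<l. x $ i = of_int (z i)) \<and> even (\<Sum>i<l. z i)) \<and>
     (\<forall>i<n. l \<le> i \<longrightarrow> x $ i = 0)}"

definition root :: "nat \<Rightarrow> nat \<Rightarrow> real \<Rightarrow> nat \<Rightarrow> real \<Rightarrow> real vec" where
  "root n a s b t = vec n (\<lambda>i. (if i = a then s else 0) + (if i = b then t else 0))"

lemma root_carrier [simp]: "root n a s b t \<in> carrier_vec n" "dim_vec (root n a s b t) = n"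
  by (simp_all add: root_def)

lemma root_nth [simp]: "i < n \<Longrightarrow> root n a s b t $ i = (if i = a then s else 0) + (if i = b then t else 0)"
  by (simp add: root_def)

lemma root_dot:
  assumes "a < n" "b < n" "x \<in> carrier_vec n"
  shows "root n a s b t \<bullet> x = s * x $ a + t * x $ b" "x \<bullet> root n a s b t = s * x $ a + t * x $ b"
proof -
  have "root n a s b t \<bullet> x = (\<Sum>i\<in>{0..<n}. (if i = a then s * x $ a else 0) + (if i = b then t * x $ b else 0))"
    using assms(3) unfolding scalar_prod_def by (intro sum.cong) (auto simp: distrib_right)
  then show "root n a s b t \<bullet> x = s * x $ a + t * x $ b"
    using assms by (simp add: sum.distrib)
  then show "x \<bullet> root n a s b t = s * x $ a + t * x $ b"
    using comm_scalar_prod[OF assms(3), of "root n a s b t"] by simp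
qed

lemma DL_carrier: "DL n l \<subseteq> carrier_vec n"
  by (auto simp: DL_def)

lemma DLI:
  fixes z :: "nat \<Rightarrow> int"
  assumes "x \<in> carrier_vec n" "\<And>i. i < l \<Longrightarrow> x $ i = of_int (z i)" "even (\<Sum>i<l. z i)"
    "\<And>i. l \<le> i \<Longrightarrow> i < n \<Longrightarrow> x $ i = 0"
  shows "x \<in> DL n l"
  using assms unfolding DL_def by blast

lemma DLE:
  assumes "x \<in> DL n l"
  obtains z :: "nat \<Rightarrow> int" where "x \<in> carrier_vec n" "\<And>i. i < l \<Longrightarrow> x $ i = of_int (z i)"
    "even (\<Sum>i<l. z i)" "\<And>i. l \<le> i \<Longrightarrow> i < n \<Longrightarrow> x $ i = 0"
  using assms unfolding DL_def by blast

lemma DL_step: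
  assumes "l \<le> n" "x \<in> DL n l" "y \<in> DL n l" "s = 1 \<or> s = -1"
  shows "x + s \<cdot>\<^sub>v y \<in> DL n l"
proof -
  obtain t :: int where t: "s = of_int t" using assms(4) by (metis of_int_1 of_int_minus)
  obtain z :: "nat \<Rightarrow> int" where z: "x \<in> carrier_vec n" "\<And>i. i < l \<Longrightarrow> x $ i = of_int (z i)"
    "even (\<Sum>i<l. z i)" "\<And>i. l \<le> i \<Longrightarrow> i < n \<Longrightarrow> x $ i = 0" using DLE[OF assms(2)] by blast
  obtain w :: "nat \<Rightarrow> int" where w: "y \<in> carrier_vec n" "\<And>i. i < l \<Longrightarrow> y $ i = of_int (w i)"
    "even (\<Sum>i<l. w i)" "\<And>i. l \<le> i \<Longrightarrow> i < n \<Longrightarrow> y $ i = 0" using DLE[OF assms(3)] by blast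
  show ?thesis
    by (rule DLI[of _ _ _ "\<lambda>i. z i + t * w i"])
      (use z w t assms(1) in \<open>auto simp: sum.distrib simp flip: sum_distrib_left\<close>)
qed

lemma zlat_subset_DL:
  assumes "l \<le> n" "set vs \<subseteq> carrier_vec n" "set vs \<subseteq> DL n l"
  shows "zlat n vs \<subseteq> DL n l"
proof
  fix v assume "v \<in> zlat n vs"
  then show "v \<in> DL n l"
    using assms(2)
  proof (induction rule: zlat_induct)
    case zero
    show ?case by (rule DLI[of _ _ _ "\<lambda>_. 0"]) (use assms(1) in auto)
  next
    case (step v j s)
    then have "vs ! j \<in> DL n l" using assms(3) by auto
    with step show ?case using DL_step[OF assms(1)] by blast
  qed
qed

lemma root_in_DL:
  assumes "a < l" "b < l" "l \<le> n" "s = 1 \<or> s = -1" "t = 1 \<or> t = -1"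
  shows "root n a s b t \<in> DL n l"
proof -
  obtain s' :: int where s: "s = of_int s'" "s' = 1 \<or> s' = -1" using assms(4) by (metis of_int_1 of_int_minus)
  obtain t' :: int where t: "t = of_int t'" "t' = 1 \<or> t' = -1" using assms(5) by (metis of_int_1 of_int_minus)
  have "(\<Sum>i<l. (if i = a then s' else 0) + (if i = b then t' else 0)) = s' + t'"
    using assms by (simp add: sum.distrib)
  then show ?thesis
    by (intro DLI[of _ _ _ "\<lambda>i. (if i = a then s' else 0) + (if i = b then t' else 0)"])
      (use s t assms in auto)
qed

text \<open>The consecutive differences telescope to e_m - e_0, and the one root with a plus sign
  adds 2 e_0. A vector with integer coordinates z of sum 2k is then \<Sum> z_m (e_m - e_0) + k * 2
  e_0.\<close>

lemma DL_subset_zlat: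
  assumes l: "l \<le> n" "0 < l" and vs: "set vs \<subseteq> carrier_vec n"
    and diff: "\<And>m. Suc m < l \<Longrightarrow> root n m 1 (Suc m) (-1) \<in> zlat n vs"
    and p: "Suc p < l" "root n p 1 (Suc p) 1 \<in> zlat n vs"
  shows "DL n l \<subseteq> zlat n vs"
proof
  fix x assume "x \<in> DL n l"
  then obtain z :: "nat \<Rightarrow> int" where z: "x \<in> carrier_vec n" "\<And>i. i < l \<Longrightarrow> x $ i = of_int (z i)"
    "even (\<Sum>i<l. z i)" "\<And>i. l \<le> i \<Longrightarrow> i < n \<Longrightarrow> x $ i = 0" using DLE by blast
  have d0: "root n m 1 0 (-1) \<in> zlat n vs" if "m < l" for m
    using that
  proof (induction m)
    case 0
    have "root n 0 1 0 (-1) = 0\<^sub>v n" by (intro eq_vecI) auto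
    then show ?case by simp
  next
    case (Suc m)
    then have "root n m 1 0 (-1) - root n m 1 (Suc m) (-1) \<in> zlat n vs" using diff zlat_diff by simp
    moreover have "root n m 1 0 (-1) - root n m 1 (Suc m) (-1) = root n (Suc m) 1 0 (-1)"
      by (intro eq_vecI) auto
    ultimately show ?case by simp
  qed
  \<comment> \<open>(e_p + e_{p+1}) + (e_p - e_{p+1}) - 2 (e_p - e_0) = 2 e_0.\<close>
  have "root n p 1 (Suc p) 1 + root n p 1 (Suc p) (-1) - of_int 2 \<cdot>\<^sub>v root n p 1 0 (-1) \<in> zlat n vs"
    using p diff d0[of p] by (intro zlat_diff zlat_add zlat_smult) auto
  moreover have "root n p 1 (Suc p) 1 + root n p 1 (Suc p) (-1) - of_int 2 \<cdot>\<^sub>v root n p 1 0 (-1) = root n 0 1 0 1"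
    using l p by (intro eq_vecI) auto
  ultimately have e0: "root n 0 1 0 1 \<in> zlat n vs" by simp
  obtain k where k: "(\<Sum>i<l. z i) = 2 * k" using z(3) by (auto elim: evenE)
  define us where "us = map (\<lambda>m. root n m 1 0 (-1)) [0..<l]"
  have us: "length us = l" "set us \<subseteq> carrier_vec n" "set us \<subseteq> zlat n vs"
    using d0 by (auto simp: us_def)
  \<comment> \<open>Index l belongs to the appended vector 2 e_0, which occurs half as often as the
    coordinate sum.\<close>
  let ?c = "\<lambda>i. real_of_int (if i < l then z i else k)"
  have "x = comb n (us @ [root n 0 1 0 1]) ?c"
    unfolding comb_append_singleton[OF us(1,2) root_carrier(1)]
  proof (rule eq_vecI)
    fix i assume "i < dim_vec (comb n us ?c + ?c l \<cdot>\<^sub>v root n 0 1 0 1)"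
    then have i: "i < n" by simp
    have "comb n us ?c $ i = (\<Sum>m<l. of_int (z m) * ((if i = m then 1 else 0) + (if i = 0 then -1 else 0)))"
      using i us(1) by (simp add: comb_def us_def)
    also have "\<dots> = (\<Sum>m<l. (if i = m then of_int (z m) else 0) - (if i = 0 then of_int (z m) else 0))"
      by (rule sum.cong) auto
    also have "\<dots> = (if i < l then of_int (z i) else 0) - (if i = 0 then of_int (2 * k) else 0)"
      by (simp add: sum_subtractf k[symmetric] of_int_sum[symmetric] del: of_int_sum)
    finally show "x $ i = (comb n us ?c + ?c l \<cdot>\<^sub>v root n 0 1 0 1) $ i"
      using i z by auto
  qed (use z in simp)
  then have "x \<in> zlat n (us @ [root n 0 1 0 1])" by (metis comb_in_zlat)
  moreover have "zlat n (us @ [root n 0 1 0 1]) \<subseteq> zlat n vs"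
    using us e0 vs by (intro zlat_least) auto
  ultimately show "x \<in> zlat n vs" by blast
qed

text \<open>Orthogonality to the generators extends to the lattice, and a nonzero multiple of a unit
  vector detects the corresponding coordinate.\<close>

lemma zlat_nondeg:
  assumes "set vs \<subseteq> carrier_vec n" "\<And>k. k < n \<Longrightarrow> \<exists>d. d \<noteq> 0 \<and> d \<cdot>\<^sub>v unit_vec n k \<in> zlat n vs"
  shows "nondeg n vs"
  unfolding nondeg_def
proof (intro ballI impI)
  fix v assume v: "v \<in> carrier_vec n" "\<forall>i<length vs. v \<bullet> vs ! i = 0"
  have "v \<bullet> w = 0" if "w \<in> zlat n vs" for w
  proof -
    obtain c where c: "w = comb n vs c" using \<open>w \<in> zlat n vs\<close> by (auto simp: zlat_def)
    have "w \<bullet> v = (\<Sum>i<length vs. c i * (vs ! i \<bullet> v))" using comb_dot[OF v(1)] c by simp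
    also have "\<dots> = 0"
      using v nth_carrier[OF assms(1)] by (intro sum.neutral) (auto simp: comm_scalar_prod[of _ n v])
    finally show ?thesis using comm_scalar_prod[OF v(1), of w] c by simp
  qed
  then have "v $ k = 0" if "k < n" for k
    using assms(2)[OF that] v(1) that by fastforce
  then show "v = 0\<^sub>v n" using v(1) by (intro eq_vecI) auto
qed

lemma two_unit_vec: "k < n \<Longrightarrow> 2 \<cdot>\<^sub>v unit_vec n k = root n k 1 k 1"
  by (intro eq_vecI) auto

lemma DL_nondeg:
  assumes "set vs \<subseteq> carrier_vec l" "zlat l vs = DL l l"
  shows "nondeg l vs"
proof (rule zlat_nondeg[OF assms(1)])
  fix k assume "k < l"
  then show "\<exists>d. d \<noteq> 0 \<and> d \<cdot>\<^sub>v unit_vec l k \<in> zlat l vs"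
    using root_in_DL[of k l k l 1 1] assms(2) two_unit_vec[of k l] by (intro exI[of _ 2]) auto
qed

lemma int_square_less:
  fixes n k :: int
  assumes "n * n < k * k" "0 \<le> k"
  shows "- k < n \<and> n < k"
proof -
  have "\<bar>n\<bar> < k"
  proof (rule ccontr)
    assume "\<not> \<bar>n\<bar> < k"
    then have "k * k \<le> \<bar>n\<bar> * \<bar>n\<bar>" using assms(2) by (intro mult_mono) auto
    with assms(1) show False by (simp add: abs_mult_self_eq)
  qed
  then show ?thesis by auto
qed

text \<open>Products with 2 e_i and e_i - e_j force the coordinates to be all integral or all
  half-integral. A sum of squares below 2 then leaves at most one entry \<plusminus>1 in the first
  case and only entries \<plusminus>1/2 in the second.\<close>

lemma DL_dual_short:
  assumes l: "2 \<le> l" "l \<le> n" and x: "x \<in> carrier_vec n" "\<And>w. w \<in> DL n l \<Longrightarrow> x \<bullet> w \<in> \<int>"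
    and nrm: "(\<Sum>i<l. x $ i * x $ i) < 2"
  obtains (zero) "\<And>i. i < l \<Longrightarrow> x $ i = 0"
  | (vector) k s where "k < l" "s = 1 \<or> s = -1" "\<And>i. i < l \<Longrightarrow> x $ i = (if i = k then s else 0)"
  | (spinor) A where "A \<subseteq> {..<l}" "\<And>i. i < l \<Longrightarrow> x $ i = (if i \<in> A then -1/2 else 1/2)"
proof -
  have two: "2 * x $ i \<in> \<int>" if "i < l" for i
    using x(2)[OF root_in_DL[of i l i n 1 1]] root_dot(2)[of i n i x 1 1] that l x(1) by simp
  have dif: "x $ i - x $ j \<in> \<int>" if "i < l" "j < l" for i j
    using x(2)[OF root_in_DL[of i l j n 1 "-1"]] root_dot(2)[of i n j x 1 "-1"] that l x(1) by simp
  have sub: "(\<Sum>i\<in>S. x $ i * x $ i) < 2" if "S \<subseteq> {..<l}" for S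
    using sum_mono2[of "{..<l}" S "\<lambda>i. x $ i * x $ i"] that nrm by force
  show thesis
  proof (cases "x $ 0 \<in> \<int>")
    case True
    have int: "x $ i \<in> \<int>" if "i < l" for i
      using Ints_add[OF dif[OF that, of 0] True] l by simp
    have one: "1 \<le> x $ i * x $ i" if i: "i < l" "x $ i \<noteq> 0" for i
    proof -
      obtain a where a: "x $ i = of_int a" using int[OF i(1)] by (auto elim: Ints_cases)
      then have "a \<noteq> 0" using i(2) by auto
      then have "0 < a * a" by (auto simp: zero_less_mult_iff)
      then have "1 \<le> a * a" by linarith
      then show ?thesis using a by (metis of_int_1_le_iff of_int_mult)
    qed
    show thesis
    proof (cases "\<exists>k<l. x $ k \<noteq> 0")
      case False
      then show thesis using zero by blast
    next
      case True
      then obtain k where k: "k < l" "x $ k \<noteq> 0" by blast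
      have "x $ j = 0" if "j < l" "j \<noteq> k" for j
      proof (rule ccontr)
        assume "x $ j \<noteq> 0"
        then show False using sub[of "{k, j}"] that k one[of k] one[of j] by auto
      qed
      moreover obtain a where a: "x $ k = of_int a" using int[OF k(1)] by (auto elim: Ints_cases)
      have "real_of_int (a * a) < 2" using sub[of "{k}"] k a by simp
      then have "a * a < 2 * 2" by linarith
      then have "- 2 < a \<and> a < 2" by (rule int_square_less) simp
      then have "a = 1 \<or> a = -1" using k a by auto
      ultimately show thesis using vector[of k "x $ k"] k a by auto
    qed
  next
    case False
    have half: "x $ i = 1 / 2 \<or> x $ i = - 1 / 2" if i: "i < l" for i
    proof -
      obtain a where a: "2 * x $ i = of_int a" using two[OF i] by (auto elim: Ints_cases)
      have "odd a"
      proof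
        assume "even a"
        then obtain b where "a = 2 * b" by (auto elim: evenE)
        then have "x $ i \<in> \<int>" using a by simp
        then have "x $ 0 \<in> \<int>" using Ints_add[OF dif[of 0 i]] i l by fastforce
        with False show False by simp
      qed
      \<comment> \<open>A single coordinate already has square below 2, so 2 x_i is an odd integer
        of square less than 9.\<close>
      have "(2 * x $ i) * (2 * x $ i) < 8" using sub[of "{i}"] i by simp
      then have "real_of_int (a * a) < 8" using a by simp
      then have "a * a < 3 * 3" by linarith
      then have "- 3 < a \<and> a < 3" by (rule int_square_less) simp
      then have "a = 1 \<or> a = -1" using \<open>odd a\<close> by presburger
      then show ?thesis using a by auto
    qed
    show thesis
      by (rule spinor[of "{i. i < l \<and> x $ i < 0}"]) (use half in force)+
  qed
qed

text \<open>Whether m belongs to A is determined by the rest of A and the prescribed parity, so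
  deleting m is a bijection onto all subsets of \<open>{..<m}\<close>.\<close>

lemma card_parity_subsets:
  "card {A. A \<subseteq> {..<Suc m} \<and> even (card A) = P} = 2 ^ m"
proof -
  let ?g = "\<lambda>B. if even (card B) = P then B else insert m B"
  have fin: "finite B" if "B \<subseteq> {..<m}" for B using that finite_subset by blast
  have "bij_betw (\<lambda>A. A - {m}) {A. A \<subseteq> {..<Suc m} \<and> even (card A) = P} (Pow {..<m})"
  proof (rule bij_betw_byWitness[where f' = ?g])
    show "\<forall>A\<in>{A. A \<subseteq> {..<Suc m} \<and> even (card A) = P}. ?g (A - {m}) = A"
    proof
      fix A assume "A \<in> {A. A \<subseteq> {..<Suc m} \<and> even (card A) = P}"
      then have A: "A \<subseteq> {..<Suc m}" "even (card A) = P" by auto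
      then have "finite A" using finite_subset by blast
      then show "?g (A - {m}) = A"
      proof (cases "m \<in> A")
        case True
        then have "card A = Suc (card (A - {m}))" by (rule card.remove[OF \<open>finite A\<close>])
        then have "(even (card (A - {m})) = P) = False" using A(2) by auto
        then show ?thesis using insert_Diff[OF True] by (simp only: if_False)
      next
        case False
        then have "A - {m} = A" by simp
        then show ?thesis using A(2) by simp
      qed
    qed
    show "\<forall>B\<in>Pow {..<m}. ?g B - {m} = B" by auto
    show "(\<lambda>A. A - {m}) ` {A. A \<subseteq> {..<Suc m} \<and> even (card A) = P} \<subseteq> Pow {..<m}"
      by (auto simp: less_Suc_eq)
    show "?g ` Pow {..<m} \<subseteq> {A. A \<subseteq> {..<Suc m} \<and> even (card A) = P}"
    proof
      fix A assume "A \<in> ?g ` Pow {..<m}"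
      then obtain B where "A = ?g B" "B \<in> Pow {..<m}" by (rule imageE)
      then have B: "B \<subseteq> {..<m}" "A = ?g B" by simp_all
      moreover have "card (insert m B) = Suc (card B)" using B fin[of B] by (subst card_insert_disjoint) auto
      ultimately show "A \<in> {A. A \<subseteq> {..<Suc m} \<and> even (card A) = P}" by (auto simp: less_Suc_eq)
    qed
  qed
  then show ?thesis by (simp add: bij_betw_same_card card_Pow)
qed

section \<open>Vector and spin weights of D_l\<close>

text \<open>The weights of the vector representation. The spin weights defined next are those of the
  two half-spin representations, told apart by the parity of the number of minus signs.\<close>

definition vector_weights :: "nat \<Rightarrow> real vec set" where
  "vector_weights l = {vec l (\<lambda>i. if i = k then s else 0) | k s. k < l \<and> (s = 1 \<or> s = -1)}"

definition spin_weight :: "nat \<Rightarrow> nat set \<Rightarrow> real vec" where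
  "spin_weight l A = vec l (\<lambda>i. if i \<in> A then -1/2 else 1/2)"

definition spin_weights :: "nat \<Rightarrow> bool \<Rightarrow> real vec set" where
  "spin_weights l P = spin_weight l ` {A. A \<subseteq> {..<l} \<and> even (card A) = P}"

lemma spin_weight_inj: "inj_on (spin_weight l) (Pow {..<l})"
proof (rule inj_onI)
  fix A B assume *: "A \<in> Pow {..<l}" "B \<in> Pow {..<l}" "spin_weight l A = spin_weight l B"
  have "i \<in> A \<longleftrightarrow> i \<in> B" if "i < l" for i
  proof -
    have "spin_weight l A $ i = spin_weight l B $ i" using * by simp
    then show ?thesis using that by (auto simp: spin_weight_def split: if_splits)
  qed
  with * show "A = B" by blast
qed

lemma card_spin_weights: "card (spin_weights (Suc m) P) = 2 ^ m"
  unfolding spin_weights_def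
  by (subst card_image) (auto intro: inj_on_subset[OF spin_weight_inj] simp: card_parity_subsets)

lemma card_vector_weights: "card (vector_weights l) = 2 * l"
proof -
  let ?f = "\<lambda>(k, s). vec l (\<lambda>i. if i = k then s else 0) :: real vec"
  have "vector_weights l = ?f ` ({..<l} \<times> {1, -1})" by (auto simp: vector_weights_def image_def)
  moreover have "inj_on ?f ({..<l} \<times> {1, -1})"
  proof (rule inj_onI, clarify)
    fix k k' and s s' :: real
    assume *: "k < l" "k' < l" "s \<in> {1, -1}" "s' \<in> {1, -1}"
      "vec l (\<lambda>i. if i = k then s else 0) = vec l (\<lambda>i. if i = k' then s' else 0)"
    have "s = (if k = k' then s' else 0)"
      using arg_cong[OF *(5), of "\<lambda>v. v $ k"] *(1) by simp
    then show "k = k' \<and> s = s'" using *(3) by (auto split: if_splits)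
  qed
  ultimately show ?thesis by (simp add: card_image card_cartesian_product)
qed

lemma sum_spin_weight:
  assumes "A \<subseteq> {..<l}"
  shows "(\<Sum>i<l. spin_weight l A $ i) = l / 2 - card A"
proof -
  have "(\<Sum>i<l. spin_weight l A $ i) = (\<Sum>i<l. 1/2 - (if i \<in> A then 1 else 0))"
    by (intro sum.cong) (auto simp: spin_weight_def)
  also have "\<dots> = l / 2 - card ({..<l} \<inter> A)"
    by (simp add: sum_subtractf sum.inter_restrict[symmetric])
  finally show ?thesis using assms by (simp add: Int_absorb1)
qed

lemma spin_weight_norm: "spin_weight l A \<bullet> spin_weight l A = l / 4"
  by (simp add: scalar_prod_def spin_weight_def if_distrib cong: if_cong)

lemma vector_weight_norm:
  assumes "x \<in> vector_weights l"
  shows "x \<bullet> x = 1"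
proof -
  obtain k s where k: "k < l" "s = 1 \<or> s = -1" "x = vec l (\<lambda>i. if i = k then s else 0)"
    using assms by (auto simp: vector_weights_def)
  have "x \<bullet> x = (\<Sum>i\<in>{0..<l}. if i = k then s * s else 0)"
    unfolding k(3) scalar_prod_def by (intro sum.cong) auto
  then show ?thesis using k by auto
qed

lemma dot_DL_Ints:
  assumes "w \<in> DL n l" "x \<in> carrier_vec n" "l \<le> n"
    and "(\<forall>i<l. x $ i \<in> \<int>) \<or> (\<exists>A\<subseteq>{..<l}. \<forall>i<l. x $ i = (if i \<in> A then -1/2 else 1/2))"
  shows "x \<bullet> w \<in> \<int>"
proof -
  obtain z :: "nat \<Rightarrow> int" where z: "w \<in> carrier_vec n" "\<And>i. i < l \<Longrightarrow> w $ i = of_int (z i)"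
    "even (\<Sum>i<l. z i)" "\<And>i. l \<le> i \<Longrightarrow> i < n \<Longrightarrow> w $ i = 0" using DLE[OF assms(1)] by blast
  have "x \<bullet> w = (\<Sum>i\<in>{0..<n}. x $ i * w $ i)" using z by (simp add: scalar_prod_def)
  also have "\<dots> = (\<Sum>i<l. x $ i * of_int (z i))"
    using z assms(3) by (intro sum.mono_neutral_cong_right) auto
  finally have xw: "x \<bullet> w = (\<Sum>i<l. x $ i * of_int (z i))" .
  from assms(4) show ?thesis
  proof
    assume "\<forall>i<l. x $ i \<in> \<int>"
    then show ?thesis unfolding xw by (intro Ints_sum Ints_mult) auto
  next
    assume "\<exists>A\<subseteq>{..<l}. \<forall>i<l. x $ i = (if i \<in> A then -1/2 else 1/2)"
    then obtain A where A: "\<And>i. i < l \<Longrightarrow> x $ i = (if i \<in> A then -1/2 else 1/2)" by blast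
    obtain k where k: "(\<Sum>i<l. z i) = 2 * k" using z(3) by (auto elim: evenE)
    \<comment> \<open>Replacing a coordinate 1/2 by -1/2 subtracts the integer z i; the remaining
      half sum is integral because the coordinate sum is even.\<close>
    have "x \<bullet> w = (\<Sum>i<l. of_int (z i) / 2 - of_int (if i \<in> A then z i else 0))"
      unfolding xw using A by (intro sum.cong) auto
    also have "\<dots> = of_int (\<Sum>i<l. z i) / 2 - of_int (\<Sum>i<l. if i \<in> A then z i else 0)"
      unfolding sum_subtractf sum_divide_distrib[symmetric] of_int_sum ..
    also have "\<dots> \<in> \<int>" unfolding k by (rule Ints_diff[OF _ Ints_of_int]) simp
    finally show ?thesis .
  qed
qed

lemma spin_weight_carrier [simp]: "spin_weight l A \<in> carrier_vec l" "dim_vec (spin_weight l A) = l"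
  by (simp_all add: spin_weight_def)

lemma spin_weight_nth: "i < l \<Longrightarrow> spin_weight l A $ i = (if i \<in> A then -1/2 else 1/2)"
  by (simp add: spin_weight_def)

lemma half_not_Ints: "(1/2 :: real) \<notin> \<int>" "(-1/2 :: real) \<notin> \<int>"
proof -
  show *: "(1/2 :: real) \<notin> \<int>"
  proof
    assume "(1/2 :: real) \<in> \<int>"
    then obtain a where "(1/2 :: real) = of_int a" by (auto elim: Ints_cases)
    then have "2 * a = 1" by linarith
    then show False by presburger
  qed
  then show "(-1/2 :: real) \<notin> \<int>" using minus_in_Ints_iff[of "1/2 :: real"] by simp
qed

lemma vector_weightE:
  assumes "x \<in> vector_weights l"
  obtains k and s :: int where "k < l" "s = 1 \<or> s = -1" "x \<in> carrier_vec l"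
    "\<And>i. i < l \<Longrightarrow> x $ i = of_int (if i = k then s else 0)"
proof -
  obtain k s where k: "k < l" "s = 1 \<or> s = -1" "x = vec l (\<lambda>i. if i = k then s else 0)"
    using assms by (auto simp: vector_weights_def)
  obtain t :: int where "s = of_int t" using k(2) by (metis of_int_1 of_int_minus)
  with k show thesis by (intro that[of k t]) auto
qed

lemma vector_weight_diff:
  assumes "x \<in> vector_weights l" "y \<in> vector_weights l"
  shows "y - x \<in> DL l l"
proof -
  obtain k s where k: "k < l" "s = 1 \<or> s = -1" "x \<in> carrier_vec l"
    "\<And>i. i < l \<Longrightarrow> x $ i = of_int (if i = k then s else 0)" by (rule vector_weightE[OF assms(1)]) blast
  obtain m t where m: "m < l" "t = 1 \<or> t = -1" "y \<in> carrier_vec l"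
    "\<And>i. i < l \<Longrightarrow> y $ i = of_int (if i = m then t else 0)" by (rule vector_weightE[OF assms(2)]) blast
  have "(\<Sum>i<l. (if i = m then t else 0) - (if i = k then s else 0)) = t - s"
    using k m by (simp add: sum_subtractf)
  then show ?thesis
    by (intro DLI[of _ _ _ "\<lambda>i. (if i = m then t else 0) - (if i = k then s else 0)"])
      (use k m in auto)
qed

text \<open>The difference is integral with coordinate sum card A - card B, so only the parity
  condition of D_l is at stake.\<close>

lemma spin_weight_diff:
  assumes "A \<subseteq> {..<l}" "B \<subseteq> {..<l}"
  shows "spin_weight l B - spin_weight l A \<in> DL l l \<longleftrightarrow> (even (card A) = even (card B))"
proof -
  let ?z = "\<lambda>i. (if i \<in> A then 1 else 0) - (if i \<in> B then 1 else 0) :: int"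
  have n: "(spin_weight l B - spin_weight l A) $ i = of_int (?z i)" if "i < l" for i
    using that by (simp add: spin_weight_nth)
  have s: "(\<Sum>i<l. ?z i) = int (card A) - int (card B)"
    using assms by (simp add: sum_subtractf sum.inter_restrict[symmetric] Int_absorb1)
  show ?thesis
  proof
    assume "spin_weight l B - spin_weight l A \<in> DL l l"
    then obtain z :: "nat \<Rightarrow> int" where z: "\<And>i. i < l \<Longrightarrow> (spin_weight l B - spin_weight l A) $ i = of_int (z i)"
      "even (\<Sum>i<l. z i)" using DLE by blast
    have "z i = ?z i" if "i < l" for i using z(1)[OF that] n[OF that] by linarith
    then have "(\<Sum>i<l. z i) = (\<Sum>i<l. ?z i)" by (intro sum.cong) auto
    with z(2) s show "even (card A) = even (card B)" by auto
  next
    assume "even (card A) = even (card B)"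
    then show "spin_weight l B - spin_weight l A \<in> DL l l"
      by (intro DLI[of _ _ _ ?z]) (use n s in auto)
  qed
qed

lemma DL_nth_Ints: "x \<in> DL n l \<Longrightarrow> i < l \<Longrightarrow> x $ i \<in> \<int>"
  by (metis DLE Ints_of_int)

lemma vector_spin_diff:
  assumes "x \<in> vector_weights l" "A \<subseteq> {..<l}"
  shows "spin_weight l A - x \<notin> DL l l" "x - spin_weight l A \<notin> DL l l"
proof -
  obtain k s where k: "k < l" "x \<in> carrier_vec l"
    "\<And>i. i < l \<Longrightarrow> x $ i = of_int (if i = k then s else 0)" using vector_weightE[OF assms(1)] by metis
  have *: "spin_weight l A $ k \<notin> \<int>" using k(1) half_not_Ints by (simp add: spin_weight_nth)
  show "spin_weight l A - x \<notin> DL l l"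
  proof
    assume "spin_weight l A - x \<in> DL l l"
    then have "spin_weight l A $ k - of_int s \<in> \<int>" using DL_nth_Ints[of _ l l k] k by fastforce
    then have "spin_weight l A $ k - of_int s + of_int s \<in> \<int>" by (intro Ints_add) auto
    with * show False by simp
  qed
  show "x - spin_weight l A \<notin> DL l l"
  proof
    assume "x - spin_weight l A \<in> DL l l"
    then have "of_int s - spin_weight l A $ k \<in> \<int>" using DL_nth_Ints[of _ l l k] k by fastforce
    then have "of_int s - (of_int s - spin_weight l A $ k) \<in> \<int>" by (intro Ints_diff) auto
    with * show False by simp
  qed
qed

text \<open>A spin weight has norm l / 4, which is below 2 exactly for l < 8. This is the origin of
  the different behaviour beyond rank 7.\<close>

lemma short_weights_DL:
  assumes "2 \<le> l"
  shows "short_weights l (DL l l) = vector_weights l \<union>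
    (if l < 8 then spin_weights l True \<union> spin_weights l False else {})" (is "_ = ?R")
proof
  show "short_weights l (DL l l) \<subseteq> ?R"
  proof
    fix x assume x: "x \<in> short_weights l (DL l l)"
    then have xc: "x \<in> carrier_vec l" "x \<noteq> 0\<^sub>v l" "\<And>w. w \<in> DL l l \<Longrightarrow> x \<bullet> w \<in> \<int>"
      and nrm: "(\<Sum>i<l. x $ i * x $ i) < 2"
      by (auto simp: short_weights_def scalar_prod_def lessThan_atLeast0)
    show "x \<in> ?R"
    proof (rule DL_dual_short[OF assms le_refl xc(1,3) nrm])
      assume "\<And>i. i < l \<Longrightarrow> x $ i = 0"
      then have "x = 0\<^sub>v l" using xc(1) by (intro eq_vecI) auto
      with xc(2) show ?thesis by simp
    next
      fix k s assume vector: "k < l" "s = 1 \<or> s = -1" "\<And>i. i < l \<Longrightarrow> x $ i = (if i = k then s else 0)"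
      then have "x = vec l (\<lambda>i. if i = k then s else 0)" using xc(1) by (intro eq_vecI) auto
      with vector show ?thesis by (auto simp: vector_weights_def)
    next
      fix A assume spinor: "A \<subseteq> {..<l}" "\<And>i. i < l \<Longrightarrow> x $ i = (if i \<in> A then -1/2 else 1/2)"
      then have x_eq: "x = spin_weight l A" using xc(1) by (intro eq_vecI) (auto simp: spin_weight_nth)
      have "l / 4 < (2 :: real)" using x spin_weight_norm[of l A] x_eq by (simp add: short_weights_def)
      then have "l < 8" by simp
      with x_eq spinor show ?thesis by (cases "even (card A)") (auto simp: spin_weights_def)
    qed
  qed
  show "?R \<subseteq> short_weights l (DL l l)"
  proof
    fix x assume x: "x \<in> ?R"
    consider "x \<in> vector_weights l" | A where "l < 8" "A \<subseteq> {..<l}" "x = spin_weight l A"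
      using x by (auto simp: spin_weights_def split: if_splits)
    then show "x \<in> short_weights l (DL l l)"
    proof cases
      case 1
      then have n: "x \<bullet> x = 1" by (rule vector_weight_norm)
      obtain k s where k: "k < l" "x \<in> carrier_vec l"
        "\<And>i. i < l \<Longrightarrow> x $ i = of_int (if i = k then s else 0)" using vector_weightE[OF 1] by metis
      then have "\<forall>i<l. x $ i \<in> \<int>" by (metis Ints_of_int)
      then have "x \<bullet> w \<in> \<int>" if "w \<in> DL l l" for w
        using dot_DL_Ints[OF that k(2)] by blast
      moreover have "x \<noteq> 0\<^sub>v l" using n by auto
      ultimately show ?thesis using n k(2) by (simp add: short_weights_def)
    next
      case 2
      then have "x \<bullet> w \<in> \<int>" if "w \<in> DL l l" for w
        using dot_DL_Ints[OF that, of x] by (auto simp: spin_weight_nth)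
      moreover have "x \<noteq> 0\<^sub>v l"
        using 2 spin_weight_norm[of l A] assms by auto
      ultimately show ?thesis using 2 spin_weight_norm[of l A] by (auto simp: short_weights_def)
    qed
  qed
qed

lemma weight_class_vector:
  assumes "2 \<le> l" "x \<in> vector_weights l"
  shows "weight_class l (DL l l) x = vector_weights l"
  using assms vector_weight_diff[OF assms(2)] vector_spin_diff(1)[OF assms(2)]
  unfolding weight_class_def short_weights_DL[OF assms(1)]
  by (auto simp: spin_weights_def split: if_splits)

lemma weight_class_spin:
  assumes "2 \<le> l" "l < 8" "x \<in> spin_weights l P"
  shows "weight_class l (DL l l) x = spin_weights l P"
proof -
  obtain A where A: "A \<subseteq> {..<l}" "even (card A) = P" "x = spin_weight l A"
    using assms(3) by (auto simp: spin_weights_def)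
  show ?thesis
  proof (rule Set.set_eqI)
    fix y
    show "y \<in> weight_class l (DL l l) x \<longleftrightarrow> y \<in> spin_weights l P" (is "?L \<longleftrightarrow> ?R")
    proof
      assume ?L
      then have y: "y \<in> short_weights l (DL l l)" "y - x \<in> DL l l" by (auto simp: weight_class_def)
      have "y \<notin> vector_weights l" using vector_spin_diff(2)[of y l A] A y by auto
      then obtain B where B: "B \<subseteq> {..<l}" "y = spin_weight l B"
        using y(1) short_weights_DL[OF assms(1)] by (auto simp: spin_weights_def split: if_splits)
      then have "even (card A) = even (card B)" using y(2) A spin_weight_diff by simp
      with A B show ?R by (auto simp: spin_weights_def)
    next
      assume ?R
      then obtain B where B: "B \<subseteq> {..<l}" "even (card B) = P" "y = spin_weight l B"
        by (auto simp: spin_weights_def)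
      then have "y - x \<in> DL l l" using A spin_weight_diff by simp
      moreover have "y \<in> short_weights l (DL l l)"
        using \<open>?R\<close> short_weights_DL[OF assms(1)] assms(2) by (cases P) auto
      ultimately show ?L by (simp add: weight_class_def)
    qed
  qed
qed

text \<open>The roots \<open>e_m - e_{m+1}\<close> together with one root \<open>e_p + e_{p+1}\<close>. For \<open>p = l - 2\<close> this is the
  usual base of \<open>D_l\<close>; for other \<open>p\<close> the diagram is a 4-cycle with two tails.\<close>

definition D_chain :: "nat \<Rightarrow> nat \<Rightarrow> nat \<Rightarrow> real vec" where
  "D_chain l p m = (if m < l - 1 then root l m 1 (Suc m) (-1) else root l p 1 (Suc p) 1)"

lemma D_chain_carrier [simp]: "D_chain l p m \<in> carrier_vec l" "dim_vec (D_chain l p m) = l"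
  by (simp_all add: D_chain_def)

lemma D_chain_dot:
  assumes "i < l" "j < l" "Suc p < l"
  shows "D_chain l p i \<bullet> D_chain l p j = (if i = j then 2
    else if i < l - 1 \<and> j < l - 1 then (if j = Suc i \<or> i = Suc j then -1 else 0)
    else if i < l - 1 then (if i = Suc p then 1 else if Suc i = p then -1 else 0)
    else (if j = Suc p then 1 else if Suc j = p then -1 else 0))"
proof -
  have [simp]: "Suc m < l" if "m < l - 1" for m using that by simp
  consider "i < l - 1" "j < l - 1" | "i < l - 1" "j = l - 1" | "i = l - 1" "j < l - 1" | "i = l - 1" "j = l - 1"
    using assms by linarith
  then show ?thesis
    by cases (use assms in \<open>auto simp: D_chain_def root_dot(1)\<close>)
qed

text \<open>The permutation \<mu> absorbs the numbering of the vertices and the signs \<epsilon>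
  absorb the dotting; neither affects the lattice.\<close>

lemma zlat_signed_D_chain:
  assumes p: "Suc p < l" and \<mu>: "bij_betw \<mu> {..<l} {..<l}" and \<epsilon>: "\<And>i. i < l \<Longrightarrow> \<epsilon> i = 1 \<or> \<epsilon> i = (-1 :: real)"
  defines "vs \<equiv> map (\<lambda>i. \<epsilon> i \<cdot>\<^sub>v D_chain l p (\<mu> i)) [0..<l]"
  shows "zlat l vs = DL l l"
proof
  have vsc: "set vs \<subseteq> carrier_vec l" by (auto simp: vs_def)
  have len: "length vs = l" by (simp add: vs_def)
  have \<mu>l: "\<mu> i < l" if "i < l" for i using bij_betwE[OF \<mu>] that by auto
  have ch: "D_chain l p m \<in> DL l l" if "m < l" for m
    using that p by (auto simp: D_chain_def intro!: root_in_DL)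
  have "\<epsilon> i \<cdot>\<^sub>v D_chain l p (\<mu> i) \<in> DL l l" if i: "i < l" for i
  proof -
    have z: "0\<^sub>v l \<in> DL l l" by (rule DLI[of _ _ _ "\<lambda>_. 0"]) auto
    have "0\<^sub>v l + \<epsilon> i \<cdot>\<^sub>v D_chain l p (\<mu> i) \<in> DL l l"
      using DL_step[OF le_refl z ch[OF \<mu>l[OF i]] \<epsilon>[OF i]] .
    then show ?thesis by simp
  qed
  then have "set vs \<subseteq> DL l l" by (auto simp: vs_def)
  then show "zlat l vs \<subseteq> DL l l" by (rule zlat_subset_DL[OF le_refl vsc])
  have mem: "D_chain l p m \<in> zlat l vs" if "m < l" for m
  proof -
    have "m \<in> \<mu> ` {..<l}" using \<mu> that by (simp add: bij_betw_def)
    then obtain i where i: "i < l" "\<mu> i = m" by auto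
    have v: "vs ! i = \<epsilon> i \<cdot>\<^sub>v D_chain l p m" using i by (simp add: vs_def)
    have "of_int 1 \<cdot>\<^sub>v vs ! i \<in> zlat l vs" "of_int (-1) \<cdot>\<^sub>v vs ! i \<in> zlat l vs"
      using zlat_smult_nth[of i vs l] i vsc len by metis+
    then show ?thesis using v \<epsilon>[OF i(1)] by (auto simp: smult_smult_assoc)
  qed
  show "DL l l \<subseteq> zlat l vs"
  proof (rule DL_subset_zlat[OF le_refl _ vsc _ p])
    show "root l m 1 (Suc m) (-1) \<in> zlat l vs" if "Suc m < l" for m
      using mem[of m] that by (simp add: D_chain_def less_diff_conv)
    show "root l p 1 (Suc p) 1 \<in> zlat l vs"
      using mem[of "l - 1"] p by (simp add: D_chain_def)
  qed (use p in simp)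
qed

lemma D_model:
  assumes "rank \<Gamma> = l" "Suc p < l" "bij_betw \<mu> {..<l} {..<l}" "\<And>i. i < l \<Longrightarrow> \<epsilon> i = 1 \<or> \<epsilon> i = (-1 :: real)"
    and g: "\<And>i j. i < l \<Longrightarrow> j < l \<Longrightarrow> cartan \<Gamma> $$ (i, j) = \<epsilon> i * \<epsilon> j * (D_chain l p (\<mu> i) \<bullet> D_chain l p (\<mu> j))"
  shows "\<exists>\<tau>s. model \<Gamma> \<tau>s l \<and> zlat l \<tau>s = DL l l"
proof -
  let ?vs = "map (\<lambda>i. \<epsilon> i \<cdot>\<^sub>v D_chain l p (\<mu> i)) [0..<l]"
  have z: "zlat l ?vs = DL l l" using zlat_signed_D_chain[OF assms(2-4)] .
  have c: "set ?vs \<subseteq> carrier_vec l" by auto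
  have "model \<Gamma> ?vs l"
    by unfold_locales (use assms(1) g c DL_nondeg[OF c z] in auto)
  with z show ?thesis by blast
qed

lemma D_chain_gram:
  assumes "i < p + 4" "j < p + 4"
  shows "D_chain (p + 4) (p + 2) i \<bullet> D_chain (p + 4) (p + 2) j = of_int (D_entry (p + 4) i j)"
proof -
  have "p + 4 - 1 = p + 3" by simp
  then show ?thesis
    using assms D_chain_dot[of i "p + 4" j "p + 2"] D_entry_add[of p i j] by auto
qed

section \<open>Attaching a vertex to a Dynkin diagram\<close>

text \<open>The integer counterpart of \<open>extended_gram\<close> when the new root has label -1
  at e and 0 elsewhere.\<close>

definition attach :: "(nat \<Rightarrow> nat \<Rightarrow> int) \<Rightarrow> nat \<Rightarrow> nat \<Rightarrow> nat \<Rightarrow> nat \<Rightarrow> int" where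
  "attach G l e i j = (if i < l \<and> j < l then G i j
     else if i < l then (if i = e then -1 else 0) else if j < l then (if j = e then -1 else 0) else 2)"

text \<open>Bijectivity of the relabelling f is encoded by bounded quantifiers, so that concrete
  instances can be evaluated.\<close>

definition is_attachment ::
  "(nat \<Rightarrow> nat \<Rightarrow> int) \<Rightarrow> (nat \<Rightarrow> nat \<Rightarrow> int) \<Rightarrow> nat \<Rightarrow> nat \<Rightarrow> (nat \<Rightarrow> nat) \<Rightarrow> bool" where
  "is_attachment G' G l e f \<longleftrightarrow>
     (\<forall>a<l + 1. f a < l + 1) \<and> (\<forall>a<l + 1. \<forall>b<l + 1. f a = f b \<longrightarrow> a = b) \<and>
     (\<forall>a<l + 1. \<forall>b<l + 1. G' a b = attach G l e (f a) (f b))"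

lemma all_less_iff_list_all: "(\<forall>a<n. P a) \<longleftrightarrow> list_all P [0..<n]"
  by (auto simp: list_all_iff)

text \<open>The chain grows at its free end: the new vertex becomes vertex 0 and all others move up
  by one.\<close>

lemma D_attach_D:
  "is_attachment (D_entry (p + 4 + 1)) (D_entry (p + 4)) (p + 4) 0 (\<lambda>a. if a = 0 then p + 4 else a - 1)"
  unfolding is_attachment_def
proof (intro conjI allI impI)
  fix a assume a: "a < p + 4 + 1"
  then show "(if a = 0 then p + 4 else a - 1) < p + 4 + 1" by (cases a) auto
  fix b assume b: "b < p + 4 + 1"
  then show "a = b" if "(if a = 0 then p + 4 else a - 1) = (if b = 0 then p + 4 else b - 1)"
    using that a by (auto split: if_splits)
  have "p + 4 + 1 = (p + 1) + 4" by simp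
  then have "D_entry (p + 4 + 1) = D_entry ((p + 1) + 4)" by (rule arg_cong)
  then show "D_entry (p + 4 + 1) a b = attach (D_entry (p + 4)) (p + 4) 0
      (if a = 0 then p + 4 else a - 1) (if b = 0 then p + 4 else b - 1)"
    using a b by (cases a; cases b) (auto simp only: D_entry_add attach_def, auto)
qed

text \<open>Attaching the vertex \<open>l\<close> to the vertex \<open>e\<close> of the fork \<open>e\<close>, \<open>e'\<close> of \<open>D_l\<close> gives \<open>E_{l+1}\<close>, whose long
  chain runs through \<open>l\<close>, \<open>e\<close>, \<open>l - 3\<close>, \<open>\<dots>\<close>, \<open>0\<close> while \<open>e'\<close> is its short arm.\<close>

definition E_labelling :: "nat \<Rightarrow> nat \<Rightarrow> nat \<Rightarrow> nat \<Rightarrow> nat" where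
  "E_labelling l e e' a = (if a = 0 then l else if a = 1 then e else if a = l then e' else l - 1 - a)"

lemma D_attach_E:
  assumes "l \<in> {4, 5, 6, 7}" "(e, e') = (l - 1, l - 2) \<or> (e, e') = (l - 2, l - 1)"
  shows "is_attachment (E_entry (l + 1)) (D_entry l) l e (E_labelling l e e')"
proof -
  have "list_all (\<lambda>l. list_all (\<lambda>(e, e').
      is_attachment (E_entry (l + 1)) (D_entry l) l e (E_labelling l e e'))
      [(l - 1, l - 2), (l - 2, l - 1)]) [4, 5, 6, 7]"
    unfolding is_attachment_def all_less_iff_list_all by code_simp
  with assms show ?thesis by auto
qed

text \<open>E_6 has two arms of length 2, and lengthening either gives E_7, with the chain reversed
  in the second case; the two choices serve the two components. For E_7 the longest arm is
  lengthened.\<close>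

lemma E_attach_E:
  "is_attachment (E_entry 7) (E_entry 6) 6 4 ((!) [0, 1, 2, 3, 4, 6, 5])"
  "is_attachment (E_entry 7) (E_entry 6) 6 0 ((!) [4, 3, 2, 1, 0, 6, 5])"
  "is_attachment (E_entry 8) (E_entry 7) 7 5 ((!) [0, 1, 2, 3, 4, 5, 7, 6])"
  unfolding is_attachment_def all_less_iff_list_all by code_simp+

lemma bij_betw_of_inj:
  fixes f :: "nat \<Rightarrow> nat"
  assumes "\<forall>a<n. f a < n" "\<forall>a<n. \<forall>b<n. f a = f b \<longrightarrow> a = b"
  shows "bij_betw f {..<n} {..<n}"
proof -
  have "inj_on f {..<n}" using assms(2) by (intro inj_onI) auto
  moreover have "f ` {..<n} \<subseteq> {..<n}" using assms(1) by auto
  ultimately show ?thesis by (metis bij_betw_def endo_inj_surj finite_lessThan)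
qed

lemma dynkin_dotted [simp]: "dotted (dynkin_D m) = {}" "dotted (dynkin_E m) = {}"
  by (simp_all add: dynkin_D_def dynkin_E_def)

lemma image_constant_on:
  assumes "X \<noteq> {}" "\<And>x. x \<in> X \<Longrightarrow> f x = c"
  shows "f ` X = {c}"
  using assms by auto

context model
begin

text \<open>A coset gets its type from one representative with label -1 at a single base vertex e:
  the base and the new root then form a Dynkin diagram with a vertex attached at e.\<close>

lemma attachment_type:
  assumes bs: "length bs = l" "set bs \<subseteq> carrier_vec l" "zlat l bs = \<Lambda>"
    and g: "\<And>i j. i < l \<Longrightarrow> j < l \<Longrightarrow> bs ! i \<bullet> bs ! j = of_int (G i j)"
    and \<Delta>: "rank (\<Delta> (l + 1)) = l + 1" "dotted (\<Delta> (l + 1)) = {}"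
    and G': "\<And>a b. a < l + 1 \<Longrightarrow> b < l + 1 \<Longrightarrow> cartan (\<Delta> (l + 1)) $$ (a, b) = of_int (G' a b)"
    and att: "is_attachment G' G l e f"
    and x0: "x0 \<in> short_weights l \<Lambda>" "\<And>i. i < l \<Longrightarrow> x0 \<bullet> bs ! i = (if i = e then -1 else 0)"
    and nrm: "\<And>y. y \<in> weight_class l \<Lambda> x0 \<Longrightarrow> y \<bullet> y = x0 \<bullet> x0"
  shows "labels \<tau>s ` weight_class l \<Lambda> x0 \<in> components_of_type \<Delta> \<Gamma>"
proof (rule weight_class_of_type[where \<Delta> = \<Delta> and f = f, OF bs \<Delta>])
  show "bij_betw f {..<l + 1} {..<l + 1}"
    using att unfolding is_attachment_def by (intro bij_betw_of_inj) blast+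
  fix a b assume "a < l + 1" "b < l + 1"
  moreover have "of_int (attach G l e i j) = extended_gram bs x0 i j" for i j
    using g x0(2) by (simp add: attach_def extended_gram_def)
  ultimately show "cartan (\<Delta> (l + 1)) $$ (a, b) = extended_gram bs x0 (f a) (f b)"
    using att G' by (simp add: is_attachment_def)
qed (use x0 nrm in auto)

lemma image_labels_eq_iff:
  assumes "A \<subseteq> carrier_vec l" "B \<subseteq> carrier_vec l"
  shows "labels \<tau>s ` A = labels \<tau>s ` B \<longleftrightarrow> A = B"
  using inj_on_image_eq_iff[OF inj_labels assms] .

lemma card_image_labels:
  assumes "A \<subseteq> carrier_vec l"
  shows "card (labels \<tau>s ` A) = card A"
  using inj_on_subset[OF inj_labels assms] by (rule card_image)

end

lemma vector_weights_nonempty: "0 < l \<Longrightarrow> vector_weights l \<noteq> {}"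
  by (auto simp: vector_weights_def)

lemma spin_weights_nonempty: "0 < l \<Longrightarrow> spin_weights l P \<noteq> {}"
proof -
  assume "0 < l"
  have "spin_weight l (if P then {} else {0}) \<in> spin_weights l P"
    unfolding spin_weights_def by (rule imageI) (use \<open>0 < l\<close> in auto)
  then show ?thesis by blast
qed

lemma weights_carrier: "vector_weights l \<subseteq> carrier_vec l" "spin_weights l P \<subseteq> carrier_vec l"
  by (auto simp: vector_weights_def spin_weights_def)

lemma zero_in_DL: "l \<le> n \<Longrightarrow> 0\<^sub>v n \<in> DL n l"
  by (rule DLI[of _ _ _ "\<lambda>_. 0"]) auto

lemma weights_disjoint:
  "vector_weights l \<inter> spin_weights l P = {}" "spin_weights l True \<inter> spin_weights l False = {}"
proof -
  have "x \<notin> spin_weights l P" if x: "x \<in> vector_weights l" for x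
  proof
    assume "x \<in> spin_weights l P"
    then obtain A where "A \<subseteq> {..<l}" "x = spin_weight l A" by (auto simp: spin_weights_def)
    then show False using vector_spin_diff(1)[OF x, of A] zero_in_DL[of l l]
      minus_cancel_vec[OF spin_weight_carrier(1), of l A] by simp
  qed
  then show "vector_weights l \<inter> spin_weights l P = {}" by blast
  show "spin_weights l True \<inter> spin_weights l False = {}"
  proof (rule equals0I)
    fix x assume "x \<in> spin_weights l True \<inter> spin_weights l False"
    then obtain A B where "A \<subseteq> {..<l}" "B \<subseteq> {..<l}" "even (card A)" "odd (card B)"
      "x = spin_weight l A" "x = spin_weight l B" by (auto simp: spin_weights_def)
    then show False using spin_weight_diff[of A l B] zero_in_DL[of l l]
      minus_cancel_vec[OF spin_weight_carrier(1), of l A] by simp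
  qed
qed

definition D_base :: "nat \<Rightarrow> real vec list" where
  "D_base l = map (D_chain l (l - 2)) [0..<l]"

lemma D_base:
  assumes "4 \<le> l"
  shows "length (D_base l) = l" "set (D_base l) \<subseteq> carrier_vec l" "zlat l (D_base l) = DL l l"
    and "i < l \<Longrightarrow> D_base l ! i = D_chain l (l - 2) i"
    and "i < l \<Longrightarrow> j < l \<Longrightarrow> D_base l ! i \<bullet> D_base l ! j = of_int (D_entry l i j)"
proof -
  show "length (D_base l) = l" "set (D_base l) \<subseteq> carrier_vec l" by (auto simp: D_base_def)
  show nth: "D_base l ! i = D_chain l (l - 2) i" if "i < l" for i using that by (simp add: D_base_def)
  have "D_base l = map (\<lambda>i. 1 \<cdot>\<^sub>v D_chain l (l - 2) (id i)) [0..<l]" by (simp add: D_base_def)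
  then show "zlat l (D_base l) = DL l l"
    using zlat_signed_D_chain[of "l - 2" l id "\<lambda>_. 1"] assms by simp
  obtain p where "l = p + 4" using assms by (metis add.commute le_Suc_ex)
  then show "D_base l ! i \<bullet> D_base l ! j = of_int (D_entry l i j)" if "i < l" "j < l" for i j
    using that D_chain_gram[of i p j] nth by simp
qed

text \<open>These two spin weights are the negatives of the fundamental weights at the two fork
  vertices: all signs minus, or all but the last.\<close>

lemma spin_weight_dot_D_base:
  assumes l: "4 \<le> l" and i: "i < l" and e: "e = l - 1 \<and> A = {..<l} \<or> e = l - 2 \<and> A = {..<l - 1}"
  shows "spin_weight l A \<bullet> D_base l ! i = (if i = e then -1 else 0)"
proof (cases "i < l - 1")
  case True
  then have "spin_weight l A \<bullet> D_base l ! i = spin_weight l A $ i - spin_weight l A $ Suc i"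
    using i l root_dot(2)[of i l "Suc i" "spin_weight l A" 1 "-1"] by (simp add: D_base D_chain_def)
  then show ?thesis using True e by (auto simp: spin_weight_nth)
next
  case False
  then have "i = l - 1" using i by simp
  then have "spin_weight l A \<bullet> D_base l ! i = spin_weight l A $ (l - 2) + spin_weight l A $ (l - 1)"
    using l root_dot(2)[of "l - 2" l "l - 1" "spin_weight l A" 1 1]
    by (simp add: D_base D_chain_def Suc_diff_Suc numeral_2_eq_2)
  then show ?thesis using \<open>i = l - 1\<close> l e by (auto simp: spin_weight_nth)
qed

text \<open>The negative of the fundamental weight at the free end of the chain of D_l.\<close>

definition minus_e0 :: "nat \<Rightarrow> real vec" where
  "minus_e0 l = vec l (\<lambda>i. if i = 0 then -1 else 0)"

lemma minus_e0:
  assumes "4 \<le> l"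
  shows "minus_e0 l \<in> vector_weights l"
    and "i < l \<Longrightarrow> minus_e0 l \<bullet> D_base l ! i = (if i = 0 then -1 else 0)"
proof -
  show "minus_e0 l \<in> vector_weights l" unfolding vector_weights_def minus_e0_def using assms by fastforce
  have c: "minus_e0 l \<in> carrier_vec l" by (simp add: minus_e0_def)
  show "minus_e0 l \<bullet> D_base l ! i = (if i = 0 then -1 else 0)" if "i < l"
    using that assms root_dot(2)[OF _ _ c] by (auto simp: D_base D_chain_def minus_e0_def)
qed

section \<open>Linkage systems of the diagrams with lattice D_l\<close>

locale D_lattice_model = model +
  assumes lat: "\<Lambda> = DL l l" and l4: "4 \<le> l"
begin

abbreviation "vector_component \<equiv> labels \<tau>s ` vector_weights l"
abbreviation "spin_component P \<equiv> labels \<tau>s ` spin_weights l P"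

lemma components_D: "components \<Gamma> = insert vector_component
    (if l < 8 then {spin_component True, spin_component False} else {})"
proof -
  let ?c = "\<lambda>x. labels \<tau>s ` weight_class l (DL l l) x"
  have l2: "2 \<le> l" using l4 by simp
  have v: "?c ` vector_weights l = {vector_component}"
    using vector_weights_nonempty[of l] l4 weight_class_vector[OF l2] by (intro image_constant_on) auto
  show ?thesis
  proof (cases "l < 8")
    case True
    have "?c ` spin_weights l P = {spin_component P}" for P
      using spin_weights_nonempty[of l] l4 weight_class_spin[OF l2 True] by (intro image_constant_on) auto
    with v True show ?thesis
      unfolding components_eq lat short_weights_DL[OF l2] by (simp add: image_Un insert_commute)
  next
    case False
    with v show ?thesis unfolding components_eq lat short_weights_DL[OF l2] by simp
  qed
qed

lemma component_distinct:
  "vector_component \<noteq> spin_component P" "spin_component True \<noteq> spin_component False"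
  "spin_component True \<inter> spin_component False = {}"
proof -
  have l0: "0 < l" using l4 by simp
  show "vector_component \<noteq> spin_component P"
    unfolding image_labels_eq_iff[OF weights_carrier]
    using weights_disjoint(1)[of l P] vector_weights_nonempty[OF l0] by blast
  show "spin_component True \<noteq> spin_component False"
    unfolding image_labels_eq_iff[OF weights_carrier(2) weights_carrier(2)]
    using weights_disjoint(2)[of l] spin_weights_nonempty[OF l0] by blast
  show "spin_component True \<inter> spin_component False = {}"
    using inj_on_image_Int[OF inj_labels weights_carrier(2) weights_carrier(2)] weights_disjoint(2)[of l]
    by (metis image_empty)
qed

lemma card_components_D:
  "card vector_component = 2 * l" "card (spin_component P) = 2 ^ (l - 1)"
  using card_image_labels[OF weights_carrier(1)] card_image_labels[OF weights_carrier(2)]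
    card_vector_weights[of l] card_spin_weights[of "l - 1" P] l4 by simp_all

lemma dual_form_D:
  "u \<in> vector_component \<Longrightarrow> dual_form \<Gamma> u = 1" "u \<in> spin_component P \<Longrightarrow> dual_form \<Gamma> u = l / 4"
  using weights_carrier[of l] vector_weight_norm[of _ l] dual_form_labels spin_weight_norm[of l]
  by (auto simp: spin_weights_def)

lemma vector_component_type: "vector_component \<in> D_components \<Gamma>"
proof -
  obtain p where p: "l = p + 4" using l4 by (metis add.commute le_Suc_ex)
  have l2: "2 \<le> l" using l4 by simp
  note x0 = minus_e0[OF l4] note B = D_base[OF l4]
  have cls: "weight_class l \<Lambda> (minus_e0 l) = vector_weights l" using weight_class_vector[OF l2 x0(1)] lat by simp
  have "labels \<tau>s ` weight_class l \<Lambda> (minus_e0 l) \<in> D_components \<Gamma>"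
  proof (rule attachment_type[OF B(1,2) _ B(5)])
    show "zlat l (D_base l) = \<Lambda>" using B(3) lat by simp
    show "is_attachment (D_entry (l + 1)) (D_entry l) l 0 (\<lambda>a. if a = 0 then p + 4 else a - 1)"
      unfolding p by (rule D_attach_D)
    show "minus_e0 l \<in> short_weights l \<Lambda>" using x0(1) short_weights_DL[OF l2] lat by simp
    show "y \<bullet> y = minus_e0 l \<bullet> minus_e0 l" if "y \<in> weight_class l \<Lambda> (minus_e0 l)" for y
      using that cls x0(1) vector_weight_norm by simp
  qed (simp_all add: cartan_dynkin_entry x0(2))
  then show ?thesis unfolding cls .
qed

lemma spin_component_type:
  assumes "l < 8"
  shows "spin_component P \<in> E_components \<Gamma>"
proof -
  \<comment> \<open>The representative must lie in the class of parity P. The set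
    \<open>{..<l}\<close> has parity that of l, and dropping one element changes it; e is the fork
    vertex where the chosen weight has label -1, e' the other one.\<close>
  define A where "A = (if even l = P then {..<l} else {..<l - 1})"
  define e where "e = (if even l = P then l - 1 else l - 2)"
  define e' where "e' = (if even l = P then l - 2 else l - 1)"
  let ?x = "spin_weight l A"
  have x: "?x \<in> spin_weights l P"
    unfolding spin_weights_def A_def using l4 by (intro imageI) auto
  have l2: "2 \<le> l" using l4 by simp
  note B = D_base[OF l4]
  have cls: "weight_class l \<Lambda> ?x = spin_weights l P" using weight_class_spin[OF l2 assms x] lat by simp
  have "labels \<tau>s ` weight_class l \<Lambda> ?x \<in> E_components \<Gamma>"
  proof (rule attachment_type[OF B(1,2) _ B(5)])
    show "zlat l (D_base l) = \<Lambda>" using B(3) lat by simp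
    show "is_attachment (E_entry (l + 1)) (D_entry l) l e (E_labelling l e e')"
      by (rule D_attach_E) (use l4 assms in \<open>auto simp: e_def e'_def\<close>)
    show "?x \<in> short_weights l \<Lambda>"
      using x short_weights_DL[OF l2] lat assms by (cases P) auto
    show "?x \<bullet> D_base l ! i = (if i = e then -1 else 0)" if "i < l" for i
      using spin_weight_dot_D_base[OF l4 that] by (simp add: A_def e_def)
    show "y \<bullet> y = ?x \<bullet> ?x" if "y \<in> weight_class l \<Lambda> ?x" for y
      using that cls by (auto simp: spin_weights_def spin_weight_norm)
  qed (simp_all add: cartan_dynkin_entry)
  then show ?thesis unfolding cls .
qed

lemma components_of_type_subset: "components_of_type \<Delta> \<Gamma> \<subseteq> components \<Gamma>"
  by (auto simp: components_of_type_def)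

lemma linkage_rank_4:
  assumes "l = 4"
  shows "\<exists>C1 C2 C3. distinct [C1, C2, C3] \<and> components \<Gamma> = {C1, C2, C3} \<and>
       {C1, C2} \<subseteq> E_components \<Gamma> \<inter> D_components \<Gamma> \<and> C3 \<in> D_components \<Gamma> \<and>
       (\<Gamma> = dynkin_D 4 \<longrightarrow> C3 \<in> E_components \<Gamma>) \<and>
       card C1 = 8 \<and> card C2 = 8 \<and> card (C1 \<union> C2) = 16 \<and> card C3 = 8 \<and>
       (\<forall>u \<in> C1 \<union> C2 \<union> C3. dual_form \<Gamma> u = 1)"
proof -
  \<comment> \<open>In rank 5 the two diagrams are literally equal, so each of the three components
    has both types.\<close>
  have "dynkin_D 5 = dynkin_E 5" by (simp add: dynkin_D_def dynkin_E_def)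
  then have DE: "D_components \<Gamma> = E_components \<Gamma>"
    unfolding components_of_type_def rank assms by simp
  have fin: "finite (spin_component P)" for P
    by (rule card_ge_0_finite) (simp add: card_components_D)
  have "card (spin_component True \<union> spin_component False) = 16"
    using card_Un_disjoint[OF fin fin component_distinct(3)] card_components_D(2) assms by simp
  moreover have "components \<Gamma> = {spin_component True, spin_component False, vector_component}"
    using components_D assms by auto
  moreover have "distinct [spin_component True, spin_component False, vector_component]"
    using component_distinct(1)[symmetric] component_distinct(2) by simp
  moreover have "{spin_component True, spin_component False} \<subseteq> E_components \<Gamma> \<inter> D_components \<Gamma>"
    "vector_component \<in> D_components \<Gamma>" "vector_component \<in> E_components \<Gamma>"
    using vector_component_type spin_component_type assms DE by simp_all
  moreover have "card (spin_component P) = 8" "card vector_component = 8" for P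
    using card_components_D assms by simp_all
  moreover have "\<forall>u \<in> spin_component True \<union> spin_component False \<union> vector_component. dual_form \<Gamma> u = 1"
    using dual_form_D assms by (metis Un_iff numeral_eq_one_iff of_nat_numeral divide_self_if zero_neq_numeral)
  ultimately show ?thesis by blast
qed

lemma linkage_rank_5_7:
  assumes "l \<in> {5, 6, 7}"
  shows "card (components \<Gamma>) = 3 \<and> components \<Gamma> = E_components \<Gamma> \<union> D_components \<Gamma> \<and>
       card (E_components \<Gamma>) = 2 \<and> card (\<Union>(E_components \<Gamma>)) = 2 ^ l \<and>
       (\<forall>C \<in> E_components \<Gamma>. card C = 2 ^ (l - 1) \<and> (\<forall>u\<in>C. dual_form \<Gamma> u = l / 4)) \<and>
       card (D_components \<Gamma>) = 1 \<and>
       (\<forall>C \<in> D_components \<Gamma>. card C = 2 * l \<and> (\<forall>u\<in>C. dual_form \<Gamma> u = 1))"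
proof -
  have l8: "l < 8" using assms by auto
  have c: "components \<Gamma> = {vector_component, spin_component True, spin_component False}"
    using components_D l8 by simp
  have nE: "vector_component \<notin> E_components \<Gamma>" and nD: "spin_component P \<notin> D_components \<Gamma>" for P
    using vector_component_type spin_component_type[OF l8, of P] D_E_disjoint[OF assms] by blast+
  have E: "E_components \<Gamma> = {spin_component True, spin_component False}"
  proof
    show "E_components \<Gamma> \<subseteq> {spin_component True, spin_component False}"
    proof
      fix C assume C: "C \<in> E_components \<Gamma>"
      then have "C \<in> components \<Gamma>" using components_of_type_subset by blast
      moreover have "C \<noteq> vector_component" using C nE by metis
      ultimately show "C \<in> {spin_component True, spin_component False}" unfolding c by simp
    qed
  qed (use spin_component_type[OF l8] in simp)
  have D: "D_components \<Gamma> = {vector_component}"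
  proof
    show "D_components \<Gamma> \<subseteq> {vector_component}"
    proof
      fix C assume C: "C \<in> D_components \<Gamma>"
      then have "C \<in> components \<Gamma>" using components_of_type_subset by blast
      moreover have "C \<noteq> spin_component P" for P using C nD[of P] by metis
      ultimately show "C \<in> {vector_component}" unfolding c by simp
    qed
  qed (use vector_component_type in simp)
  have fin: "finite (spin_component P)" for P
    by (rule card_ge_0_finite) (simp add: card_components_D)
  have "2 ^ (l - 1) + 2 ^ (l - 1) = (2 :: nat) ^ l"
    using l4 by (metis One_nat_def mult_2 not_numeral_le_zero power_eq_if)
  then have "card (\<Union>(E_components \<Gamma>)) = 2 ^ l"
    unfolding E using card_Un_disjoint[OF fin fin component_distinct(3)] card_components_D(2) by simp
  moreover have "card (components \<Gamma>) = 3" "card (E_components \<Gamma>) = 2" "card (D_components \<Gamma>) = 1"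
    unfolding c E D using component_distinct by simp_all
  moreover have "components \<Gamma> = E_components \<Gamma> \<union> D_components \<Gamma>" unfolding c E D by blast
  moreover have "\<forall>C \<in> E_components \<Gamma>. card C = 2 ^ (l - 1) \<and> (\<forall>u\<in>C. dual_form \<Gamma> u = l / 4)"
    unfolding E using card_components_D(2) dual_form_D(2) by blast
  moreover have "\<forall>C \<in> D_components \<Gamma>. card C = 2 * l \<and> (\<forall>u\<in>C. dual_form \<Gamma> u = 1)"
    unfolding D using card_components_D(1) dual_form_D(1) by blast
  ultimately show ?thesis by blast
qed

lemma linkage_rank_ge_8:
  assumes "8 \<le> l"
  shows "card (components \<Gamma>) = 1 \<and> components \<Gamma> = D_components \<Gamma> \<and>
       (\<forall>C \<in> components \<Gamma>. card C = 2 * l \<and> (\<forall>u\<in>C. dual_form \<Gamma> u = 1))"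
proof -
  have c: "components \<Gamma> = {vector_component}" using components_D assms by simp
  then have "D_components \<Gamma> = {vector_component}"
    using components_of_type_subset[of dynkin_D] vector_component_type by blast
  moreover have "\<forall>C \<in> components \<Gamma>. card C = 2 * l \<and> (\<forall>u\<in>C. dual_form \<Gamma> u = 1)"
    unfolding c using card_components_D(1) dual_form_D(1) by blast
  ultimately show ?thesis using c by simp
qed

end

section \<open>The lattices \<open>E_6\<close> and \<open>E_7\<close>\<close>

text \<open>The lattice \<open>E_{l+1}\<close> is generated by \<open>D_l\<close> and a root whose projection is the spin weight
  \<open>(-1/2, \<dots>, -1/2)\<close>; \<open>h\<close> is the length of the orthogonal part, so that \<open>h\<^sup>2 = 2 - l / 4\<close>.\<close>

abbreviation "spin_min l \<equiv> spin_weight l {..<l}"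

definition EL :: "nat \<Rightarrow> real \<Rightarrow> real vec set" where
  "EL l h = {extend l (d + of_int k \<cdot>\<^sub>v spin_min l) (of_int k * h) | d k. d \<in> DL l l}"

definition E_gens :: "nat \<Rightarrow> real \<Rightarrow> real vec list" where
  "E_gens l h = map (\<lambda>v. extend l v 0) (D_base l) @ [extend l (spin_min l) h]"

text \<open>The generators renumbered to match the vertices of \<open>dynkin_E\<close>.\<close>

definition E_base :: "nat \<Rightarrow> real \<Rightarrow> real vec list" where
  "E_base l h = map (\<lambda>a. E_gens l h ! E_labelling l (l - 1) (l - 2) a) [0..<l + 1]"

lemma extend_add_smult:
  assumes "w \<in> carrier_vec l"
  shows "extend l v s + a \<cdot>\<^sub>v extend l w t = extend l (v + a \<cdot>\<^sub>v w) (s + a * t)"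
  using assms by (intro eq_vecI) (auto simp: extend_def)

lemma E_gens:
  assumes l: "4 \<le> l"
  shows "length (E_gens l h) = l + 1" "set (E_gens l h) \<subseteq> carrier_vec (l + 1)"
    "zlat (l + 1) (E_gens l h) = EL l h"
    "i < l \<Longrightarrow> E_gens l h ! i = extend l (D_base l ! i) 0" "E_gens l h ! l = extend l (spin_min l) h"
proof -
  note B = D_base[OF l]
  show len: "length (E_gens l h) = l + 1" using B by (simp add: E_gens_def)
  show car: "set (E_gens l h) \<subseteq> carrier_vec (l + 1)" by (auto simp: E_gens_def)
  show "i < l \<Longrightarrow> E_gens l h ! i = extend l (D_base l ! i) 0" "E_gens l h ! l = extend l (spin_min l) h"
    using B by (simp_all add: E_gens_def nth_append)
  have comb: "comb (l + 1) (E_gens l h) c = extend l (comb l (D_base l) c + c l \<cdot>\<^sub>v spin_min l) (c l * h)" for c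
  proof -
    have "comb (l + 1) (E_gens l h) c
        = extend l (comb l (D_base l) c) 0 + c l \<cdot>\<^sub>v extend l (spin_min l) h"
      unfolding E_gens_def using B comb_extend[OF B(2), of c]
      by (subst comb_append_singleton) auto
    then show ?thesis by (simp add: extend_add_smult)
  qed
  show "zlat (l + 1) (E_gens l h) = EL l h"
  proof
    show "zlat (l + 1) (E_gens l h) \<subseteq> EL l h"
      unfolding EL_def zlat_def[of "l + 1"] comb B(3)[symmetric] by (auto intro!: comb_in_zlat)
    show "EL l h \<subseteq> zlat (l + 1) (E_gens l h)"
    proof
      fix x assume "x \<in> EL l h"
      then obtain d k where d: "d \<in> DL l l" "x = extend l (d + of_int k \<cdot>\<^sub>v spin_min l) (of_int k * h)"
        by (auto simp: EL_def)
      obtain c :: "nat \<Rightarrow> int" where c: "d = comb l (D_base l) (\<lambda>i. of_int (c i))"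
        using d(1) unfolding B(3)[symmetric] by (auto simp: zlat_def)
      have "comb l (D_base l) (\<lambda>i. of_int ((c(l := k)) i)) = d"
        unfolding c by (rule comb_cong) (use B in auto)
      then have "x = comb (l + 1) (E_gens l h) (\<lambda>i. of_int ((c(l := k)) i))"
        unfolding comb d(2) by simp
      then show "x \<in> zlat (l + 1) (E_gens l h)" by (metis comb_in_zlat)
    qed
  qed
qed

lemma zlat_permute:
  assumes "set vs \<subseteq> carrier_vec n" "bij_betw f {..<length vs} {..<length vs}"
  shows "zlat n (map (\<lambda>a. vs ! f a) [0..<length vs]) = zlat n vs"
proof -
  let ?ws = "map (\<lambda>a. vs ! f a) [0..<length vs]"
  have "set ?ws = (!) vs ` (f ` {..<length vs})" by (simp add: image_image lessThan_atLeast0)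
  also have "f ` {..<length vs} = {..<length vs}" using assms(2) by (simp add: bij_betw_def)
  finally have set: "set ?ws = set vs" by (auto simp: set_conv_nth)
  show ?thesis
    using zlat_least[of ?ws n vs] zlat_least[of vs n ?ws] zlat_base[of vs n] zlat_base[of ?ws n] assms(1) set
    by (intro equalityI) metis+
qed

text \<open>The condition on h gives the last generator norm 2. Against the base of D_l its only
  nonzero label is -1 at a fork vertex, so \<open>D_attach_E\<close> identifies the diagram.\<close>

lemma E_base:
  fixes h :: real
  assumes l: "l \<in> {5, 6}" and h: "h * h = 2 - l / 4"
  shows "length (E_base l h) = l + 1" "set (E_base l h) \<subseteq> carrier_vec (l + 1)"
    "zlat (l + 1) (E_base l h) = EL l h"
    and E_base_nth: "a < l + 1 \<Longrightarrow> E_base l h ! a = E_gens l h ! E_labelling l (l - 1) (l - 2) a"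
    and "a < l + 1 \<Longrightarrow> b < l + 1 \<Longrightarrow> E_base l h ! a \<bullet> E_base l h ! b = of_int (E_entry (l + 1) a b)"
proof -
  have l4: "4 \<le> l" using l by auto
  note G = E_gens[OF l4, where h = h] note B = D_base[OF l4]
  let ?f = "E_labelling l (l - 1) (l - 2)"
  have att: "is_attachment (E_entry (l + 1)) (D_entry l) l (l - 1) ?f"
    by (rule D_attach_E) (use l in auto)
  then have f: "?f a < l + 1" if "a < l + 1" for a using that unfolding is_attachment_def by blast
  have bij: "bij_betw ?f {..<l + 1} {..<l + 1}"
    using att unfolding is_attachment_def by (intro bij_betw_of_inj) blast+
  show "length (E_base l h) = l + 1" by (simp add: E_base_def)
  show nth: "E_base l h ! a = E_gens l h ! ?f a" if "a < l + 1" for a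
    using that by (simp add: E_base_def del: upt_Suc)
  show "zlat (l + 1) (E_base l h) = EL l h"
    using zlat_permute[OF G(2), of ?f] bij G(1,3) by (simp add: E_base_def del: upt_Suc)
  show "set (E_base l h) \<subseteq> carrier_vec (l + 1)"
  proof
    fix v assume "v \<in> set (E_base l h)"
    then obtain a where "a < l + 1" "v = E_gens l h ! ?f a" by (auto simp: E_base_def simp del: upt_Suc)
    then show "v \<in> carrier_vec (l + 1)" using nth_carrier[OF G(2)] G(1) f by simp
  qed
  have bc: "D_base l ! i \<in> carrier_vec l" if "i < l" for i using nth_carrier[OF B(2)] B(1) that by simp
  have g: "E_gens l h ! i \<bullet> E_gens l h ! j = of_int (attach (D_entry l) l (l - 1) i j)" if "i < l + 1" "j < l + 1" for i j
  proof -
    have s: "spin_min l \<bullet> D_base l ! i = (if i = l - 1 then -1 else 0)" if "i < l" for i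
      using spin_weight_dot_D_base[OF l4 that] by simp
    have s': "D_base l ! i \<bullet> spin_min l = (if i = l - 1 then -1 else 0)" if "i < l" for i
      using s[OF that] comm_scalar_prod[OF bc[OF that], of "spin_min l"] by simp
    show ?thesis
    proof (cases "i < l"; cases "j < l")
      assume ij: "i < l" "j < l"
      then show ?thesis using G(4) extend_dot[OF bc] B(5) by (simp add: attach_def)
    next
      assume ij: "i < l" "\<not> j < l"
      then have "j = l" using \<open>j < l + 1\<close> by simp
      then show ?thesis using ij G(4,5) extend_dot[OF spin_weight_carrier(1)] s' by (simp add: attach_def)
    next
      assume ij: "\<not> i < l" "j < l"
      then have "i = l" using \<open>i < l + 1\<close> by simp
      then show ?thesis using ij G(4,5) extend_dot[OF bc] s by (simp add: attach_def)
    next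
      assume ij: "\<not> i < l" "\<not> j < l"
      then have "i = l" "j = l" using that by simp_all
      then show ?thesis using G(5) extend_dot[OF spin_weight_carrier(1)] h spin_weight_norm[of l "{..<l}"]
        by (simp add: attach_def)
    qed
  qed
  show "E_base l h ! a \<bullet> E_base l h ! b = of_int (E_entry (l + 1) a b)" if "a < l + 1" "b < l + 1" for a b
    using that nth g[OF f f] att unfolding is_attachment_def by simp
qed

lemma EL_nondeg:
  assumes "4 \<le> l" "h \<noteq> 0" "set vs \<subseteq> carrier_vec (l + 1)" "zlat (l + 1) vs = EL l h"
  shows "nondeg (l + 1) vs"
proof (rule zlat_nondeg[OF assms(3)])
  fix k assume k: "k < l + 1"
  show "\<exists>d. d \<noteq> 0 \<and> d \<cdot>\<^sub>v unit_vec (l + 1) k \<in> zlat (l + 1) vs"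
  proof (cases "k < l")
    case True
    have "2 \<cdot>\<^sub>v unit_vec (l + 1) k = extend l (root l k 1 k 1 + of_int 0 \<cdot>\<^sub>v spin_min l) (of_int 0 * h)"
      using True by (intro eq_vecI) (auto simp: extend_def)
    then have "2 \<cdot>\<^sub>v unit_vec (l + 1) k \<in> EL l h"
      using root_in_DL[of k l k l 1 1] True unfolding EL_def by blast
    then show ?thesis using assms(4) by (intro exI[of _ 2]) auto
  next
    case False
    then have "k = l" using k by simp
    \<comment> \<open>Four times the spin weight is (-2, ..., -2); adding this vector of D_l leaves
      only the last coordinate 4h.\<close>
    let ?d = "vec l (\<lambda>_. 2) :: real vec"
    have "?d \<in> DL l l"
      by (rule DLI[of _ _ _ "\<lambda>_. 2"]) auto
    moreover have "(4 * h) \<cdot>\<^sub>v unit_vec (l + 1) k = extend l (?d + of_int 4 \<cdot>\<^sub>v spin_min l) (of_int 4 * h)"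
      using \<open>k = l\<close> by (intro eq_vecI) (auto simp: extend_def spin_weight_nth)
    ultimately have "(4 * h) \<cdot>\<^sub>v unit_vec (l + 1) k \<in> EL l h" unfolding EL_def by blast
    then show ?thesis using assms(2,4) by (intro exI[of _ "4 * h"]) auto
  qed
qed

text \<open>Compared with D_l there is one more generator, hence one more integrality
  condition.\<close>

lemma EL_dual_iff:
  assumes y: "y \<in> carrier_vec l"
  shows "(\<forall>w\<in>EL l h. extend l y t \<bullet> w \<in> \<int>) \<longleftrightarrow> (\<forall>d\<in>DL l l. y \<bullet> d \<in> \<int>) \<and> y \<bullet> spin_min l + t * h \<in> \<int>"
proof -
  have dot: "extend l y t \<bullet> extend l (d + of_int k \<cdot>\<^sub>v spin_min l) (of_int k * h)
      = y \<bullet> d + of_int k * (y \<bullet> spin_min l + t * h)" if "d \<in> DL l l" for d k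
  proof -
    have d: "d \<in> carrier_vec l" using that DL_carrier by blast
    have "extend l y t \<bullet> extend l (d + of_int k \<cdot>\<^sub>v spin_min l) (of_int k * h)
      = y \<bullet> (d + of_int k \<cdot>\<^sub>v spin_min l) + t * (of_int k * h)"
      using d by (intro extend_dot) auto
    also have "y \<bullet> (d + of_int k \<cdot>\<^sub>v spin_min l) = y \<bullet> d + of_int k * (y \<bullet> spin_min l)"
      using y d by (simp add: scalar_prod_add_distrib[of _ l])
    finally show ?thesis by (simp add: algebra_simps)
  qed
  show ?thesis
  proof (intro iffI conjI ballI)
    assume r: "(\<forall>d\<in>DL l l. y \<bullet> d \<in> \<int>) \<and> y \<bullet> spin_min l + t * h \<in> \<int>"
    fix w assume "w \<in> EL l h"
    then obtain d k where "d \<in> DL l l" "w = extend l (d + of_int k \<cdot>\<^sub>v spin_min l) (of_int k * h)"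
      by (auto simp: EL_def)
    then show "extend l y t \<bullet> w \<in> \<int>" using dot r by auto
  next
    assume r: "\<forall>w\<in>EL l h. extend l y t \<bullet> w \<in> \<int>"
    have mem: "extend l (d + of_int k \<cdot>\<^sub>v spin_min l) (of_int k * h) \<in> EL l h" if "d \<in> DL l l" for d k
      using that by (auto simp: EL_def)
    show "y \<bullet> d \<in> \<int>" if "d \<in> DL l l" for d
      using bspec[OF r mem[OF that, of 0]] dot[OF that, of 0] by simp
    show "y \<bullet> spin_min l + t * h \<in> \<int>"
      using bspec[OF r mem[OF zero_in_DL[OF le_refl], of 1]] dot[OF zero_in_DL[OF le_refl], of 1] y by simp
  qed
qed

lemma spin_weight_dot_spin_min:
  assumes "A \<subseteq> {..<l}"
  shows "spin_weight l A \<bullet> spin_min l = card A / 2 - l / 4"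
proof -
  have "spin_weight l A \<bullet> spin_min l = (\<Sum>i<l. - (1/2) * spin_weight l A $ i)"
    unfolding scalar_prod_def lessThan_atLeast0 by (intro sum.cong) (auto simp: spin_weight_nth)
  also have "\<dots> = - (1/2) * (\<Sum>i<l. spin_weight l A $ i)" by (simp only: sum_distrib_left)
  also have "\<dots> = card A / 2 - l / 4" unfolding sum_spin_weight[OF assms] by (simp add: field_simps)
  finally show ?thesis .
qed

lemma vector_weight_dot_spin_min:
  assumes "y \<in> vector_weights l"
  obtains s :: int where "s = 1 \<or> s = -1" "y \<bullet> spin_min l = - of_int s / 2"
proof -
  obtain k and s :: int where k: "k < l" "s = 1 \<or> s = -1" "y \<in> carrier_vec l"
    "\<And>i. i < l \<Longrightarrow> y $ i = of_int (if i = k then s else 0)" by (rule vector_weightE[OF assms]) blast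
  have "y \<bullet> spin_min l = (\<Sum>i<l. if i = k then - of_int s / 2 else 0)"
    unfolding scalar_prod_def lessThan_atLeast0 using k by (intro sum.cong) (auto simp: spin_weight_nth)
  also have "\<dots> = - of_int s / 2" using k by simp
  finally show thesis using that k by blast
qed

lemma extend_eq_iff:
  assumes "v \<in> carrier_vec l" "w \<in> carrier_vec l"
  shows "extend l v s = extend l w t \<longleftrightarrow> v = w \<and> s = t"
proof
  assume e: "extend l v s = extend l w t"
  have "v $ i = w $ i" if "i < l" for i
    using arg_cong[OF e, of "\<lambda>x. x $ i"] that by (simp add: extend_nth)
  moreover have "s = t" using arg_cong[OF e, of "\<lambda>x. x $ l"] by (simp add: extend_nth)
  ultimately show "v = w \<and> s = t" using assms by auto
qed simp

lemma extend_zero: "extend l (0\<^sub>v l) 0 = 0\<^sub>v (l + 1)"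
  by (intro eq_vecI) (auto simp: extend_def)

section \<open>Short weights of E_6 and E_7\<close>

text \<open>The first l coordinates form a dual vector of D_l of norm below 2, hence zero, a vector
  weight or a spin weight. The remaining norm 2, 1 or 2 - l / 4 bounds the last coordinate.\<close>

lemma short_weights_EL:
  assumes l: "2 \<le> l" "l < 8" and y: "y \<in> carrier_vec l"
  shows "extend l y t \<in> short_weights (l + 1) (EL l h) \<longleftrightarrow> y \<bullet> spin_min l + t * h \<in> \<int> \<and>
    (y = 0\<^sub>v l \<and> t \<noteq> 0 \<and> t * t < 2 \<or> y \<in> vector_weights l \<and> t * t < 1 \<or>
     (\<exists>P. y \<in> spin_weights l P \<and> t * t < 2 - l / 4))" (is "?L \<longleftrightarrow> ?R")
proof -
  have L: "?L \<longleftrightarrow> y \<bullet> spin_min l + t * h \<in> \<int> \<and> (\<forall>d\<in>DL l l. y \<bullet> d \<in> \<int>) \<and>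
      (y \<noteq> 0\<^sub>v l \<or> t \<noteq> 0) \<and> y \<bullet> y + t * t < 2"
    unfolding short_weights_def
    using EL_dual_iff[OF y, of h t] extend_dot[OF y] extend_eq_iff[OF y zero_carrier_vec, of t 0] extend_zero[of l]
    by auto
  have sw: "short_weights l (DL l l) = vector_weights l \<union> (spin_weights l True \<union> spin_weights l False)"
    using short_weights_DL[OF l(1)] l(2) by simp
  have spin: "y \<in> spin_weights l P \<Longrightarrow> y \<bullet> y = l / 4" for P
    by (auto simp: spin_weights_def spin_weight_norm)
  have dual: "\<forall>d\<in>DL l l. y \<bullet> d \<in> \<int>" "y \<noteq> 0\<^sub>v l" if "y \<in> vector_weights l \<or> (\<exists>P. y \<in> spin_weights l P)"
  proof -
    have "y \<in> short_weights l (DL l l)" unfolding sw using that by (metis (full_types) UnCI)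
    then show "\<forall>d\<in>DL l l. y \<bullet> d \<in> \<int>" "y \<noteq> 0\<^sub>v l" by (auto simp: short_weights_def)
  qed
  show ?thesis
  proof
    assume ?L
    then have *: "y \<bullet> spin_min l + t * h \<in> \<int>" "\<forall>d\<in>DL l l. y \<bullet> d \<in> \<int>" "y \<noteq> 0\<^sub>v l \<or> t \<noteq> 0"
      "y \<bullet> y + t * t < 2" using L by auto
    show ?R
    proof (cases "y = 0\<^sub>v l")
      case True
      then show ?thesis using * by auto
    next
      case False
      have "0 \<le> t * t" by simp
      then have "y \<bullet> y < 2" using *(4) by linarith
      then have "y \<in> short_weights l (DL l l)" using False * y by (simp add: short_weights_def)
      then have "y \<in> vector_weights l \<or> (\<exists>P. y \<in> spin_weights l P)" unfolding sw by blast
      then show ?thesis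
      proof
        assume "y \<in> vector_weights l"
        then show ?thesis using * vector_weight_norm[of y l] by simp
      next
        assume "\<exists>P. y \<in> spin_weights l P"
        then show ?thesis using * spin by force
      qed
    qed
  next
    assume ?R
    then have int: "y \<bullet> spin_min l + t * h \<in> \<int>"
      and "y = 0\<^sub>v l \<and> t \<noteq> 0 \<and> t * t < 2 \<or> y \<in> vector_weights l \<and> t * t < 1 \<or>
     (\<exists>P. y \<in> spin_weights l P \<and> t * t < 2 - l / 4)" by auto
    then consider "y = 0\<^sub>v l" "t \<noteq> 0" "t * t < 2" | "y \<in> vector_weights l" "t * t < 1"
      | P where "y \<in> spin_weights l P" "t * t < 2 - l / 4" by blast
    then show ?L
    proof cases
      case 1
      then have "\<forall>d\<in>DL l l. y \<bullet> d \<in> \<int>" using DL_carrier[of l l] by auto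
      then show ?thesis using L 1 int by simp
    next
      case 2
      then show ?thesis using L int dual vector_weight_norm[of y l] by simp
    next
      case 3
      then show ?thesis using L int dual spin[of P] by auto
    qed
  qed
qed

lemma half_odd_small:
  assumes s: "s = 1 \<or> s = (-1 :: int)" and int: "- of_int s / 2 + c \<in> \<int>" and c: "c * c < (1 :: real)"
  shows "c = 1 / 2 \<or> c = -1 / 2"
proof -
  obtain m where m: "- of_int s / 2 + c = of_int m" using int by (auto elim: Ints_cases)
  then have c2: "2 * c = of_int (2 * m + s)" by simp
  have "(2 * c) * (2 * c) < 4" using c by simp
  then have "real_of_int ((2 * m + s) * (2 * m + s)) < 4" unfolding c2 by simp
  then have "(2 * m + s) * (2 * m + s) < 2 * 2" by linarith
  then have "- 2 < 2 * m + s \<and> 2 * m + s < 2" by (rule int_square_less) simp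
  then have "2 * m + s = 1 \<or> 2 * m + s = -1" using s by presburger
  then show ?thesis using c2 by auto
qed

text \<open>Restricted to D_5 the 27 weights of a minuscule representation of E_6 split as 1 + 10 +
  16. The last coordinates bring all of them to norm 4/3 when h^2 = 3/4; P distinguishes the
  representation from its dual.\<close>

definition E6_class :: "real \<Rightarrow> bool \<Rightarrow> real vec set" where
  "E6_class h P = (let \<sigma> = if P then 1 else -1 in {extend 5 (0\<^sub>v 5) (\<sigma> / h)} \<union>
     (\<lambda>y. extend 5 y (- \<sigma> / (2 * h))) ` vector_weights 5 \<union> (\<lambda>y. extend 5 y (\<sigma> / (4 * h))) ` spin_weights 5 P)"

text \<open>The 56 weights of the minuscule representation of E_7, restricted to D_6: 12 + 12 +
  32.\<close>

definition E7_class :: "real \<Rightarrow> real vec set" where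
  "E7_class h = (\<lambda>y. extend 6 y (1 / (2 * h))) ` vector_weights 6 \<union>
     (\<lambda>y. extend 6 y (- 1 / (2 * h))) ` vector_weights 6 \<union> (\<lambda>y. extend 6 y 0) ` spin_weights 6 False"

text \<open>Here c stands for t * h, where t is the last coordinate; the bound 9/16 is (2 - 5/4) *
  3/4.\<close>

lemma spin_weight_dot_5:
  assumes "y \<in> spin_weights 5 P"
  shows "y \<bullet> spin_min 5 + c \<in> \<int> \<and> c * c < 9 / 16 \<longleftrightarrow> c = (if P then 1 / 4 else -1 / 4 :: real)"
proof -
  obtain A where A: "A \<subseteq> {..<5}" "even (card A) = P" "y = spin_weight 5 A"
    using assms by (auto simp: spin_weights_def)
  have d: "y \<bullet> spin_min 5 = card A / 2 - 5 / 4" using spin_weight_dot_spin_min[OF A(1)] A by simp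
  show ?thesis
  proof
    assume a: "y \<bullet> spin_min 5 + c \<in> \<int> \<and> c * c < 9 / 16"
    then obtain m where m: "y \<bullet> spin_min 5 + c = of_int m" by (auto elim: Ints_cases)
    \<comment> \<open>This is 4c. Modulo 4 it is 1 or 3 according to the parity of A, and its
      absolute value is below 3, which leaves 1 or -1.\<close>
    let ?n = "4 * m - 2 * int (card A) + 5"
    have c4: "4 * c = of_int ?n" using m d by simp
    have "(4 * c) * (4 * c) < 9" using a by simp
    then have "real_of_int (?n * ?n) < 9" unfolding c4 by simp
    then have "?n * ?n < 3 * 3" by linarith
    then have n: "- 3 < ?n \<and> ?n < 3" by (rule int_square_less) simp
    have "?n = (if P then 1 else -1)"
    proof (cases P)
      case True
      then obtain k where "card A = 2 * k" using A(2) by (auto elim: evenE)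
      then show ?thesis using n True by simp presburger
    next
      case False
      then obtain k where "card A = 2 * k + 1" using A(2) by (auto elim: oddE)
      then show ?thesis using n False by simp presburger
    qed
    then show "c = (if P then 1 / 4 else -1 / 4)" using c4 by (auto split: if_splits)
  next
    assume c: "c = (if P then 1 / 4 else -1 / 4)"
    have "y \<bullet> spin_min 5 + c \<in> \<int>"
    proof (cases P)
      case True
      then obtain k where "card A = 2 * k" using A(2) by (auto elim: evenE)
      then have "y \<bullet> spin_min 5 + c = of_int (int k - 1)" using c True d by simp
      then show ?thesis by (metis Ints_of_int)
    next
      case False
      then obtain k where "card A = 2 * k + 1" using A(2) by (auto elim: oddE)
      then have "y \<bullet> spin_min 5 + c = of_int (int k - 1)" using c False d by (simp add: field_simps)
      then show ?thesis by (metis Ints_of_int)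
    qed
    then show "y \<bullet> spin_min 5 + c \<in> \<int> \<and> c * c < 9 / 16" using c by simp
  qed
qed

text \<open>Again c = t * h, with bound (2 - 6/4) * 1/2. Then 2c is an integer of absolute value
  below 1, so c = 0, and integrality selects the odd sets.\<close>

lemma spin_weight_dot_6:
  assumes "y \<in> spin_weights 6 P"
  shows "y \<bullet> spin_min 6 + c \<in> \<int> \<and> c * c < 1 / 4 \<longleftrightarrow> \<not> P \<and> c = (0 :: real)"
proof -
  obtain A where A: "A \<subseteq> {..<6}" "even (card A) = P" "y = spin_weight 6 A"
    using assms by (auto simp: spin_weights_def)
  have d: "y \<bullet> spin_min 6 = card A / 2 - 3 / 2" using spin_weight_dot_spin_min[OF A(1)] A by simp
  show ?thesis
  proof
    assume a: "y \<bullet> spin_min 6 + c \<in> \<int> \<and> c * c < 1 / 4"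
    then obtain m where m: "y \<bullet> spin_min 6 + c = of_int m" by (auto elim: Ints_cases)
    let ?n = "2 * m - int (card A) + 3"
    have c2: "2 * c = of_int ?n" using m d by (simp add: field_simps)
    have "(2 * c) * (2 * c) < 1" using a by simp
    then have "real_of_int (?n * ?n) < 1" unfolding c2 by simp
    then have "?n * ?n < 1 * 1" by linarith
    then have "- 1 < ?n \<and> ?n < 1" by (rule int_square_less) simp
    then have n: "?n = 0" by simp
    then have "odd (card A)" by presburger
    then show "\<not> P \<and> c = 0" using A(2) c2 n by simp
  next
    assume c: "\<not> P \<and> c = 0"
    then obtain k where "card A = 2 * k + 1" using A(2) by (auto elim: oddE)
    then have "y \<bullet> spin_min 6 + c = of_int (int k - 1)" using c d by (simp add: field_simps)
    then have "y \<bullet> spin_min 6 + c \<in> \<int>" by (metis Ints_of_int)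
    then show "y \<bullet> spin_min 6 + c \<in> \<int> \<and> c * c < 1 / 4" using c by simp
  qed
qed

text \<open>The bound k is kept general to serve both lattices, with k = 3/4 for E_6 and k = 1/2 for
  E_7. The product with the spin weight is \<plusminus>1/2, so c is half an odd integer.\<close>

lemma vector_weight_dot:
  assumes "y \<in> vector_weights l" "k \<le> 1" "1 / 4 < k"
  shows "y \<bullet> spin_min l + c \<in> \<int> \<and> c * c < k \<longleftrightarrow> c = 1 / 2 \<or> c = - 1 / 2"
proof -
  obtain s :: int where s: "s = 1 \<or> s = -1" "y \<bullet> spin_min l = - of_int s / 2"
    using vector_weight_dot_spin_min[OF assms(1)] by blast
  show ?thesis
  proof
    assume "y \<bullet> spin_min l + c \<in> \<int> \<and> c * c < k"
    then show "c = 1 / 2 \<or> c = - 1 / 2" using half_odd_small[OF s(1), of c] s(2) assms(2) by auto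
  next
    assume c: "c = 1 / 2 \<or> c = - 1 / 2"
    then have "y \<bullet> spin_min l + c \<in> {0, 1, -1}" using s by auto
    moreover have "c * c = 1 / 4" using c by (elim disjE; hypsubst; simp)
    ultimately show "y \<bullet> spin_min l + c \<in> \<int> \<and> c * c < k" using assms(3) by auto
  qed
qed

lemma zero_weight_dot:
  "(0\<^sub>v l) \<bullet> spin_min l + c \<in> \<int> \<and> c \<noteq> 0 \<and> c * c < 3 / 2 \<longleftrightarrow> c = 1 \<or> c = (- 1 :: real)"
proof
  assume a: "(0\<^sub>v l) \<bullet> spin_min l + c \<in> \<int> \<and> c \<noteq> 0 \<and> c * c < 3 / 2"
  then obtain m where m: "c = of_int m" by (auto elim: Ints_cases)
  have "real_of_int (m * m) < 3 / 2" using a m by simp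
  then have "m * m < 2 * 2" by linarith
  then have "- 2 < m \<and> m < 2" by (rule int_square_less) simp
  then have "m = 1 \<or> m = -1" using a m by auto
  then show "c = 1 \<or> c = - 1" using m by auto
qed auto

lemma extend_in_image:
  assumes "y \<in> carrier_vec l" "X \<subseteq> carrier_vec l"
  shows "extend l y t \<in> (\<lambda>y. extend l y a) ` X \<longleftrightarrow> y \<in> X \<and> t = a"
  using assms extend_eq_iff[OF assms(1)] by blast

lemma extend_in_E6_class:
  assumes y: "y \<in> carrier_vec 5"
  shows "extend 5 y t \<in> E6_class h P \<longleftrightarrow> (y = 0\<^sub>v 5 \<and> t = (if P then 1 else -1) / h \<or>
    y \<in> vector_weights 5 \<and> t = - (if P then 1 else -1) / (2 * h) \<or>
    y \<in> spin_weights 5 P \<and> t = (if P then 1 else -1) / (4 * h))"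
  unfolding E6_class_def Let_def
  using extend_in_image[OF y weights_carrier(1)] extend_in_image[OF y weights_carrier(2)]
    extend_eq_iff[OF y zero_carrier_vec] by simp

lemma extend_in_E7_class:
  assumes y: "y \<in> carrier_vec 6"
  shows "extend 6 y t \<in> E7_class h \<longleftrightarrow>
    (y \<in> vector_weights 6 \<and> (t = 1 / (2 * h) \<or> t = - 1 / (2 * h)) \<or> y \<in> spin_weights 6 False \<and> t = 0)"
  unfolding E7_class_def
  using extend_in_image[OF y weights_carrier(1)] extend_in_image[OF y weights_carrier(2)] by auto

lemma E_class_carrier: "E6_class h P \<subseteq> carrier_vec 6" "E7_class h \<subseteq> carrier_vec 7"
proof -
  have e: "extend 5 y t \<in> carrier_vec 6" "extend 6 y t \<in> carrier_vec 7" for y t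
    using extend_carrier(1)[of 5 y t] extend_carrier(1)[of 6 y t] by (simp_all add: eval_nat_numeral)
  show "E6_class h P \<subseteq> carrier_vec 6" "E7_class h \<subseteq> carrier_vec 7"
    using e by (auto simp: E6_class_def E7_class_def Let_def)
qed

lemma short_weights_E6:
  assumes h: "0 < h" "h * h = 3 / 4"
  shows "short_weights 6 (EL 5 h) = E6_class h True \<union> E6_class h False"
proof -
  \<comment> \<open>Rescales the bound on t to one on c = t * h, the quantity in the integrality
    conditions.\<close>
  have sc: "t * t < k \<longleftrightarrow> (t * h) * (t * h) < k * (3 / 4)" for t k :: real
  proof -
    have "(t * h) * (t * h) = (t * t) * (3 / 4)" using h(2) by (metis mult.assoc mult.commute)
    then show ?thesis by (intro iffI; linarith)
  qed
  have eqs: "t * h = a \<longleftrightarrow> t = a / h" for t a using h(1) by (auto simp: field_simps)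
  have *: "extend 5 y t \<in> short_weights 6 (EL 5 h) \<longleftrightarrow> extend 5 y t \<in> E6_class h True \<union> E6_class h False"
    if y: "y \<in> carrier_vec 5" for y t
  proof -
    have z: "y \<bullet> spin_min 5 + t * h \<in> \<int> \<and> t \<noteq> 0 \<and> t * t < 2 \<longleftrightarrow> t = 1 / h \<or> t = - 1 / h"
      if "y = 0\<^sub>v 5"
      using zero_weight_dot[of 5 "t * h"] h(1) unfolding sc[of t 2] that eqs by simp
    have v: "y \<bullet> spin_min 5 + t * h \<in> \<int> \<and> t * t < 1 \<longleftrightarrow> t = 1 / (2 * h) \<or> t = - 1 / (2 * h)"
      if "y \<in> vector_weights 5"
      using vector_weight_dot[OF that, of "3 / 4" "t * h"] unfolding sc[of t 1] eqs by simp
    have s: "y \<bullet> spin_min 5 + t * h \<in> \<int> \<and> t * t < 2 - real 5 / 4 \<longleftrightarrow> t = (if P then 1 else - 1) / (4 * h)"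
      if "y \<in> spin_weights 5 P" for P
      using spin_weight_dot_5[OF that, of "t * h"] unfolding sc[of t "2 - real 5 / 4"] eqs by (cases P) simp_all
    have "extend 5 y t \<in> short_weights 6 (EL 5 h) \<longleftrightarrow>
      y = 0\<^sub>v 5 \<and> (y \<bullet> spin_min 5 + t * h \<in> \<int> \<and> t \<noteq> 0 \<and> t * t < 2) \<or>
      y \<in> vector_weights 5 \<and> (y \<bullet> spin_min 5 + t * h \<in> \<int> \<and> t * t < 1) \<or>
      (\<exists>P. y \<in> spin_weights 5 P \<and> (y \<bullet> spin_min 5 + t * h \<in> \<int> \<and> t * t < 2 - real 5 / 4))"
      using short_weights_EL[OF _ _ y, of t h] by auto
    also have "\<dots> \<longleftrightarrow> y = 0\<^sub>v 5 \<and> (t = 1 / h \<or> t = - 1 / h) \<or>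
      y \<in> vector_weights 5 \<and> (t = 1 / (2 * h) \<or> t = - 1 / (2 * h)) \<or>
      (\<exists>P. y \<in> spin_weights 5 P \<and> t = (if P then 1 else - 1) / (4 * h))"
      using z v s by blast
    also have "\<dots> \<longleftrightarrow> extend 5 y t \<in> E6_class h True \<union> E6_class h False"
      unfolding Un_iff extend_in_E6_class[OF y] by (auto simp: ex_bool_eq)
    finally show ?thesis .
  qed
  have e6: "(5::nat) + 1 = 6" by simp
  show ?thesis
  proof (rule Set.set_eqI)
    fix x
    show "x \<in> short_weights 6 (EL 5 h) \<longleftrightarrow> x \<in> E6_class h True \<union> E6_class h False"
    proof (cases "x \<in> carrier_vec (5 + 1)")
      case True
      then show ?thesis using * extend_cases by metis
    next
      case False
      then show ?thesis unfolding e6 using E_class_carrier(1)[of h] by (auto simp: short_weights_def)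
    qed
  qed
qed

lemma short_weights_E7:
  assumes h: "0 < h" "h * h = 1 / 2"
  shows "short_weights 7 (EL 6 h) = E7_class h"
proof -
  have sc: "t * t < k \<longleftrightarrow> (t * h) * (t * h) < k * (1 / 2)" for t k :: real
  proof -
    have "(t * h) * (t * h) = (t * t) * (1 / 2)" using h(2) by (metis mult.assoc mult.commute)
    then show ?thesis by (intro iffI; linarith)
  qed
  have eqs: "t * h = a \<longleftrightarrow> t = a / h" for t a using h(1) by (auto simp: field_simps)
  have *: "extend 6 y t \<in> short_weights 7 (EL 6 h) \<longleftrightarrow> extend 6 y t \<in> E7_class h"
    if y: "y \<in> carrier_vec 6" for y t
  proof -
    \<comment> \<open>For y = 0 the product t * h would be a nonzero integer with square below 1, so
      E_7 has no analogue of the single weight in the E_6 classes.\<close>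
    have z: False if a: "y = 0\<^sub>v 6" "y \<bullet> spin_min 6 + t * h \<in> \<int>" "t \<noteq> 0" "t * t < 2"
    proof -
      have c: "(t * h) * (t * h) < 1" using a(4) unfolding sc[of t 2] by simp
      then have "t * h = 1 \<or> t * h = -1" using zero_weight_dot[of 6 "t * h"] a h(1) by simp
      then show False using c by auto
    qed
    have v: "y \<bullet> spin_min 6 + t * h \<in> \<int> \<and> t * t < 1 \<longleftrightarrow> t = 1 / (2 * h) \<or> t = - 1 / (2 * h)"
      if "y \<in> vector_weights 6"
      using vector_weight_dot[OF that, of "1 / 2" "t * h"] unfolding sc[of t 1] eqs by simp
    have s: "y \<bullet> spin_min 6 + t * h \<in> \<int> \<and> t * t < 2 - real 6 / 4 \<longleftrightarrow> \<not> P \<and> t = 0"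
      if "y \<in> spin_weights 6 P" for P
      using spin_weight_dot_6[OF that, of "t * h"] h(1) unfolding sc[of t "2 - real 6 / 4"] by simp
    have "extend 6 y t \<in> short_weights 7 (EL 6 h) \<longleftrightarrow>
      y \<in> vector_weights 6 \<and> (y \<bullet> spin_min 6 + t * h \<in> \<int> \<and> t * t < 1) \<or>
      (\<exists>P. y \<in> spin_weights 6 P \<and> (y \<bullet> spin_min 6 + t * h \<in> \<int> \<and> t * t < 2 - real 6 / 4))"
      using short_weights_EL[OF _ _ y, of t h] z by auto
    also have "\<dots> \<longleftrightarrow> y \<in> vector_weights 6 \<and> (t = 1 / (2 * h) \<or> t = - 1 / (2 * h)) \<or>
      (\<exists>P. y \<in> spin_weights 6 P \<and> \<not> P \<and> t = 0)"
      using v s by blast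
    also have "\<dots> \<longleftrightarrow> extend 6 y t \<in> E7_class h"
      unfolding extend_in_E7_class[OF y] by (auto simp: ex_bool_eq)
    finally show ?thesis .
  qed
  have e7: "(6::nat) + 1 = 7" by simp
  show ?thesis
  proof (rule Set.set_eqI)
    fix x
    show "x \<in> short_weights 7 (EL 6 h) \<longleftrightarrow> x \<in> E7_class h"
    proof (cases "x \<in> carrier_vec (6 + 1)")
      case True
      then show ?thesis using * extend_cases by metis
    next
      case False
      then show ?thesis unfolding e7 using E_class_carrier(2)[of h] by (auto simp: short_weights_def)
    qed
  qed
qed

section \<open>Cosets of E_6 and E_7, their sizes and norms\<close>

lemma extend_diff:
  assumes "v \<in> carrier_vec l" "w \<in> carrier_vec l"
  shows "extend l v s - extend l w t = extend l (v - w) (s - t)"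
  using assms by (intro eq_vecI) (auto simp: extend_def)

lemma EL_memI:
  assumes "y \<in> carrier_vec l" "t = of_int k * h" "y - of_int k \<cdot>\<^sub>v spin_min l \<in> DL l l"
  shows "extend l y t \<in> EL l h"
proof -
  have "(y - of_int k \<cdot>\<^sub>v spin_min l) + of_int k \<cdot>\<^sub>v spin_min l = y"
    using assms(1) by (intro eq_vecI) auto
  then show ?thesis using assms(2,3) unfolding EL_def by (intro CollectI exI[of _ "y - of_int k \<cdot>\<^sub>v spin_min l"] exI[of _ k]) simp
qed

lemma EL_last: "extend l y t \<in> EL l h \<Longrightarrow> \<exists>k::int. t = of_int k * h"
  unfolding EL_def by (auto dest!: arg_cong[where f = "\<lambda>x. x $ l"] simp: extend_nth)

lemma EL_diff: "4 \<le> l \<Longrightarrow> x \<in> EL l h \<Longrightarrow> y \<in> EL l h \<Longrightarrow> x - y \<in> EL l h"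
  using zlat_diff E_gens(3) by metis

lemma E6_class_cases:
  assumes "x \<in> E6_class h P"
  obtains y t where "y \<in> carrier_vec 5" "x = extend 5 y t"
    "y = 0\<^sub>v 5 \<and> t = (if P then 1 else -1) / h \<or>
    y \<in> vector_weights 5 \<and> t = - (if P then 1 else -1) / (2 * h) \<or>
    y \<in> spin_weights 5 P \<and> t = (if P then 1 else -1) / (4 * h)"
proof -
  have "x \<in> carrier_vec (5 + 1)" using E_class_carrier(1)[of h P] assms by auto
  then obtain y t where "y \<in> carrier_vec 5" "x = extend 5 y t" by (rule extend_cases) blast
  then show thesis using that assms extend_in_E6_class by blast
qed

lemma E7_class_cases:
  assumes "x \<in> E7_class h"
  obtains y t where "y \<in> carrier_vec 6" "x = extend 6 y t"
    "y \<in> vector_weights 6 \<and> (t = 1 / (2 * h) \<or> t = - 1 / (2 * h)) \<or> y \<in> spin_weights 6 False \<and> t = 0"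
proof -
  have "x \<in> carrier_vec (6 + 1)" using E_class_carrier(2)[of h] assms by auto
  then obtain y t where "y \<in> carrier_vec 6" "x = extend 6 y t" by (rule extend_cases) blast
  then show thesis using that assms extend_in_E7_class by blast
qed

text \<open>All weights of a class are compared with one representative, whose first five
  coordinates equal \<sigma> / 2. The three kinds of weights differ from it by the multiples
  \<sigma>, -\<sigma> and 0 of the extra generator, up to D_5.\<close>

lemma E6_class_coset:
  assumes h: "0 < h" "h * h = 3 / 4" and x: "x \<in> E6_class h P"
  shows "x - extend 5 (spin_weight 5 (if P then {} else {..<5})) ((if P then 1 else -1) / (4 * h)) \<in> EL 5 h"
proof -
  define \<sigma> :: int where "\<sigma> = (if P then 1 else -1)"
  define X :: "nat set" where "X = (if P then {} else {..<5})"
  have \<sigma>: "\<sigma> = 1 \<or> \<sigma> = -1" "(if P then 1 else -1) = real_of_int \<sigma>" by (auto simp: \<sigma>_def)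
  \<comment> \<open>This form of h^2 = 3/4 turns the last coordinates, given as fractions of 1 / h,
    into integer multiples of h.\<close>
  have hi: "1 / h = 4 / 3 * h" using h by (simp add: field_simps)
  have Xi: "spin_weight 5 X $ i = of_int \<sigma> / 2" if "i < 5" for i
    using that by (simp add: X_def \<sigma>_def spin_weight_nth)
  obtain y t where y: "y \<in> carrier_vec 5" "x = extend 5 y t"
    "y = 0\<^sub>v 5 \<and> t = of_int \<sigma> / h \<or> y \<in> vector_weights 5 \<and> t = - of_int \<sigma> / (2 * h) \<or>
    y \<in> spin_weights 5 P \<and> t = of_int \<sigma> / (4 * h)"
    using E6_class_cases[OF x] unfolding \<sigma>(2) by metis
  have "extend 5 (y - spin_weight 5 X) (t - of_int \<sigma> / (4 * h)) \<in> EL 5 h"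
    using y(3)
  proof (elim disjE conjE)
    assume a: "y = 0\<^sub>v 5" "t = of_int \<sigma> / h"
    have "y - spin_weight 5 X - of_int \<sigma> \<cdot>\<^sub>v spin_min 5 = 0\<^sub>v 5"
      using a Xi by (intro eq_vecI) (auto simp: spin_weight_nth)
    moreover have "of_int \<sigma> * (1 / h) - of_int \<sigma> / 4 * (1 / h) = of_int \<sigma> * h" unfolding hi by simp
    then have "t - of_int \<sigma> / (4 * h) = of_int \<sigma> * h" using a(2) by simp
    ultimately show ?thesis using y(1) zero_in_DL[of 5 5] by (intro EL_memI[of _ _ _ \<sigma>]) auto
  next
    assume a: "y \<in> vector_weights 5" "t = - of_int \<sigma> / (2 * h)"
    obtain k and s :: int where k: "k < 5" "s = 1 \<or> s = -1" "y \<in> carrier_vec 5"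
      "\<And>i. i < 5 \<Longrightarrow> y $ i = of_int (if i = k then s else 0)" by (rule vector_weightE[OF a(1)]) blast
    have "(\<Sum>i<5. (if i = k then s else 0) - \<sigma>) = s - 5 * \<sigma>" using k(1) by (simp add: sum_subtractf)
    then have ev: "even (\<Sum>i<5. (if i = k then s else 0) - \<sigma>)" using k(2) \<sigma>(1) by auto
    have "y - spin_weight 5 X - of_int (- \<sigma>) \<cdot>\<^sub>v spin_min 5 \<in> DL 5 5"
    proof (rule DLI[OF _ _ ev])
      fix i :: nat assume i: "i < 5"
      have "spin_min 5 $ i = - 1 / 2" using i by (simp add: spin_weight_nth)
      then show "(y - spin_weight 5 X - of_int (- \<sigma>) \<cdot>\<^sub>v spin_min 5) $ i
          = of_int ((if i = k then s else 0) - \<sigma>)"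
        using i y(1) k(4)[OF i] Xi[OF i] by simp
    qed (use y(1) in auto)
    moreover have "- of_int \<sigma> / 2 * (1 / h) - of_int \<sigma> / 4 * (1 / h) = of_int (- \<sigma>) * h"
      unfolding hi by simp
    then have "t - of_int \<sigma> / (4 * h) = of_int (- \<sigma>) * h" using a(2) by simp
    ultimately show ?thesis using y(1) by (intro EL_memI[of _ _ _ "- \<sigma>"]) auto
  next
    assume a: "y \<in> spin_weights 5 P" "t = of_int \<sigma> / (4 * h)"
    then obtain A where A: "A \<subseteq> {..<5}" "even (card A) = P" "y = spin_weight 5 A"
      by (auto simp: spin_weights_def)
    have "y - spin_weight 5 X \<in> DL 5 5"
      using spin_weight_diff[of X 5 A] A by (auto simp: X_def)
    moreover have "y - spin_weight 5 X - of_int 0 \<cdot>\<^sub>v spin_min 5 = y - spin_weight 5 X"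
      using y(1) by (intro eq_vecI) auto
    ultimately show ?thesis using y(1) a(2) by (intro EL_memI[of _ _ _ 0]) auto
  qed
  then show ?thesis unfolding y(2) \<sigma>(2) X_def[symmetric] using y(1) by (simp add: extend_diff)
qed

text \<open>The residue separates the two cosets: a lattice vector has last coordinate k h, and 4 k
  h^2 = 3k vanishes modulo 3.\<close>

lemma E6_class_residue:
  assumes h: "0 < h" "h * h = 3 / 4" and x: "x \<in> E6_class h P"
  obtains y t a where "y \<in> carrier_vec 5" "x = extend 5 y t" "4 * (t * h) = of_int a" "a mod 3 = (if P then 1 else 2)"
proof -
  obtain y t where y: "y \<in> carrier_vec 5" "x = extend 5 y t"
    "y = 0\<^sub>v 5 \<and> t = (if P then 1 else -1) / h \<or>
    y \<in> vector_weights 5 \<and> t = - (if P then 1 else -1) / (2 * h) \<or>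
    y \<in> spin_weights 5 P \<and> t = (if P then 1 else -1) / (4 * h)"
    using E6_class_cases[OF x] by metis
  then consider "t = (if P then 1 else -1) / h" | "t = - (if P then 1 else -1) / (2 * h)"
    | "t = (if P then 1 else -1) / (4 * h)" by blast
  then show thesis
  proof cases
    case 1
    then show thesis using h by (intro that[OF y(1,2), of "if P then 4 else -4"]) auto
  next
    case 2
    then show thesis using h by (intro that[OF y(1,2), of "if P then -2 else 2"]) auto
  next
    case 3
    then show thesis using h by (intro that[OF y(1,2), of "if P then 1 else -1"]) auto
  qed
qed

lemma weight_class_E6:
  assumes h: "0 < h" "h * h = 3 / 4" and x: "x \<in> E6_class h P"
  shows "weight_class 6 (EL 5 h) x = E6_class h P"
proof (rule Set.set_eqI)
  fix y
  let ?x0 = "extend 5 (spin_weight 5 (if P then {} else {..<5})) ((if P then 1 else -1) / (4 * h))"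
  show "y \<in> weight_class 6 (EL 5 h) x \<longleftrightarrow> y \<in> E6_class h P"
  proof
    assume y: "y \<in> E6_class h P"
    have c: "x \<in> carrier_vec 6" "y \<in> carrier_vec 6" "?x0 \<in> carrier_vec 6"
      using x y E_class_carrier(1) extend_carrier(1)[of 5] by (auto simp: eval_nat_numeral)
    have "(y - ?x0) - (x - ?x0) \<in> EL 5 h"
      using EL_diff[OF _ E6_class_coset[OF h y] E6_class_coset[OF h x]] by simp
    moreover have "(y - ?x0) - (x - ?x0) = y - x" using c by (intro eq_vecI) auto
    ultimately show "y \<in> weight_class 6 (EL 5 h) x"
      using y short_weights_E6[OF h] by (cases P) (auto simp: weight_class_def)
  next
    assume "y \<in> weight_class 6 (EL 5 h) x"
    then have y: "y \<in> short_weights 6 (EL 5 h)" "y - x \<in> EL 5 h" by (auto simp: weight_class_def)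
    obtain Q where Q: "y \<in> E6_class h Q" using y(1) short_weights_E6[OF h] by blast
    obtain v s a where a: "v \<in> carrier_vec 5" "x = extend 5 v s" "4 * (s * h) = of_int a" "a mod 3 = (if P then 1 else 2)"
      using E6_class_residue[OF h x] .
    obtain w t b where b: "w \<in> carrier_vec 5" "y = extend 5 w t" "4 * (t * h) = of_int b" "b mod 3 = (if Q then 1 else 2)"
      using E6_class_residue[OF h Q] .
    obtain k :: int where "t - s = of_int k * h" using y(2) EL_last extend_diff[OF b(1) a(1)] a(2) b(2) by metis
    then have "(t - s) * h = of_int k * (h * h)" by simp
    then have "of_int b - of_int a = (3 * of_int k :: real)" using a(3) b(3) h(2) by (simp add: algebra_simps)
    then have "b - a = 3 * k" by linarith
    then have "b mod 3 = a mod 3" by presburger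
    then have "P = Q" using a(4) b(4) by (auto split: if_splits)
    then show "y \<in> E6_class h P" using Q by simp
  qed
qed

lemma weight_class_E7:
  assumes h: "0 < h" "h * h = 1 / 2" and x: "x \<in> E7_class h"
  shows "weight_class 7 (EL 6 h) x = E7_class h"
proof -
  \<comment> \<open>A representative of the single class; one minus sign puts it among the odd spin
    weights.\<close>
  let ?z = "spin_weight 6 {0}"
  have coset: "x - extend 6 ?z 0 \<in> EL 6 h" if x: "x \<in> E7_class h" for x
  proof -
    obtain y t where y: "y \<in> carrier_vec 6" "x = extend 6 y t"
      "y \<in> vector_weights 6 \<and> (t = 1 / (2 * h) \<or> t = - 1 / (2 * h)) \<or> y \<in> spin_weights 6 False \<and> t = 0"
      using E7_class_cases[OF x] .
    have "extend 6 (y - ?z) (t - 0) \<in> EL 6 h"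
      using y(3)
    proof (elim disjE[of "_ \<and> _" "_ \<and> _"] conjE)
      assume a: "y \<in> vector_weights 6" "t = 1 / (2 * h) \<or> t = - 1 / (2 * h)"
      then obtain \<sigma> :: int where \<sigma>: "\<sigma> = 1 \<or> \<sigma> = -1" "t = of_int \<sigma> / (2 * h)"
        by (metis of_int_1 of_int_minus)
      obtain k and s :: int where k: "k < 6" "s = 1 \<or> s = -1" "y \<in> carrier_vec 6"
        "\<And>i. i < 6 \<Longrightarrow> y $ i = of_int (if i = k then s else 0)" by (rule vector_weightE[OF a(1)]) blast
      \<comment> \<open>The coordinates of the difference. Its sum is s + 1 minus a multiple of 6,
        hence even, since s = \<plusminus>1.\<close>
      let ?w = "\<lambda>i. (if i = k then s else 0) + (if i = 0 then 1 else 0) - (1 - \<sigma>) div 2"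
      have "(\<Sum>i<6. ?w i) = s + 1 - 6 * ((1 - \<sigma>) div 2)" using k(1) by (simp add: sum_subtractf sum.distrib)
      then have ev: "even (\<Sum>i<6. ?w i)" using k(2) by auto
      have "y - ?z - of_int \<sigma> \<cdot>\<^sub>v spin_min 6 \<in> DL 6 6"
        by (rule DLI[OF _ _ ev]) (use y(1) k \<sigma>(1) in \<open>auto simp: spin_weight_nth\<close>)
      moreover have hi: "1 / h = 2 * h" using h by (simp add: field_simps)
      have "of_int \<sigma> / 2 * (1 / h) = of_int \<sigma> * h" unfolding hi by simp
      then have "t - 0 = of_int \<sigma> * h" using \<sigma>(2) by simp
      ultimately show ?thesis using y(1) by (intro EL_memI[of _ _ _ \<sigma>]) auto
    next
      assume a: "y \<in> spin_weights 6 False" "t = 0"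
      then obtain A where A: "A \<subseteq> {..<6}" "odd (card A)" "y = spin_weight 6 A"
        by (auto simp: spin_weights_def)
      have "y - ?z \<in> DL 6 6" using spin_weight_diff[of "{0}" 6 A] A by auto
      moreover have "y - ?z - of_int 0 \<cdot>\<^sub>v spin_min 6 = y - ?z" using y(1) by (intro eq_vecI) auto
      ultimately show ?thesis using y(1) a(2) by (intro EL_memI[of _ _ _ 0]) auto
    qed
    then show ?thesis unfolding y(2) using y(1) by (simp add: extend_diff)
  qed
  have "y - x \<in> EL 6 h" if y: "y \<in> E7_class h" for y
  proof -
    have c: "x \<in> carrier_vec 7" "y \<in> carrier_vec 7" "extend 6 ?z 0 \<in> carrier_vec 7"
      using x y E_class_carrier(2) extend_carrier(1)[of 6] by (auto simp: eval_nat_numeral)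
    have "(y - extend 6 ?z 0) - (x - extend 6 ?z 0) \<in> EL 6 h"
      using EL_diff[OF _ coset[OF y] coset[OF x]] by simp
    moreover have "(y - extend 6 ?z 0) - (x - extend 6 ?z 0) = y - x" using c by (intro eq_vecI) auto
    ultimately show ?thesis by simp
  qed
  then show ?thesis unfolding weight_class_def short_weights_E7[OF h] by blast
qed

lemma extend_inj: "inj_on (\<lambda>y. extend l y a) (carrier_vec l)"
  by (rule inj_onI) (simp add: extend_eq_iff)

lemma finite_weights: "0 < l \<Longrightarrow> finite (vector_weights l)" "0 < l \<Longrightarrow> finite (spin_weights l P)"
  using card_vector_weights[of l] card_spin_weights[of "l - 1" P] card_ge_0_finite[of "vector_weights l"]
    card_ge_0_finite[of "spin_weights l P"] by simp_all

text \<open>The three pieces are separated by their last coordinates, so their sizes 1, 10 and 16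
  add up.\<close>

lemma card_E6_class:
  assumes "0 < h"
  shows "card (E6_class h P) = 27"
proof -
  let ?s = "if P then 1 else - 1 :: real"
  let ?A = "{extend 5 (0\<^sub>v 5) (?s / h)}" let ?B = "(\<lambda>y. extend 5 y (- ?s / (2 * h))) ` vector_weights 5"
  let ?C = "(\<lambda>y. extend 5 y (?s / (4 * h))) ` spin_weights 5 P"
  have last: "x $ 5 = ?s / h" if "x \<in> ?A" for x using that extend_nth(2)[of 5] by auto
  have last': "x $ 5 = - ?s / (2 * h)" if "x \<in> ?B" for x using that extend_nth(2)[of 5] by auto
  have last'': "x $ 5 = ?s / (4 * h)" if "x \<in> ?C" for x using that extend_nth(2)[of 5] by auto
  have ne: "?s / h \<noteq> - ?s / (2 * h)" "?s / h \<noteq> ?s / (4 * h)" "- ?s / (2 * h) \<noteq> ?s / (4 * h)"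
    using assms by (auto simp: field_simps)
  have "?A \<inter> ?B = {}" "(?A \<union> ?B) \<inter> ?C = {}" using last last' last'' ne by fastforce+
  moreover have "card ?B = 10" "card ?C = 16"
    using card_image[OF inj_on_subset[OF extend_inj weights_carrier(1)], of 5]
      card_image[OF inj_on_subset[OF extend_inj weights_carrier(2)], of 5 _ P]
      card_vector_weights[of 5] card_spin_weights[of 4 P] by simp_all
  moreover have "finite ?A" "finite ?B" "finite ?C" using finite_weights by auto
  ultimately show ?thesis unfolding E6_class_def Let_def by (simp add: card_Un_disjoint del: Un_insert_left insert_is_Un)
qed

lemma card_E7_class:
  assumes "0 < h"
  shows "card (E7_class h) = 56"
proof -
  let ?A = "(\<lambda>y. extend 6 y (1 / (2 * h))) ` vector_weights 6" let ?B = "(\<lambda>y. extend 6 y (- 1 / (2 * h))) ` vector_weights 6"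
  let ?C = "(\<lambda>y. extend 6 y 0) ` spin_weights 6 False"
  have last: "x $ 6 = 1 / (2 * h)" if "x \<in> ?A" for x using that extend_nth(2)[of 6] by auto
  have last': "x $ 6 = - 1 / (2 * h)" if "x \<in> ?B" for x using that extend_nth(2)[of 6] by auto
  have last'': "x $ 6 = 0" if "x \<in> ?C" for x using that extend_nth(2)[of 6] by auto
  have ne: "1 / (2 * h) \<noteq> - 1 / (2 * h)" "1 / (2 * h) \<noteq> 0" "- 1 / (2 * h) \<noteq> 0"
    using assms by (auto simp: field_simps)
  have "?A \<inter> ?B = {}" "(?A \<union> ?B) \<inter> ?C = {}" using last last' last'' ne by fastforce+
  moreover have "card ?A = 12" "card ?B = 12" "card ?C = 32"
    using card_image[OF inj_on_subset[OF extend_inj weights_carrier(1)], of 6]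
      card_image[OF inj_on_subset[OF extend_inj weights_carrier(2)], of 6 _ False]
      card_vector_weights[of 6] card_spin_weights[of 5 False] by simp_all
  moreover have "finite ?A" "finite ?B" "finite ?C" using finite_weights by auto
  ultimately show ?thesis unfolding E7_class_def by (simp add: card_Un_disjoint)
qed

lemma E6_class_norm:
  assumes h: "0 < h" "h * h = 3 / 4" and x: "x \<in> E6_class h P"
  shows "x \<bullet> x = 4 / 3"
proof -
  obtain y t where y: "y \<in> carrier_vec 5" "x = extend 5 y t"
    "y = 0\<^sub>v 5 \<and> t = (if P then 1 else -1) / h \<or>
    y \<in> vector_weights 5 \<and> t = - (if P then 1 else -1) / (2 * h) \<or>
    y \<in> spin_weights 5 P \<and> t = (if P then 1 else -1) / (4 * h)"
    using E6_class_cases[OF x] by metis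
  have n: "x \<bullet> x = y \<bullet> y + t * t" using extend_dot[OF y(1)] y(2) by simp
  have hh: "1 / (h * h) = 4 / 3" unfolding h(2) by simp
  from y(3) show ?thesis
  proof (elim disjE conjE)
    assume "y = 0\<^sub>v 5" "t = (if P then 1 else -1) / h"
    then have "y \<bullet> y = 0" "t * t = 1 / (h * h)" by auto
    then show ?thesis using n hh by simp
  next
    assume "y \<in> vector_weights 5" "t = - (if P then 1 else -1) / (2 * h)"
    then have "y \<bullet> y = 1" "t * t = (1 / 4) * (1 / (h * h))" using vector_weight_norm by auto
    then show ?thesis using n hh by simp
  next
    assume a: "y \<in> spin_weights 5 P" "t = (if P then 1 else -1) / (4 * h)"
    then have "y \<bullet> y = 5 / 4" using spin_weight_norm[of 5] by (auto simp: spin_weights_def)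
    moreover have "t * t = (1 / 16) * (1 / (h * h))" using a by auto
    ultimately show ?thesis using n hh by simp
  qed
qed

lemma E7_class_norm:
  assumes h: "0 < h" "h * h = 1 / 2" and x: "x \<in> E7_class h"
  shows "x \<bullet> x = 3 / 2"
proof -
  obtain y t where y: "y \<in> carrier_vec 6" "x = extend 6 y t"
    "y \<in> vector_weights 6 \<and> (t = 1 / (2 * h) \<or> t = - 1 / (2 * h)) \<or> y \<in> spin_weights 6 False \<and> t = 0"
    using E7_class_cases[OF x] .
  have n: "x \<bullet> x = y \<bullet> y + t * t" using extend_dot[OF y(1)] y(2) by simp
  have hh: "1 / (h * h) = 2" unfolding h(2) by simp
  from y(3) show ?thesis
  proof (elim disjE[of "_ \<and> _" "_ \<and> _"] conjE)
    assume "y \<in> vector_weights 6" "t = 1 / (2 * h) \<or> t = - 1 / (2 * h)"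
    then have "y \<bullet> y = 1" "t * t = (1 / 4) * (1 / (h * h))" using vector_weight_norm by auto
    then show ?thesis using n hh by simp
  next
    assume a: "y \<in> spin_weights 6 False" "t = 0"
    then have "y \<bullet> y = 6 / 4" using spin_weight_norm[of 6] by (auto simp: spin_weights_def)
    then show ?thesis using n a by simp
  qed
qed

lemma E_base_dot:
  assumes l: "l \<in> {5, 6}" "h * h = 2 - l / 4" and y: "y \<in> carrier_vec l" and a: "a < l + 1"
  shows "extend l y t \<bullet> E_base l h ! a = (let j = E_labelling l (l - 1) (l - 2) a in
    if j < l then y \<bullet> D_base l ! j else y \<bullet> spin_min l + t * h)"
proof -
  have l4: "4 \<le> l" using l by auto
  let ?j = "E_labelling l (l - 1) (l - 2) a"
  have "is_attachment (E_entry (l + 1)) (D_entry l) l (l - 1) (E_labelling l (l - 1) (l - 2))"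
    by (rule D_attach_E) (use l in auto)
  then have j: "?j < l + 1" using a unfolding is_attachment_def by blast
  show ?thesis
  proof (cases "?j < l")
    case True
    then have "D_base l ! ?j \<in> carrier_vec l" using nth_carrier[OF D_base(2)[OF l4]] D_base(1)[OF l4] by simp
    then show ?thesis
      using True E_base_nth[OF l a] E_gens(4)[OF l4 True, of h] extend_dot by (simp add: Let_def)
  next
    case False
    then have "?j = l" using j by simp
    then show ?thesis
      using E_base_nth[OF l a] E_gens(5)[OF l4, of h] extend_dot[OF spin_weight_carrier(1)] by (simp add: Let_def)
  qed
qed

context model
begin

section \<open>Linkage systems of the diagrams with lattice E_6 or E_7\<close>

lemma linkage_E6:
  assumes \<Lambda>: "l = 6" "\<Lambda> = EL 5 h" "0 < h" "h * h = 3 / 4"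
  shows "card (components \<Gamma>) = 2 \<and> components \<Gamma> = E_components \<Gamma> \<and> card (linkage_system \<Gamma>) = 54 \<and>
       (\<forall>C \<in> components \<Gamma>. card C = 27 \<and> (\<forall>u\<in>C. dual_form \<Gamma> u = 4 / 3))"
proof -
  note h = \<Lambda>(3,4)
  have car: "E6_class h P \<subseteq> carrier_vec l" for P using E_class_carrier(1) \<Lambda>(1) by simp
  have cls: "weight_class l \<Lambda> x = E6_class h P" if "x \<in> E6_class h P" for x P
    using weight_class_E6[OF h that] \<Lambda> by simp
  have sw: "short_weights l \<Lambda> = E6_class h True \<union> E6_class h False"
    using short_weights_E6[OF h] \<Lambda> by simp
  have ne: "E6_class h P \<noteq> {}" for P using card_E6_class[OF h(1), of P] by force
  have img: "(\<lambda>x. labels \<tau>s ` weight_class l \<Lambda> x) ` E6_class h P = {labels \<tau>s ` E6_class h P}" for P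
    using ne cls by (intro image_constant_on) auto
  have c: "components \<Gamma> = {labels \<tau>s ` E6_class h True, labels \<tau>s ` E6_class h False}"
    unfolding components_eq sw image_Un img by blast
  have disj: "E6_class h True \<inter> E6_class h False = {}"
  proof (rule equals0I)
    fix x assume "x \<in> E6_class h True \<inter> E6_class h False"
    then obtain v s a w t b where "x = extend 5 v s" "4 * (s * h) = of_int a" "a mod 3 = 1"
      "x = extend 5 w t" "4 * (t * h) = of_int b" "b mod 3 = 2"
      using E6_class_residue[OF h, of x True] E6_class_residue[OF h, of x False] by (metis IntE)
    moreover from this have "s = t" using extend_nth(2) by metis
    ultimately show False by simp
  qed
  have dist: "labels \<tau>s ` E6_class h True \<noteq> labels \<tau>s ` E6_class h False"
    unfolding image_labels_eq_iff[OF car car] using disj ne by blast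
  have cd: "card (labels \<tau>s ` E6_class h P) = 27" for P
    using card_image_labels[OF car] card_E6_class[OF h(1)] by simp
  have l5: "(5::nat) \<in> {5, 6}" "h * h = 2 - real 5 / 4" using h by simp_all
  note B = E_base[OF l5]
  have type: "labels \<tau>s ` E6_class h P \<in> E_components \<Gamma>"
    if att: "is_attachment (E_entry 7) (E_entry 6) 6 e f" and y: "y \<in> carrier_vec 5"
      and x: "extend 5 y t \<in> E6_class h P" and lab: "\<And>i. i < 6 \<Longrightarrow> extend 5 y t \<bullet> E_base 5 h ! i = (if i = e then -1 else 0)"
    for e f P y t
  proof -
    have "labels \<tau>s ` weight_class l \<Lambda> (extend 5 y t) \<in> E_components \<Gamma>"
    proof (rule attachment_type)
      show "length (E_base 5 h) = l" "set (E_base 5 h) \<subseteq> carrier_vec l" "zlat l (E_base 5 h) = \<Lambda>"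
        using B(1-3) \<Lambda> by simp_all
      show "E_base 5 h ! i \<bullet> E_base 5 h ! j = of_int (E_entry 6 i j)" if "i < l" "j < l" for i j
        using B(5)[of i j] that \<Lambda> by simp
      show "cartan (dynkin_E (l + 1)) $$ (a, b) = of_int (E_entry 7 a b)" if "a < l + 1" "b < l + 1" for a b
        using cartan_dynkin_entry(2)[of a "l + 1" b] that \<Lambda>(1) by simp
      show "is_attachment (E_entry 7) (E_entry 6) l e f" using att \<Lambda>(1) by simp
      show "extend 5 y t \<in> short_weights l \<Lambda>" unfolding sw using x by (cases P) auto
      show "extend 5 y t \<bullet> E_base 5 h ! i = (if i = e then - 1 else 0)" if "i < l" for i
        using lab that \<Lambda>(1) by simp
      show "z \<bullet> z = extend 5 y t \<bullet> extend 5 y t" if "z \<in> weight_class l \<Lambda> (extend 5 y t)" for z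
        using that cls[OF x] E6_class_norm[OF h x] E6_class_norm[OF h, of z P] by simp
    qed simp_all
    then show ?thesis unfolding cls[OF x] .
  qed
  have six: "i = 0 \<or> i = 1 \<or> i = 2 \<or> i = 3 \<or> i = 4 \<or> i = 5" if "i < 6" for i :: nat using that by auto
  have e0: "minus_e0 5 \<in> vector_weights 5" "minus_e0 5 \<in> carrier_vec 5" by (auto simp: minus_e0) (simp add: minus_e0_def)
  have ms: "minus_e0 5 \<bullet> spin_min 5 = 1 / 2"
    by (simp add: scalar_prod_def minus_e0_def spin_weight_def eval_nat_numeral)
  \<comment> \<open>Base vertex 4 is the free end of the D_5 chain, where -e_0 has label -1. The
    last coordinate cancels its product 1/2 with the spin generator.\<close>
  have "labels \<tau>s ` E6_class h True \<in> E_components \<Gamma>"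
  proof (rule type[OF E_attach_E(1) e0(2), of "- 1 / (2 * h)"])
    show "extend 5 (minus_e0 5) (- 1 / (2 * h)) \<in> E6_class h True"
      unfolding extend_in_E6_class[OF e0(2)] using e0(1) by simp
    show "extend 5 (minus_e0 5) (- 1 / (2 * h)) \<bullet> E_base 5 h ! i = (if i = 4 then - 1 else 0)" if "i < 6" for i
      using six[OF that] E_base_dot[OF l5 e0(2), of i "- 1 / (2 * h)"] ms h(1)
      by (elim disjE) (simp_all add: E_labelling_def minus_e0(2))
  qed
  \<comment> \<open>Base vertex 0 is the spin generator, and the weight concentrated in the last
    coordinate sees only that vertex.\<close>
  moreover have "labels \<tau>s ` E6_class h False \<in> E_components \<Gamma>"
  proof (rule type[OF E_attach_E(2) zero_carrier_vec, of "- 1 / h"])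
    show "extend 5 (0\<^sub>v 5) (- 1 / h) \<in> E6_class h False"
      unfolding extend_in_E6_class[OF zero_carrier_vec] by simp
    have D: "D_base 5 ! j \<in> carrier_vec 5" if "j < 5" for j
      using nth_carrier[OF D_base(2)[of 5]] D_base(1)[of 5] that by simp
    show "extend 5 (0\<^sub>v 5) (- 1 / h) \<bullet> E_base 5 h ! i = (if i = 0 then - 1 else 0)" if "i < 6" for i
      using six[OF that] E_base_dot[OF l5 zero_carrier_vec, of i "- 1 / h"] h(1) D
      by (elim disjE) (simp_all add: E_labelling_def)
  qed
  ultimately have E: "components \<Gamma> = E_components \<Gamma>"
    using c by (auto simp: components_of_type_def)
  have fin: "finite (E6_class h P)" for P
    by (rule card_ge_0_finite) (simp add: card_E6_class[OF h(1)])
  have "card (linkage_system \<Gamma>) = 54"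
    unfolding linkage_system_eq sw
    using card_image_labels[of "E6_class h True \<union> E6_class h False"] car card_Un_disjoint[OF fin fin disj]
      card_E6_class[OF h(1)] by simp
  moreover have "card (components \<Gamma>) = 2" unfolding c using dist by simp
  moreover have "dual_form \<Gamma> u = 4 / 3" if "u \<in> labels \<tau>s ` E6_class h P" for u P
    using that dual_form_labels E6_class_norm[OF h] subsetD[OF car] by (metis imageE)
  then have "\<forall>C \<in> components \<Gamma>. card C = 27 \<and> (\<forall>u\<in>C. dual_form \<Gamma> u = 4 / 3)"
    unfolding c using cd by blast
  ultimately show ?thesis using E by blast
qed

lemma linkage_E7:
  assumes \<Lambda>: "l = 7" "\<Lambda> = EL 6 h" "0 < h" "h * h = 1 / 2"
  shows "card (components \<Gamma>) = 1 \<and> components \<Gamma> = E_components \<Gamma> \<and>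
       (\<forall>C \<in> components \<Gamma>. card C = 56 \<and> (\<forall>u\<in>C. dual_form \<Gamma> u = 3 / 2))"
proof -
  note h = \<Lambda>(3,4)
  have car: "E7_class h \<subseteq> carrier_vec l" using E_class_carrier(2) \<Lambda>(1) by simp
  have cls: "weight_class l \<Lambda> x = E7_class h" if "x \<in> E7_class h" for x
    using weight_class_E7[OF h that] \<Lambda> by simp
  have sw: "short_weights l \<Lambda> = E7_class h"
    using short_weights_E7[OF h] \<Lambda> by simp
  have ne: "E7_class h \<noteq> {}" using card_E7_class[OF h(1)] by force
  have c: "components \<Gamma> = {labels \<tau>s ` E7_class h}"
    unfolding components_eq sw using ne cls by (intro image_constant_on) auto
  have l6: "(6::nat) \<in> {5, 6}" "h * h = 2 - real 6 / 4" using h by simp_all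
  note B = E_base[OF l6]
  have seven: "i = 0 \<or> i = 1 \<or> i = 2 \<or> i = 3 \<or> i = 4 \<or> i = 5 \<or> i = 6" if "i < 7" for i :: nat using that by auto
  have e0: "minus_e0 6 \<in> vector_weights 6" "minus_e0 6 \<in> carrier_vec 6" by (auto simp: minus_e0) (simp add: minus_e0_def)
  have ms: "minus_e0 6 \<bullet> spin_min 6 = 1 / 2"
    by (simp add: scalar_prod_def minus_e0_def spin_weight_def eval_nat_numeral)
  \<comment> \<open>As for E_6: the label -1 occurs at vertex 5, the free end of the D_6 chain, and
    the last coordinate cancels the product with the spin generator.\<close>
  let ?x = "extend 6 (minus_e0 6) (- 1 / (2 * h))"
  have x: "?x \<in> E7_class h" unfolding extend_in_E7_class[OF e0(2)] using e0(1) by simp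
  have "labels \<tau>s ` weight_class l \<Lambda> ?x \<in> E_components \<Gamma>"
  proof (rule attachment_type)
    show "length (E_base 6 h) = l" "set (E_base 6 h) \<subseteq> carrier_vec l" "zlat l (E_base 6 h) = \<Lambda>"
      using B(1-3) \<Lambda> by simp_all
    show "E_base 6 h ! i \<bullet> E_base 6 h ! j = of_int (E_entry 7 i j)" if "i < l" "j < l" for i j
      using B(5)[of i j] that \<Lambda> by simp
    show "cartan (dynkin_E (l + 1)) $$ (a, b) = of_int (E_entry 8 a b)" if "a < l + 1" "b < l + 1" for a b
      using cartan_dynkin_entry(2)[of a "l + 1" b] that \<Lambda>(1) by simp
    show "is_attachment (E_entry 8) (E_entry 7) l 5 ((!) [0, 1, 2, 3, 4, 5, 7, 6])"
      using E_attach_E(3) \<Lambda>(1) by simp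
    show "?x \<in> short_weights l \<Lambda>" unfolding sw by (rule x)
    show "?x \<bullet> E_base 6 h ! i = (if i = 5 then - 1 else 0)" if "i < l" for i
    proof -
      have "i < 7" using that \<Lambda>(1) by simp
      from seven[OF this] show ?thesis
        using E_base_dot[OF l6 e0(2), of i "- 1 / (2 * h)"] ms h(1)
        by (elim disjE) (simp_all add: E_labelling_def minus_e0(2))
    qed
    show "z \<bullet> z = ?x \<bullet> ?x" if "z \<in> weight_class l \<Lambda> ?x" for z
      using that cls[OF x] E7_class_norm[OF h x] E7_class_norm[OF h, of z] by simp
  qed simp_all
  then have "labels \<tau>s ` E7_class h \<in> E_components \<Gamma>" unfolding cls[OF x] .
  then have "components \<Gamma> = E_components \<Gamma>" using c by (auto simp: components_of_type_def)
  moreover have "card (labels \<tau>s ` E7_class h) = 56"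
    using card_image_labels[OF car] card_E7_class[OF h(1)] by simp
  moreover have "dual_form \<Gamma> u = 3 / 2" if "u \<in> labels \<tau>s ` E7_class h" for u
    using that dual_form_labels E7_class_norm[OF h] subsetD[OF car] by (metis imageE)
  ultimately have "\<forall>C \<in> components \<Gamma>. card C = 56 \<and> (\<forall>u\<in>C. dual_form \<Gamma> u = 3 / 2)"
    unfolding c by blast
  moreover have "card (components \<Gamma>) = 1" unfolding c by simp
  ultimately show ?thesis using \<open>components \<Gamma> = E_components \<Gamma>\<close> by blast
qed

end

section \<open>Realizing the Carter diagrams in the lattices\<close>

definition edge_sign :: "nat set set \<Rightarrow> nat \<Rightarrow> nat \<Rightarrow> real" where
  "edge_sign F i j = (if {i, j} \<in> F then 1 else -1)"

lemma edge_sign_props: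
  "edge_sign F i j = 1 \<or> edge_sign F i j = -1" "edge_sign F i j = edge_sign F j i"
  by (auto simp: edge_sign_def insert_commute)

text \<open>Dotted edges carry +1 and solid ones -1. An odd number of dotted edges among four leaves
  an odd number of solid ones, so the product of the signs around a 4-cycle is -1.\<close>

lemma carter_diagramsE:
  assumes "\<Gamma> \<in> carter_diagrams n E"
  obtains F where "F \<subseteq> E" "\<Gamma> = Diagram n (E - F) F"
    "\<And>i j. i < n \<Longrightarrow> j < n \<Longrightarrow> cartan \<Gamma> $$ (i, j) =
       (if i = j then 2 else if {i, j} \<in> E then edge_sign F i j else 0)"
    "\<And>a b c d. distinct [a, b, c, d] \<Longrightarrow> path [a, b, c, d, a] \<subseteq> E \<Longrightarrow>
       edge_sign F a b * edge_sign F b c * edge_sign F c d * edge_sign F d a = -1"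
proof -
  obtain F where F: "F \<subseteq> E" "\<Gamma> = Diagram n (E - F) F"
    and odd: "\<forall>a b c d. distinct [a, b, c, d] \<and> path [a, b, c, d, a] \<subseteq> E \<longrightarrow>
        odd (card (path [a, b, c, d, a] \<inter> F))"
    using assms unfolding carter_diagrams_def mem_Collect_eq by (elim exE conjE)
  show thesis
  proof (rule that[OF F])
    show "cartan \<Gamma> $$ (i, j) = (if i = j then 2 else if {i, j} \<in> E then edge_sign F i j else 0)"
      if "i < n" "j < n" for i j
      using that F by (auto simp: cartan_def edge_sign_def)
    fix a b c d assume d: "distinct [a, b, c, d]" "path [a, b, c, d, a] \<subseteq> E"
    have ne: "{a, b} \<noteq> {b, c}" "{a, b} \<noteq> {c, d}" "{a, b} \<noteq> {d, a}" "{b, c} \<noteq> {c, d}" "{b, c} \<noteq> {d, a}" "{c, d} \<noteq> {d, a}"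
      using d(1) by (auto simp: doubleton_eq_iff)
    show "edge_sign F a b * edge_sign F b c * edge_sign F c d * edge_sign F d a = -1"
      using odd[rule_format, OF conjI[OF d]] ne unfolding edge_sign_def
      by (cases "{a, b} \<in> F"; cases "{b, c} \<in> F"; cases "{c, d} \<in> F"; cases "{d, a} \<in> F")
        (simp_all add: Int_insert_left)
  qed
qed

lemma zlat_signs:
  assumes "length ws = N" "set ws \<subseteq> carrier_vec n" "\<And>i. i < N \<Longrightarrow> \<epsilon> i = 1 \<or> \<epsilon> i = (-1 :: real)"
  shows "zlat n (map (\<lambda>i. \<epsilon> i \<cdot>\<^sub>v ws ! i) [0..<N]) = zlat n ws" (is "zlat n ?vs = _")
proof
  have wc: "ws ! i \<in> carrier_vec n" if "i < N" for i using nth_carrier[OF assms(2)] assms(1) that by simp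
  have vc: "set ?vs \<subseteq> carrier_vec n" using wc by auto
  have sgn: "\<epsilon> i \<cdot>\<^sub>v v \<in> zlat n us" if "v \<in> zlat n us" "i < N" for i v us
    using zlat_smult[OF that(1), of 1] zlat_smult[OF that(1), of "-1"] assms(3)[OF that(2)] by auto
  have "\<epsilon> i \<cdot>\<^sub>v ws ! i \<in> zlat n ws" if "i < N" for i
    using sgn[OF zlat_nth[OF _ assms(2)]] that assms(1) by simp
  then show "zlat n ?vs \<subseteq> zlat n ws" by (intro zlat_least[OF vc assms(2)]) auto
  have "ws ! i \<in> zlat n ?vs" if i: "i < N" for i
  proof -
    have "?vs ! i \<in> zlat n ?vs" using zlat_nth[OF _ vc] i by simp
    then have "\<epsilon> i \<cdot>\<^sub>v (\<epsilon> i \<cdot>\<^sub>v ws ! i) \<in> zlat n ?vs" using sgn i by simp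
    moreover have "\<epsilon> i * \<epsilon> i = 1" using assms(3)[OF i] by auto
    ultimately show ?thesis by (simp add: smult_smult_assoc)
  qed
  then show "zlat n ws \<subseteq> zlat n ?vs"
    using assms(1) by (intro zlat_least[OF assms(2) vc]) (auto simp: in_set_conv_nth)
qed

definition signed_entry :: "(nat \<times> nat) list \<Rightarrow> (nat \<times> nat) list \<Rightarrow> nat \<Rightarrow> nat \<Rightarrow> int" where
  "signed_entry es ds i j = (if i = j then 2 else let e = (min i j, max i j) in
     if e \<in> set es then (if e \<in> set ds then 1 else -1) else 0)"

text \<open>The rows of \<open>P\<close> are roots, in coordinates with respect to a base of type \<open>E_n\<close>, whose Gram
  matrix is that of the graph with edges \<open>es\<close>, dotted on \<open>ds\<close>; \<open>Q\<close> is a left inverse of \<open>P\<close>.\<close>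

definition E_embedding :: "nat \<Rightarrow> (nat \<times> nat) list \<Rightarrow> (nat \<times> nat) list \<Rightarrow>
    int list list \<Rightarrow> int list list \<Rightarrow> bool" where
  "E_embedding n es ds P Q \<longleftrightarrow>
     (\<forall>i<n. \<forall>j<n. (\<Sum>a<n. \<Sum>b<n. P ! i ! a * P ! j ! b * E_entry n a b) = signed_entry es ds i j) \<and>
     (\<forall>k<n. \<forall>j<n. (\<Sum>i<n. Q ! k ! i * P ! i ! j) = (if k = j then 1 else 0))"

lemma sum_lessThan_sum_list: "(\<Sum>i<n. f i) = sum_list (map f [0..<n])"
  by (simp add: interv_sum_list_conv_sum_set_nat lessThan_atLeast0)

text \<open>The cycle condition solved for the edge {a, d}, so that it rewrites the sign of an edge
  outside the spanning tree into signs of tree edges.\<close>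

definition cycle_signs :: "(nat \<Rightarrow> nat \<Rightarrow> real) \<Rightarrow> (nat \<times> nat \<times> nat \<times> nat) list \<Rightarrow> bool" where
  "cycle_signs s cs \<longleftrightarrow> (\<forall>i j. \<bar>s i j\<bar> = 1 \<and> s i j = s j i) \<and>
     (\<forall>(a, b, c, d)\<in>set cs. s a d = - (s a b * s b c * s c d))"

lemma cycle_signsD:
  assumes "cycle_signs s cs"
  shows "\<bar>s i j\<bar> = 1" "s i j * s i j = 1" "s i j * (s i j * x) = x"
    "\<forall>(a, b, c, d)\<in>set cs. s a d = - (s a b * s b c * s c d)"
proof -
  show "\<bar>s i j\<bar> = 1" using assms by (simp add: cycle_signs_def)
  then show "s i j * s i j = 1" by (metis abs_mult_self_eq mult_1)
  then show "s i j * (s i j * x) = x" by (simp flip: mult.assoc)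
qed (use assms in \<open>simp add: cycle_signs_def\<close>)

text \<open>The condition j < i orients the symmetry, which makes it safe as a rewrite rule.\<close>

lemma cycle_signs_swap: "cycle_signs s cs \<Longrightarrow> j < i \<Longrightarrow> s i j = s j i"
  by (simp add: cycle_signs_def)

text \<open>The entries of \<open>f s\<close> are the signs of the roots: products of the edge signs along the paths of a
  spanning tree. The 4-cycles \<open>cs\<close> provide the signs of the edges outside the tree.\<close>

lemma carter_E_model:
  assumes l: "l \<in> {5, 6}" and h: "0 < h" "h * h = 2 - real l / 4"
    and \<Gamma>: "\<Gamma> \<in> carter_diagrams (l + 1) ((\<lambda>(i, j). {i, j}) ` set es)"
    and emb: "E_embedding (l + 1) es ds P Q"
    and es: "\<forall>(i, j)\<in>set es. i < j"
    and cs: "\<forall>(a, b, c, d)\<in>set cs. distinct [a, b, c, d] \<and>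
      path [a, b, c, d, a] \<subseteq> (\<lambda>(i, j). {i, j}) ` set es"
    and len: "\<And>s. length (f s) = l + 1"
    and sgn: "\<And>s. cycle_signs s cs \<Longrightarrow> (\<forall>x\<in>set (f s). \<bar>x\<bar> = 1) \<and>
        (\<forall>(i, j)\<in>set es. f s ! i * f s ! j * (if (i, j) \<in> set ds then 1 else -1) = s i j)"
  shows "\<exists>\<tau>s. model \<Gamma> \<tau>s (l + 1) \<and> zlat (l + 1) \<tau>s = EL l h"
proof -
  let ?n = "l + 1" let ?E = "(\<lambda>(i, j). {i, j}) ` set es"
  obtain F where F0: "F \<subseteq> ?E" and F: "\<Gamma> = Diagram ?n (?E - F) F"
    "\<And>i j. i < ?n \<Longrightarrow> j < ?n \<Longrightarrow> cartan \<Gamma> $$ (i, j) = (if i = j then 2 else if {i, j} \<in> ?E then edge_sign F i j else 0)"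
    "\<And>a b c d. distinct [a, b, c, d] \<Longrightarrow> path [a, b, c, d, a] \<subseteq> ?E \<Longrightarrow>
       edge_sign F a b * edge_sign F b c * edge_sign F c d * edge_sign F d a = -1"
    by (rule carter_diagramsE[OF \<Gamma>]) (rule that, assumption+)
  define \<epsilon> where "\<epsilon> i = f (edge_sign F) ! i" for i
  have "cycle_signs (edge_sign F) cs"
    unfolding cycle_signs_def
  proof (intro conjI allI ballI)
    show "\<bar>edge_sign F i j\<bar> = 1" for i j using edge_sign_props(1)[of F i j] by auto
    show "edge_sign F i j = edge_sign F j i" for i j by (rule edge_sign_props(2))
    fix x assume "x \<in> set cs"
    moreover obtain a b c d where x: "x = (a, b, c, d)" by (cases x)
    ultimately have "distinct [a, b, c, d] \<and> path [a, b, c, d, a] \<subseteq> ?E"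
      using cs by fast
    then have "edge_sign F a b * edge_sign F b c * edge_sign F c d * edge_sign F d a = -1"
      using F(3) by blast
    then show "case x of (a, b, c, d) \<Rightarrow>
        edge_sign F a d = - (edge_sign F a b * edge_sign F b c * edge_sign F c d)"
      unfolding x using edge_sign_props(1)[of F d a] edge_sign_props(2)[of F a d] by auto
  qed
  note sgn = sgn[OF this]
  have \<epsilon>: "\<epsilon> i = 1 \<or> \<epsilon> i = -1" if "i < ?n" for i
  proof -
    have "\<bar>\<epsilon> i\<bar> = 1" using sgn that len unfolding \<epsilon>_def by (metis nth_mem)
    then show ?thesis by linarith
  qed
  have \<epsilon>2: "\<epsilon> i * \<epsilon> j * (if (i, j) \<in> set ds then 1 else -1) = edge_sign F i j" if "(i, j) \<in> set es" for i j
    using sgn that by (auto simp: \<epsilon>_def)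
  have edge: "{i, j} \<in> ?E \<longleftrightarrow> (min i j, max i j) \<in> set es" if "i \<noteq> j" for i j
  proof -
    have "{i, j} = {min i j, max i j}" by (auto simp: min_def max_def)
    then have "{i, j} \<in> ?E \<longleftrightarrow> {min i j, max i j} \<in> ?E" by (rule arg_cong)
    also have "\<dots> \<longleftrightarrow> (\<exists>(a, b)\<in>set es. {min i j, max i j} = {a, b})"
      by (simp add: image_iff split_beta)
    also have "\<dots> \<longleftrightarrow> (\<exists>(a, b)\<in>set es. a = min i j \<and> b = max i j)"
      using es by (intro bex_cong refl) (auto simp: doubleton_eq_iff)
    finally show ?thesis by auto
  qed
  \<comment> \<open>The signs transform the reference dotting \<open>ds\<close> into the given
    dotting F.\<close>
  have g: "cartan \<Gamma> $$ (i, j) = \<epsilon> i * \<epsilon> j * of_int (signed_entry es ds i j)" if ij: "i < ?n" "j < ?n" for i j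
  proof (cases "i = j")
    case True
    then show ?thesis using F(2)[OF ij] \<epsilon>[OF ij(1)] by (auto simp: signed_entry_def)
  next
    case False
    let ?a = "min i j" and ?b = "max i j"
    have sym: "\<epsilon> ?a * \<epsilon> ?b = \<epsilon> i * \<epsilon> j" "edge_sign F ?a ?b = edge_sign F i j"
      using edge_sign_props(2)[of F i j] by (auto simp: min_def max_def)
    show ?thesis
      using F(2)[OF ij] False edge[OF False] \<epsilon>2[of ?a ?b] sym
      by (auto simp: signed_entry_def Let_def)
  qed
  note B = E_base[OF l h(2)]
  let ?bs = "E_base l h"
  define p where "p i a = (of_int (P ! i ! a) :: real)" for i a
  define ws where "ws = map (\<lambda>i. comb ?n ?bs (p i)) [0..<?n]"
  have ws: "length ws = ?n" "set ws \<subseteq> carrier_vec ?n" by (auto simp: ws_def simp del: upt_Suc)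
  have ws_i: "ws ! i = comb ?n ?bs (p i)" if "i < ?n" for i using that by (simp add: ws_def del: upt_Suc)
  have dot: "ws ! i \<bullet> ws ! j = of_int (signed_entry es ds i j)" if "i < ?n" "j < ?n" for i j
  proof -
    have "ws ! i \<bullet> ws ! j = (\<Sum>a<?n. \<Sum>b<?n. p i a * p j b * of_int (E_entry ?n a b))"
      unfolding ws_i[OF that(1)] ws_i[OF that(2)] comb_inner[OF B(2)] B(1)
      using B(5) by (intro sum.cong refl) simp
    also have "\<dots> = of_int (\<Sum>a<?n. \<Sum>b<?n. P ! i ! a * P ! j ! b * E_entry ?n a b)"
      by (simp only: p_def of_int_sum of_int_mult)
    also have "\<dots> = of_int (signed_entry es ds i j)"
      using emb that unfolding E_embedding_def by (intro arg_cong[of _ _ of_int]) blast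
    finally show ?thesis .
  qed
  have zws: "zlat ?n ws = EL l h"
    unfolding B(3)[symmetric]
  proof
    have "ws ! i \<in> zlat ?n ?bs" if "i < ?n" for i
      unfolding ws_i[OF that] p_def by (rule comb_in_zlat)
    then show "zlat ?n ws \<subseteq> zlat ?n ?bs"
      using ws by (intro zlat_least[OF ws(2) B(2)]) (auto simp: in_set_conv_nth)
    \<comment> \<open>Without this direction the rows might generate a proper sublattice; the
      integer left inverse Q recovers each base root from them.\<close>
    have "?bs ! k \<in> zlat ?n ws" if k: "k < ?n" for k
    proof -
      have "comb ?n ws (\<lambda>i. of_int (Q ! k ! i)) = comb ?n ?bs (\<lambda>j. \<Sum>i<?n. of_int (Q ! k ! i) * p i j)"
        unfolding ws_def by (rule comb_comb)
      also have "\<dots> = comb ?n ?bs (\<lambda>j. if j = k then 1 else 0)"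
      proof (rule comb_cong)
        fix j assume "j < length ?bs"
        then have "(\<Sum>i<?n. Q ! k ! i * P ! i ! j) = (if k = j then 1 else 0)"
          using emb k B(1) unfolding E_embedding_def by simp
        then have "real_of_int (\<Sum>i<?n. Q ! k ! i * P ! i ! j) = (if j = k then 1 else 0)" by simp
        then show "(\<Sum>i<?n. of_int (Q ! k ! i) * p i j) = (if j = k then 1 else 0)"
          by (simp only: p_def of_int_sum of_int_mult)
      qed
      also have "\<dots> = ?bs ! k" using comb_unit[of k ?bs ?n 1] k B(1,2) by simp
      finally show ?thesis by (metis comb_in_zlat)
    qed
    then show "zlat ?n ?bs \<subseteq> zlat ?n ws"
      using B(1) by (intro zlat_least[OF B(2) ws(2)]) (auto simp: in_set_conv_nth)
  qed
  define ts where "ts = map (\<lambda>i. \<epsilon> i \<cdot>\<^sub>v ws ! i) [0..<?n]"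
  have z: "zlat ?n ts = EL l h"
    unfolding ts_def by (rule trans[OF zlat_signs[OF ws \<epsilon>] zws])
  have wc: "ws ! i \<in> carrier_vec ?n" if "i < ?n" for i using nth_carrier[OF ws(2)] ws(1) that by simp
  have tc: "length ts = ?n" "set ts \<subseteq> carrier_vec ?n" using wc by (auto simp: ts_def simp del: upt_Suc)
  have "model \<Gamma> ts ?n"
  proof
    show "rank \<Gamma> = ?n" using F(1) by simp
    show "ts ! i \<bullet> ts ! j = cartan \<Gamma> $$ (i, j)" if "i < ?n" "j < ?n" for i j
    proof -
      note c = wc[OF that(1)] wc[OF that(2)]
      have "ts ! i \<bullet> ts ! j = \<epsilon> i * (\<epsilon> j * (ws ! i \<bullet> ws ! j))"
        using that smult_scalar_prod_distrib[OF c(1) smult_carrier_vec[THEN iffD2, OF c(2)]] scalar_prod_smult_distrib[OF c]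
        by (simp add: ts_def del: upt_Suc)
      then show ?thesis by (simp only: g[OF that] dot[OF that] mult.assoc)
    qed
    have "4 \<le> l" "h \<noteq> 0" using l h by auto
    then show "nondeg ?n ts" by (rule EL_nondeg[OF _ _ tc(2) z])
  qed (rule tc)+
  with z show ?thesis by blast
qed

lemma E_dynkin_model:
  assumes l: "l \<in> {5, 6}" and h: "0 < h" "h * h = 2 - real l / 4"
  shows "\<exists>\<tau>s. model (dynkin_E (l + 1)) \<tau>s (l + 1) \<and> zlat (l + 1) \<tau>s = EL l h"
proof -
  note B = E_base[OF l h(2)]
  have "model (dynkin_E (l + 1)) (E_base l h) (l + 1)"
  proof
    show "E_base l h ! i \<bullet> E_base l h ! j = cartan (dynkin_E (l + 1)) $$ (i, j)" if "i < l + 1" "j < l + 1" for i j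
      using B(5)[OF that] cartan_dynkin_entry(2)[OF that] by simp
    have "4 \<le> l" "h \<noteq> 0" using l h by auto
    then show "nondeg (l + 1) (E_base l h)" by (rule EL_nondeg[OF _ _ B(2,3)])
  qed (use B in simp_all)
  with B(3) show ?thesis by blast
qed

section \<open>Explicit embeddings of the E-type Carter diagrams\<close>

lemma E6a1_model:
  assumes h: "0 < h" "h * h = 2 - real 5 / 4" and \<Gamma>: "\<Gamma> \<in> E6a1"
  shows "\<exists>\<tau>s. model \<Gamma> \<tau>s 6 \<and> zlat 6 \<tau>s = EL 5 h"
proof -
  let ?es = "[(0, 1), (1, 2), (2, 3), (0, 3), (0, 4), (1, 5)] :: (nat \<times> nat) list"
  \<comment> \<open>The reference dotting: the edge that closes the 4-cycle, lying outside the
    spanning tree.\<close>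
  let ?ds = "[(2, 3)] :: (nat \<times> nat) list"
  let ?cs = "[(2, 1, 0, 3)] :: (nat \<times> nat \<times> nat \<times> nat) list"
  let ?f = "\<lambda>s :: nat \<Rightarrow> nat \<Rightarrow> real. [1, - (s 0 1), (s 0 1 * s 1 2), - (s 0 3), - (s 0 4), (s 0 1 * s 1 5)]"
  have E: "\<Gamma> \<in> carter_diagrams (5 + 1) ((\<lambda>(i, j). {i, j}) ` set ?es)"
    using \<Gamma> unfolding E6a1_def by (simp add: insert_commute)
  have emb: "E_embedding (5 + 1) ?es ?ds
    [[-1, 0, 0, 0, 0, 0], [0, -1, 0, 0, 0, 0], [0, 0, -1, 0, 0, 0],
     [0, -1, -2, -1, 0, -1], [1, 1, 1, 0, 0, 1], [0, 0, -1, -1, -1, -1]]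
    [[-1, 0, 0, 0, 0, 0], [0, -1, 0, 0, 0, 0], [0, 0, -1, 0, 0, 0],
     [-1, 0, 1, -1, -1, 0], [0, -1, -1, 1, 0, -1], [1, 1, 1, 0, 1, 0]]"
    unfolding E_embedding_def all_less_iff_list_all sum_lessThan_sum_list by code_simp
  have sgn: "(\<forall>x\<in>set (?f s). \<bar>x\<bar> = 1) \<and>
      (\<forall>(i, j)\<in>set ?es. ?f s ! i * ?f s ! j * (if (i, j) \<in> set ?ds then 1 else -1) = s i j)"
    if "cycle_signs s ?cs" for s
    using cycle_signsD(4)[OF that] by (simp add: cycle_signsD(1-3)[OF that] cycle_signs_swap[OF that] abs_mult mult_ac)
  have "\<exists>\<tau>s. model \<Gamma> \<tau>s (5 + 1) \<and> zlat (5 + 1) \<tau>s = EL 5 h"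
    by (rule carter_E_model[where f = ?f, OF _ h E emb _ _ _ sgn]) (simp_all add: doubleton_eq_iff)
  then show ?thesis by simp
qed

lemma E6a2_model:
  assumes h: "0 < h" "h * h = 2 - real 5 / 4" and \<Gamma>: "\<Gamma> \<in> E6a2"
  shows "\<exists>\<tau>s. model \<Gamma> \<tau>s 6 \<and> zlat 6 \<tau>s = EL 5 h"
proof -
  let ?es = "[(0, 1), (1, 2), (2, 3), (0, 3), (1, 4), (4, 5), (2, 5)] :: (nat \<times> nat) list"
  let ?ds = "[(2, 3), (4, 5)] :: (nat \<times> nat) list"
  \<comment> \<open>Each of the two cycles determines one closing edge, 2-3 and 4-5; these are also
    the edges dotted for reference.\<close>
  let ?cs = "[(2, 1, 0, 3), (4, 1, 2, 5)] :: (nat \<times> nat \<times> nat \<times> nat) list"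
  let ?f = "\<lambda>s :: nat \<Rightarrow> nat \<Rightarrow> real. [1, - (s 0 1), (s 0 1 * s 1 2), - (s 0 3), (s 0 1 * s 1 4), - (s 0 1 * s 1 2 * s 2 5)]"
  have E: "\<Gamma> \<in> carter_diagrams (5 + 1) ((\<lambda>(i, j). {i, j}) ` set ?es)"
    using \<Gamma> unfolding E6a2_def by (simp add: insert_commute)
  have emb: "E_embedding (5 + 1) ?es ?ds
    [[-1, 0, 0, 0, 0, 0], [0, -1, 0, 0, 0, 0], [0, 0, -1, 0, 0, 0],
     [0, -1, -2, -1, 0, -1], [0, 0, -1, -1, -1, -1], [0, 0, 0, 0, 0, -1]]
    [[-1, 0, 0, 0, 0, 0], [0, -1, 0, 0, 0, 0], [0, 0, -1, 0, 0, 0],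
     [0, 1, 2, -1, 0, 1], [0, -1, -1, 1, -1, 0], [0, 0, 0, 0, 0, -1]]"
    unfolding E_embedding_def all_less_iff_list_all sum_lessThan_sum_list by code_simp
  have sgn: "(\<forall>x\<in>set (?f s). \<bar>x\<bar> = 1) \<and>
      (\<forall>(i, j)\<in>set ?es. ?f s ! i * ?f s ! j * (if (i, j) \<in> set ?ds then 1 else -1) = s i j)"
    if "cycle_signs s ?cs" for s
    using cycle_signsD(4)[OF that] by (simp add: cycle_signsD(1-3)[OF that] cycle_signs_swap[OF that] abs_mult mult_ac)
  have "\<exists>\<tau>s. model \<Gamma> \<tau>s (5 + 1) \<and> zlat (5 + 1) \<tau>s = EL 5 h"
    by (rule carter_E_model[where f = ?f, OF _ h E emb _ _ _ sgn]) (simp_all add: doubleton_eq_iff)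
  then show ?thesis by simp
qed

text \<open>Removing the end vertex 5 leaves E_6(a_1). The other rows are those of
  \<open>E6a1_model\<close>, padded by 0 at base root 5, and the row of vertex 5 is the only one
  that involves this base root.\<close>

lemma E7a1_model:
  assumes h: "0 < h" "h * h = 2 - real 6 / 4" and \<Gamma>: "\<Gamma> \<in> E7a1"
  shows "\<exists>\<tau>s. model \<Gamma> \<tau>s 7 \<and> zlat 7 \<tau>s = EL 6 h"
proof -
  let ?es = "[(0, 1), (1, 2), (2, 3), (0, 3), (0, 4), (4, 5), (1, 6)] :: (nat \<times> nat) list"
  let ?ds = "[(2, 3)] :: (nat \<times> nat) list"
  let ?cs = "[(2, 1, 0, 3)] :: (nat \<times> nat \<times> nat \<times> nat) list"
  let ?f = "\<lambda>s :: nat \<Rightarrow> nat \<Rightarrow> real. [1, - (s 0 1), (s 0 1 * s 1 2), - (s 0 3), - (s 0 4), (s 0 4 * s 4 5), (s 0 1 * s 1 6)]"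
  have E: "\<Gamma> \<in> carter_diagrams (6 + 1) ((\<lambda>(i, j). {i, j}) ` set ?es)"
    using \<Gamma> unfolding E7a1_def by (simp add: insert_commute)
  have emb: "E_embedding (6 + 1) ?es ?ds
    [[-1, 0, 0, 0, 0, 0, 0], [0, -1, 0, 0, 0, 0, 0], [0, 0, -1, 0, 0, 0, 0], [0, -1, -2, -1, 0, 0, -1],
     [1, 1, 1, 0, 0, 0, 1], [1, 2, 3, 3, 2, 1, 1], [0, 0, -1, -1, -1, 0, -1]]
    [[-1, 0, 0, 0, 0, 0, 0], [0, -1, 0, 0, 0, 0, 0], [0, 0, -1, 0, 0, 0, 0], [-1, 0, 1, -1, -1, 0, 0],
     [0, -1, -1, 1, 0, 0, -1], [3, 3, 1, 1, 2, 1, 2], [1, 1, 1, 0, 1, 0, 0]]"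
    unfolding E_embedding_def all_less_iff_list_all sum_lessThan_sum_list by code_simp
  have sgn: "(\<forall>x\<in>set (?f s). \<bar>x\<bar> = 1) \<and>
      (\<forall>(i, j)\<in>set ?es. ?f s ! i * ?f s ! j * (if (i, j) \<in> set ?ds then 1 else -1) = s i j)"
    if "cycle_signs s ?cs" for s
    using cycle_signsD(4)[OF that] by (simp add: cycle_signsD(1-3)[OF that] cycle_signs_swap[OF that] abs_mult mult_ac)
  have "\<exists>\<tau>s. model \<Gamma> \<tau>s (6 + 1) \<and> zlat (6 + 1) \<tau>s = EL 6 h"
    by (rule carter_E_model[where f = ?f, OF _ h E emb _ _ _ sgn]) (simp_all add: doubleton_eq_iff)
  then show ?thesis by simp
qed

text \<open>Again the rows of \<open>E6a1_model\<close> are padded by 0 at base root 5; the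
  additional root belongs to the pendant vertex 6.\<close>

lemma E7a2_model:
  assumes h: "0 < h" "h * h = 2 - real 6 / 4" and \<Gamma>: "\<Gamma> \<in> E7a2"
  shows "\<exists>\<tau>s. model \<Gamma> \<tau>s 7 \<and> zlat 7 \<tau>s = EL 6 h"
proof -
  let ?es = "[(0, 1), (1, 2), (2, 3), (0, 3), (0, 4), (1, 5), (2, 6)] :: (nat \<times> nat) list"
  let ?ds = "[(2, 3)] :: (nat \<times> nat) list"
  let ?cs = "[(2, 1, 0, 3)] :: (nat \<times> nat \<times> nat \<times> nat) list"
  let ?f = "\<lambda>s :: nat \<Rightarrow> nat \<Rightarrow> real. [1, - (s 0 1), (s 0 1 * s 1 2), - (s 0 3), - (s 0 4), (s 0 1 * s 1 5), - (s 0 1 * s 1 2 * s 2 6)]"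
  have E: "\<Gamma> \<in> carter_diagrams (6 + 1) ((\<lambda>(i, j). {i, j}) ` set ?es)"
    using \<Gamma> unfolding E7a2_def by (simp add: insert_commute)
  have emb: "E_embedding (6 + 1) ?es ?ds
    [[-1, 0, 0, 0, 0, 0, 0], [0, -1, 0, 0, 0, 0, 0], [0, 0, -1, 0, 0, 0, 0], [0, -1, -2, -1, 0, 0, -1],
     [1, 1, 1, 0, 0, 0, 1], [0, 0, -1, -1, -1, 0, -1], [1, 2, 3, 2, 2, 1, 1]]
    [[-1, 0, 0, 0, 0, 0, 0], [0, -1, 0, 0, 0, 0, 0], [0, 0, -1, 0, 0, 0, 0], [-1, 0, 1, -1, -1, 0, 0],
     [0, -1, -1, 1, 0, -1, 0], [2, 3, 2, 0, 1, 2, 1], [1, 1, 1, 0, 1, 0, 0]]"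
    unfolding E_embedding_def all_less_iff_list_all sum_lessThan_sum_list by code_simp
  have sgn: "(\<forall>x\<in>set (?f s). \<bar>x\<bar> = 1) \<and>
      (\<forall>(i, j)\<in>set ?es. ?f s ! i * ?f s ! j * (if (i, j) \<in> set ?ds then 1 else -1) = s i j)"
    if "cycle_signs s ?cs" for s
    using cycle_signsD(4)[OF that] by (simp add: cycle_signsD(1-3)[OF that] cycle_signs_swap[OF that] abs_mult mult_ac)
  have "\<exists>\<tau>s. model \<Gamma> \<tau>s (6 + 1) \<and> zlat (6 + 1) \<tau>s = EL 6 h"
    by (rule carter_E_model[where f = ?f, OF _ h E emb _ _ _ sgn]) (simp_all add: doubleton_eq_iff)
  then show ?thesis by simp
qed

text \<open>The rows of \<open>E6a2_model\<close> are padded in the same way, and the pendant vertex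
  6 is realized by the highest root of E_7.\<close>

lemma E7a3_model:
  assumes h: "0 < h" "h * h = 2 - real 6 / 4" and \<Gamma>: "\<Gamma> \<in> E7a3"
  shows "\<exists>\<tau>s. model \<Gamma> \<tau>s 7 \<and> zlat 7 \<tau>s = EL 6 h"
proof -
  let ?es = "[(0, 1), (1, 2), (2, 3), (0, 3), (1, 4), (4, 5), (2, 5), (0, 6)] :: (nat \<times> nat) list"
  let ?ds = "[(2, 3), (4, 5)] :: (nat \<times> nat) list"
  let ?cs = "[(2, 1, 0, 3), (4, 1, 2, 5)] :: (nat \<times> nat \<times> nat \<times> nat) list"
  let ?f = "\<lambda>s :: nat \<Rightarrow> nat \<Rightarrow> real. [1, - (s 0 1), (s 0 1 * s 1 2), - (s 0 3), (s 0 1 * s 1 4), - (s 0 1 * s 1 2 * s 2 5), - (s 0 6)]"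
  have E: "\<Gamma> \<in> carter_diagrams (6 + 1) ((\<lambda>(i, j). {i, j}) ` set ?es)"
    using \<Gamma> unfolding E7a3_def by (simp add: insert_commute)
  have emb: "E_embedding (6 + 1) ?es ?ds
    [[-1, 0, 0, 0, 0, 0, 0], [0, -1, 0, 0, 0, 0, 0], [0, 0, -1, 0, 0, 0, 0], [0, -1, -2, -1, 0, 0, -1],
     [0, 0, -1, -1, -1, 0, -1], [0, 0, 0, 0, 0, 0, -1], [2, 3, 4, 3, 2, 1, 2]]
    [[-1, 0, 0, 0, 0, 0, 0], [0, -1, 0, 0, 0, 0, 0], [0, 0, -1, 0, 0, 0, 0], [0, 1, 2, -1, 0, 1, 0],
     [0, -1, -1, 1, -1, 0, 0], [2, 2, 0, 1, 2, -1, 1], [0, 0, 0, 0, 0, -1, 0]]"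
    unfolding E_embedding_def all_less_iff_list_all sum_lessThan_sum_list by code_simp
  have sgn: "(\<forall>x\<in>set (?f s). \<bar>x\<bar> = 1) \<and>
      (\<forall>(i, j)\<in>set ?es. ?f s ! i * ?f s ! j * (if (i, j) \<in> set ?ds then 1 else -1) = s i j)"
    if "cycle_signs s ?cs" for s
    using cycle_signsD(4)[OF that] by (simp add: cycle_signsD(1-3)[OF that] cycle_signs_swap[OF that] abs_mult mult_ac)
  have "\<exists>\<tau>s. model \<Gamma> \<tau>s (6 + 1) \<and> zlat (6 + 1) \<tau>s = EL 6 h"
    by (rule carter_E_model[where f = ?f, OF _ h E emb _ _ _ sgn]) (simp_all add: doubleton_eq_iff)
  then show ?thesis by simp
qed

text \<open>The 4-cycles are the three faces of the cube through vertex 0. Each contains exactly one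
  of the edges 2-3, 4-5 and 4-6 outside the spanning tree and determines its sign.\<close>

lemma E7a4_model:
  assumes h: "0 < h" "h * h = 2 - real 6 / 4" and \<Gamma>: "\<Gamma> \<in> E7a4"
  shows "\<exists>\<tau>s. model \<Gamma> \<tau>s 7 \<and> zlat 7 \<tau>s = EL 6 h"
proof -
  let ?es = "[(0, 1), (0, 2), (0, 4), (1, 3), (1, 5), (2, 3), (2, 6), (4, 5), (4, 6)] :: (nat \<times> nat) list"
  let ?ds = "[(2, 3), (4, 5), (4, 6)] :: (nat \<times> nat) list"
  let ?cs = "[(2, 0, 1, 3), (4, 0, 1, 5), (4, 0, 2, 6)] :: (nat \<times> nat \<times> nat \<times> nat) list"
  let ?f = "\<lambda>s :: nat \<Rightarrow> nat \<Rightarrow> real. [1, - (s 0 1), - (s 0 2), (s 0 1 * s 1 3), - (s 0 4), (s 0 1 * s 1 5), (s 0 2 * s 2 6)]"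
  have E: "\<Gamma> \<in> carter_diagrams (6 + 1) ((\<lambda>(i, j). {i, j}) ` set ?es)"
    using \<Gamma> unfolding E7a4_def by (simp add: insert_commute)
  have emb: "E_embedding (6 + 1) ?es ?ds
    [[-1, 0, 0, 0, 0, 0, 0], [0, -1, 0, 0, 0, 0, 0], [1, 1, 1, 0, 0, 0, 0], [0, 0, -1, -1, 0, 0, -1],
     [0, -1, -2, -1, -1, 0, -1], [0, 0, -1, -1, -1, 0, 0], [0, 0, 0, 1, 1, 1, 0]]
    [[-1, 0, 0, 0, 0, 0, 0], [0, -1, 0, 0, 0, 0, 0], [1, 1, 1, 0, 0, 0, 0], [0, -1, 0, -1, 1, -1, 0],
     [-1, 0, -1, 1, -1, 0, 0], [1, 1, 1, 0, 0, 1, 1], [-1, 0, -1, 0, -1, 1, 0]]"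
    unfolding E_embedding_def all_less_iff_list_all sum_lessThan_sum_list by code_simp
  have sgn: "(\<forall>x\<in>set (?f s). \<bar>x\<bar> = 1) \<and>
      (\<forall>(i, j)\<in>set ?es. ?f s ! i * ?f s ! j * (if (i, j) \<in> set ?ds then 1 else -1) = s i j)"
    if "cycle_signs s ?cs" for s
    using cycle_signsD(4)[OF that] by (simp add: cycle_signsD(1-3)[OF that] cycle_signs_swap[OF that] abs_mult mult_ac)
  have "\<exists>\<tau>s. model \<Gamma> \<tau>s (6 + 1) \<and> zlat (6 + 1) \<tau>s = EL 6 h"
    by (rule carter_E_model[where f = ?f, OF _ h E emb _ _ _ sgn]) (simp_all add: doubleton_eq_iff)
  then show ?thesis by simp
qed

text \<open>The vertices of a diagram \<open>D_l(a_k)\<close> other than the vertex \<open>3\<close> form a path; \<open>Da_index\<close>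
  gives the position on this path, and \<open>Da_vertex\<close> is its inverse. The vertex \<open>3\<close> corresponds
  to the root \<open>e_p + e_{p+1}\<close>, where \<open>p\<close> is the position of the vertex \<open>1\<close>.\<close>

definition Da_index :: "nat \<Rightarrow> nat \<Rightarrow> nat \<Rightarrow> nat" where
  "Da_index l k v = (if v = 0 then l - k - 1 else if v = 1 then l - k - 2 else if v = 2 then l - k - 3
     else if v = 3 then l - 1 else if v < k + 3 then v + (l - k) - 4 else l - 1 - v)"

definition Da_vertex :: "nat \<Rightarrow> nat \<Rightarrow> nat \<Rightarrow> nat" where
  "Da_vertex l k m = (if m = l - k - 1 then 0 else if m = l - k - 2 then 1 else if m = l - k - 3 then 2
     else if m = l - 1 then 3 else if m < l - k then l - 1 - m else m + 4 - (l - k))"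

lemma Da_index_inverse:
  assumes "1 \<le> k" "k + 3 \<le> l" "v < l"
  shows "Da_index l k v < l" "Da_vertex l k (Da_index l k v) = v" "v \<noteq> 3 \<Longrightarrow> Da_index l k v < l - 1"
proof -
  \<comment> \<open>The length of the tail at vertex 2; with l = k + 3 + q the truncated
    subtractions disappear.\<close>
  obtain q where q: "l = k + 3 + q" using assms(2) le_Suc_ex by blast
  consider "v = 0" | "v = 1" | "v = 2" | "v = 3" | "4 \<le> v" "v < k + 3" | "4 \<le> v" "k + 3 \<le> v"
    using assms by linarith
  then have "Da_index l k v < l \<and> Da_vertex l k (Da_index l k v) = v \<and> (v \<noteq> 3 \<longrightarrow> Da_index l k v < l - 1)"
  proof cases
    case 5
    then obtain r where "v = 4 + r" using le_Suc_ex by blast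
    with 5 show ?thesis by (auto simp: q Da_index_def Da_vertex_def)
  next
    case 6
    then obtain r where r: "v = k + 3 + r" using le_Suc_ex by blast
    then obtain s where "q = Suc (r + s)" using assms(3) q less_iff_Suc_add[of r q] by auto
    with 6 r assms(1) show ?thesis by (auto simp: q Da_index_def Da_vertex_def)
  qed (use assms(1) in \<open>auto simp: q Da_index_def Da_vertex_def\<close>)
  then show "Da_index l k v < l" "Da_vertex l k (Da_index l k v) = v" "v \<noteq> 3 \<Longrightarrow> Da_index l k v < l - 1"
    by auto
qed

lemma path_Cons_upt_iff:
  "{i, j} \<in> path (x # [a..<b]) \<longleftrightarrow> a < b \<and> {i, j} = {x, a} \<or> {i, j} \<in> path [a..<b]"
  by (cases "a < b") (simp_all add: upt_conv_Cons)

abbreviation Da_edges :: "nat \<Rightarrow> nat \<Rightarrow> nat set set" where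
  "Da_edges l k \<equiv> path [0, 1, 2, 3, 0] \<union> path (0 # [4..<k + 3]) \<union> path (2 # [k + 3..<l])"

text \<open>Away from vertex 3 the diagram is a path, so being joined means having consecutive
  positions.\<close>

lemma Da_edge_iff:
  assumes k: "1 \<le> k" "k + 3 \<le> l" and ij: "i < l" "j < l" "i \<noteq> 3" "j \<noteq> 3"
  shows "{i, j} \<in> Da_edges l k \<longleftrightarrow> Da_index l k j = Suc (Da_index l k i) \<or> Da_index l k i = Suc (Da_index l k j)"
proof -
  have "{i, j} \<in> Da_edges l k \<longleftrightarrow> {i, j} = {0, 1} \<or> {i, j} = {1, 2} \<or>
    4 < k + 3 \<and> {i, j} = {0, 4} \<or> k + 3 < l \<and> {i, j} = {2, k + 3} \<or>
    (j = Suc i \<and> 4 \<le> i \<and> j < k + 3) \<or> (i = Suc j \<and> 4 \<le> j \<and> i < k + 3) \<or>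
    (j = Suc i \<and> k + 3 \<le> i \<and> j < l) \<or> (i = Suc j \<and> k + 3 \<le> j \<and> i < l)"
    using ij(3,4) unfolding Un_iff path_Cons_upt_iff path_upt_iff by (auto simp: doubleton_eq_iff)
  moreover consider "i = 0" | "i = 1" | "i = 2" | "4 \<le> i" "i < k + 3" | "k + 3 \<le> i" "4 \<le> i" using ij(3) k(1) by linarith
  then have "{i, j} = {0, 1} \<or> {i, j} = {1, 2} \<or>
    4 < k + 3 \<and> {i, j} = {0, 4} \<or> k + 3 < l \<and> {i, j} = {2, k + 3} \<or>
    (j = Suc i \<and> 4 \<le> i \<and> j < k + 3) \<or> (i = Suc j \<and> 4 \<le> j \<and> i < k + 3) \<or>
    (j = Suc i \<and> k + 3 \<le> i \<and> j < l) \<or> (i = Suc j \<and> k + 3 \<le> j \<and> i < l) \<longleftrightarrow>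
    Da_index l k j = Suc (Da_index l k i) \<or> Da_index l k i = Suc (Da_index l k j)"
  proof cases
    case 1
    then show ?thesis using ij k by (auto simp: doubleton_eq_iff Da_index_def)
  next
    case 2
    then show ?thesis using ij k by (auto simp: doubleton_eq_iff Da_index_def)
  next
    case 3
    then show ?thesis using ij k by (auto simp: doubleton_eq_iff Da_index_def)
  next
    case 4
    then show ?thesis using ij k by (auto simp: doubleton_eq_iff Da_index_def)
  next
    case 5
    then show ?thesis using ij k by (auto simp: doubleton_eq_iff Da_index_def)
  qed
  ultimately show ?thesis by (rule trans)
qed

lemma Da_edge_3_iff:
  assumes "1 \<le> k" "i \<noteq> 3"
  shows "{i, 3} \<in> Da_edges l k \<longleftrightarrow> i = 0 \<or> i = 2"
  using assms unfolding Un_iff path_Cons_upt_iff path_upt_iff by (auto simp: doubleton_eq_iff)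

lemma Da_model:
  assumes k: "1 \<le> k" "k + 3 \<le> l" and \<Gamma>: "\<Gamma> \<in> Da l k"
  shows "\<exists>\<tau>s. model \<Gamma> \<tau>s l \<and> zlat l \<tau>s = DL l l"
proof -
  let ?E = "Da_edges l k" let ?\<mu> = "Da_index l k" let ?\<nu> = "Da_vertex l k"
  have "\<Gamma> \<in> carter_diagrams l ?E" using \<Gamma> by (simp add: Da_def)
  then obtain F where F0: "F \<subseteq> ?E" and F: "\<Gamma> = Diagram l (?E - F) F"
    "\<And>i j. i < l \<Longrightarrow> j < l \<Longrightarrow> cartan \<Gamma> $$ (i, j) = (if i = j then 2 else if {i, j} \<in> ?E then edge_sign F i j else 0)"
    "\<And>a b c d. distinct [a, b, c, d] \<Longrightarrow> path [a, b, c, d, a] \<subseteq> ?E \<Longrightarrow>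
       edge_sign F a b * edge_sign F b c * edge_sign F c d * edge_sign F d a = -1"
    by (rule carter_diagramsE) (rule that, assumption+)
  let ?s = "edge_sign F"
  have cyc: "?s 0 1 * ?s 1 2 * ?s 2 3 * ?s 3 0 = -1" by (rule F(3)) auto
  \<comment> \<open>The accumulated sign along the path. The chain roots have consecutive products
    -1, so each edge contributes the negative of its prescribed sign.\<close>
  define \<eta> :: "nat \<Rightarrow> real" where "\<eta> m = (\<Prod>j<m. - ?s (?\<nu> j) (?\<nu> (Suc j)))" for m
  have \<eta>: "\<eta> m = 1 \<or> \<eta> m = -1" for m
  proof (induction m)
    case 0
    show ?case by (simp add: \<eta>_def)
  next
    case (Suc m)
    then show ?case using edge_sign_props(1)[of F "?\<nu> m" "?\<nu> (Suc m)"] by (auto simp: \<eta>_def)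
  qed
  \<comment> \<open>The root for vertex 3 has product +1 with that of vertex 0, so the edge 0-3
    fixes its sign.\<close>
  define \<epsilon> where "\<epsilon> v = (if v = 3 then \<eta> (?\<mu> 0) * ?s 0 3 else \<eta> (?\<mu> v))" for v
  have \<epsilon>1: "\<epsilon> v = 1 \<or> \<epsilon> v = -1" for v
    using \<eta>[of "?\<mu> 0"] \<eta>[of "?\<mu> v"] edge_sign_props(1)[of F 0 3] by (auto simp: \<epsilon>_def)
  have \<epsilon>sq: "\<epsilon> v * \<epsilon> v = 1" for v using \<epsilon>1[of v] by auto
  note ix = Da_index_inverse[OF k]
  have step: "\<epsilon> i * \<epsilon> j = - ?s i j" if "i < l" "j < l" "i \<noteq> 3" "j \<noteq> 3" "?\<mu> j = Suc (?\<mu> i)" for i j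
  proof -
    have "\<eta> (?\<mu> j) = \<eta> (?\<mu> i) * - ?s i j"
      unfolding that(5) using ix(2)[OF that(1)] ix(2)[OF that(2)] that(5) by (simp add: \<eta>_def)
    then show ?thesis using that(3,4) \<eta>[of "?\<mu> i"] by (auto simp: \<epsilon>_def)
  qed
  have l4: "4 \<le> l" using k by simp
  have i0: "?\<mu> 0 = l - k - 1" "?\<mu> 1 = l - k - 2" "?\<mu> 2 = l - k - 3" "?\<mu> 3 = l - 1" by (simp_all add: Da_index_def)
  have e3: "\<epsilon> 0 * \<epsilon> 3 = ?s 0 3" using \<eta>[of "?\<mu> 0"] by (auto simp: \<epsilon>_def)
  have e01: "\<epsilon> 1 * \<epsilon> 0 = - ?s 1 0" using step[of 1 0] l4 k i0 by simp
  have e12: "\<epsilon> 2 * \<epsilon> 1 = - ?s 2 1" using step[of 2 1] l4 k i0 by simp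
  \<comment> \<open>No sign is free any more; the last edge of the cycle comes out right because the
    product of the signs around it is -1.\<close>
  have e23: "\<epsilon> 2 * \<epsilon> 3 = - ?s 2 3"
  proof -
    have "\<epsilon> 2 * \<epsilon> 3 = (\<epsilon> 2 * \<epsilon> 1) * (\<epsilon> 1 * \<epsilon> 0) * (\<epsilon> 0 * \<epsilon> 3)"
      using \<epsilon>1[of 0] \<epsilon>1[of 1] by auto
    also have "\<dots> = ?s 1 2 * ?s 0 1 * ?s 3 0"
      unfolding e12 e01 e3 using edge_sign_props(2)[of F] by simp
    also have "\<dots> = - ?s 2 3"
      using cyc edge_sign_props(1)[of F 0 1] edge_sign_props(1)[of F 1 2] edge_sign_props(1)[of F 2 3] edge_sign_props(1)[of F 3 0]
      by (elim disjE) simp_all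
    finally show ?thesis .
  qed
  let ?p = "l - k - 2"
  have p: "Suc ?p < l" using k by simp
  show ?thesis
  proof (rule D_model[OF _ p _ \<epsilon>1])
    show "rank \<Gamma> = l" using F(1) by simp
    show "bij_betw ?\<mu> {..<l} {..<l}"
    proof (rule bij_betw_of_inj)
      show "\<forall>a<l. ?\<mu> a < l" using ix(1) by blast
      show "\<forall>a<l. \<forall>b<l. ?\<mu> a = ?\<mu> b \<longrightarrow> a = b" using ix(2) by metis
    qed
    fix i j assume ij: "i < l" "j < l"
    have inj: "?\<mu> i = ?\<mu> j \<longleftrightarrow> i = j" using ix(2)[OF ij(1)] ix(2)[OF ij(2)] by metis
    note dot = D_chain_dot[OF ix(1)[OF ij(1)] ix(1)[OF ij(2)] p]
    have Sp: "Suc ?p = ?\<mu> 0" "Suc m = ?p \<longleftrightarrow> m = ?\<mu> 2" for m using i0 k by auto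
    have pos: "?\<mu> v = ?\<mu> 0 \<longleftrightarrow> v = 0" "?\<mu> v = ?\<mu> 2 \<longleftrightarrow> v = 2" if "v < l" for v
    proof -
      have "0 < l" "2 < l" using l4 by auto
      then show "?\<mu> v = ?\<mu> 0 \<longleftrightarrow> v = 0" "?\<mu> v = ?\<mu> 2 \<longleftrightarrow> v = 2"
        using ix(2)[OF that] ix(2)[of 0] ix(2)[of 2] by metis+
    qed
    show "cartan \<Gamma> $$ (i, j) = \<epsilon> i * \<epsilon> j * (D_chain l ?p (?\<mu> i) \<bullet> D_chain l ?p (?\<mu> j))"
    proof (cases "i = j")
      case True
      then show ?thesis using F(2)[OF ij] dot \<epsilon>sq by simp
    next
      case ne: False
      consider "i \<noteq> 3" "j \<noteq> 3" | "i = 3" | "j = 3" by blast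
      then show ?thesis
      proof cases
        case 1
        have d: "D_chain l ?p (?\<mu> i) \<bullet> D_chain l ?p (?\<mu> j) = (if ?\<mu> j = Suc (?\<mu> i) \<or> ?\<mu> i = Suc (?\<mu> j) then -1 else 0)"
          using dot inj ne ix(3)[OF ij(1) 1(1)] ix(3)[OF ij(2) 1(2)] by simp
        show ?thesis
          unfolding F(2)[OF ij] d Da_edge_iff[OF k ij 1]
          using ne step[OF ij 1] step[OF ij(2,1) 1(2,1)] edge_sign_props(2)[of F i j] by (auto simp: mult.commute)
      next
        case 2
        have "?\<mu> j < l - 1" using ix(3)[OF ij(2)] ne 2 by simp
        then have d: "D_chain l ?p (?\<mu> i) \<bullet> D_chain l ?p (?\<mu> j) = (if j = 0 then 1 else if j = 2 then -1 else 0)"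
          using dot inj ne 2 i0(4) Sp pos[OF ij(2)] by simp
        have "{i, j} \<in> ?E \<longleftrightarrow> j = 0 \<or> j = 2" using Da_edge_3_iff[OF k(1), of j l] ne 2 by (simp add: insert_commute)
        then show ?thesis
          unfolding F(2)[OF ij] d
          using ne 2 e3 e23 edge_sign_props(2)[of F 3] by (auto simp: mult.commute)
      next
        case 3
        have "?\<mu> i < l - 1" using ix(3)[OF ij(1)] ne 3 by simp
        then have d: "D_chain l ?p (?\<mu> i) \<bullet> D_chain l ?p (?\<mu> j) = (if i = 0 then 1 else if i = 2 then -1 else 0)"
          using dot inj ne 3 i0(4) Sp pos[OF ij(1)] by simp
        have "{i, j} \<in> ?E \<longleftrightarrow> i = 0 \<or> i = 2" using Da_edge_3_iff[OF k(1), of i l] ne 3 by simp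
        then show ?thesis
          unfolding F(2)[OF ij] d
          using ne 3 e3 e23 by auto
      qed
    qed
  qed
qed

lemma D_dynkin_model:
  assumes "4 \<le> l"
  shows "\<exists>\<tau>s. model (dynkin_D l) \<tau>s l \<and> zlat l \<tau>s = DL l l"
proof -
  obtain p where p: "l = p + 4" using assms by (metis add.commute le_Suc_ex)
  show ?thesis
  proof (rule D_model[where \<epsilon> = "\<lambda>_. 1" and \<mu> = id and p = "p + 2"])
    show "cartan (dynkin_D l) $$ (i, j) = 1 * 1 * (D_chain l (p + 2) (id i) \<bullet> D_chain l (p + 2) (id j))"
      if "i < l" "j < l" for i j
      using that D_chain_gram[of i p j] cartan_dynkin_entry(1)[of i l j] p by simp
  qed (use p in auto)
qed

section \<open>The families of diagrams and the final statement\<close>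

lemma D_family:
  assumes "\<Gamma> = dynkin_D l \<or> (\<exists>k\<in>{1..l - 3}. \<Gamma> \<in> Da l k)" "4 \<le> l"
  shows "\<exists>\<tau>s. D_lattice_model \<Gamma> \<tau>s l"
proof -
  have "\<exists>\<tau>s. model \<Gamma> \<tau>s l \<and> zlat l \<tau>s = DL l l"
    using assms D_dynkin_model[of l] Da_model[of _ l \<Gamma>] by fastforce
  then show ?thesis
    using assms(2) by (auto simp: D_lattice_model_def D_lattice_model_axioms_def)
qed

lemma E6_family:
  assumes "\<Gamma> \<in> E6a1 \<union> E6a2 \<union> {dynkin_E 6}"
  shows "card (components \<Gamma>) = 2 \<and> components \<Gamma> = E_components \<Gamma> \<and> card (linkage_system \<Gamma>) = 54 \<and>
       (\<forall>C \<in> components \<Gamma>. card C = 27 \<and> (\<forall>u\<in>C. dual_form \<Gamma> u = 4 / 3))"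
proof -
  \<comment> \<open>Completes the spin weight of D_5, of norm 5/4, to a root of norm 2; for E_7 the
    spin weight has norm 6/4 and h^2 = 1/2.\<close>
  define h where "h = sqrt (3 / 4)"
  have h: "0 < h" "h * h = 3 / 4" by (auto simp: h_def)
  then have h': "h * h = 2 - real 5 / 4" by simp
  have "\<exists>\<tau>s. model \<Gamma> \<tau>s 6 \<and> zlat 6 \<tau>s = EL 5 h"
    using assms E6a1_model[OF h(1) h'] E6a2_model[OF h(1) h'] E_dynkin_model[of 5, OF _ h(1) h'] by auto
  then obtain \<tau>s where "model \<Gamma> \<tau>s 6" "zlat 6 \<tau>s = EL 5 h" by blast
  then show ?thesis using model.linkage_E6[OF _ refl _ h] by blast
qed

lemma E7_family:
  assumes "\<Gamma> \<in> E7a1 \<union> E7a2 \<union> E7a3 \<union> E7a4 \<union> {dynkin_E 7}"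
  shows "card (components \<Gamma>) = 1 \<and> components \<Gamma> = E_components \<Gamma> \<and>
       (\<forall>C \<in> components \<Gamma>. card C = 56 \<and> (\<forall>u\<in>C. dual_form \<Gamma> u = 3 / 2))"
proof -
  define h where "h = sqrt (1 / 2)"
  have h: "0 < h" "h * h = 1 / 2" by (auto simp: h_def)
  then have h': "h * h = 2 - real 6 / 4" by simp
  have "\<exists>\<tau>s. model \<Gamma> \<tau>s 7 \<and> zlat 7 \<tau>s = EL 6 h"
    using assms E7a1_model[OF h(1) h'] E7a2_model[OF h(1) h'] E7a3_model[OF h(1) h'] E7a4_model[OF h(1) h']
      E_dynkin_model[of 6, OF _ h(1) h'] by auto
  then obtain \<tau>s where "model \<Gamma> \<tau>s 7" "zlat 7 \<tau>s = EL 6 h" by blast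
  then show ?thesis using model.linkage_E7[OF _ refl _ h] by blast
qed

lemma D5_7_family:
  assumes "\<Gamma> = dynkin_D l \<or> (\<exists>k\<in>{1..l - 3}. \<Gamma> \<in> Da l k)" "l \<in> {5, 6, 7}"
  shows "card (components \<Gamma>) = 3 \<and> components \<Gamma> = E_components \<Gamma> \<union> D_components \<Gamma> \<and>
       card (E_components \<Gamma>) = 2 \<and> card (\<Union>(E_components \<Gamma>)) = 2 ^ l \<and>
       (\<forall>C \<in> E_components \<Gamma>. card C = 2 ^ (l - 1) \<and> (\<forall>u\<in>C. dual_form \<Gamma> u = l / 4)) \<and>
       card (D_components \<Gamma>) = 1 \<and>
       (\<forall>C \<in> D_components \<Gamma>. card C = 2 * l \<and> (\<forall>u\<in>C. dual_form \<Gamma> u = 1))"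
proof -
  have "4 \<le> l" using assms(2) by auto
  then obtain \<tau>s where "D_lattice_model \<Gamma> \<tau>s l" using D_family[OF assms(1)] by blast
  then show ?thesis by (rule D_lattice_model.linkage_rank_5_7[OF _ assms(2)])
qed

theorem theorem1p4:
  shows
    "(\<forall>\<Gamma> \<in> Da 4 1 \<union> {dynkin_D 4}. \<exists>C1 C2 C3.
       distinct [C1, C2, C3] \<and> components \<Gamma> = {C1, C2, C3} \<and>
       {C1, C2} \<subseteq> E_components \<Gamma> \<inter> D_components \<Gamma> \<and> C3 \<in> D_components \<Gamma> \<and>
       (\<Gamma> = dynkin_D 4 \<longrightarrow> C3 \<in> E_components \<Gamma>) \<and>
       card C1 = 8 \<and> card C2 = 8 \<and> card (C1 \<union> C2) = 16 \<and> card C3 = 8 \<and>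
       (\<forall>u \<in> C1 \<union> C2 \<union> C3. dual_form \<Gamma> u = 1)) \<and>
     (\<forall>\<Gamma> \<in> Da 5 1 \<union> {dynkin_D 5}.
       card (components \<Gamma>) = 3 \<and> components \<Gamma> = E_components \<Gamma> \<union> D_components \<Gamma> \<and>
       card (E_components \<Gamma>) = 2 \<and> card (\<Union>(E_components \<Gamma>)) = 32 \<and>
       (\<forall>C \<in> E_components \<Gamma>. card C = 16 \<and> (\<forall>u\<in>C. dual_form \<Gamma> u = 5 / 4)) \<and>
       card (D_components \<Gamma>) = 1 \<and>
       (\<forall>C \<in> D_components \<Gamma>. card C = 10 \<and> (\<forall>u\<in>C. dual_form \<Gamma> u = 1))) \<and>
     (\<forall>\<Gamma> \<in> E6a1 \<union> E6a2 \<union> {dynkin_E 6}.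
       card (components \<Gamma>) = 2 \<and> components \<Gamma> = E_components \<Gamma> \<and> card (linkage_system \<Gamma>) = 54 \<and>
       (\<forall>C \<in> components \<Gamma>. card C = 27 \<and> (\<forall>u\<in>C. dual_form \<Gamma> u = 4 / 3))) \<and>
     (\<forall>\<Gamma> \<in> Da 6 1 \<union> Da 6 2 \<union> {dynkin_D 6}.
       card (components \<Gamma>) = 3 \<and> components \<Gamma> = E_components \<Gamma> \<union> D_components \<Gamma> \<and>
       card (E_components \<Gamma>) = 2 \<and> card (\<Union>(E_components \<Gamma>)) = 64 \<and>
       (\<forall>C \<in> E_components \<Gamma>. card C = 32 \<and> (\<forall>u\<in>C. dual_form \<Gamma> u = 3 / 2)) \<and>
       card (D_components \<Gamma>) = 1 \<and>
       (\<forall>C \<in> D_components \<Gamma>. card C = 12 \<and> (\<forall>u\<in>C. dual_form \<Gamma> u = 1))) \<and>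
     (\<forall>\<Gamma> \<in> E7a1 \<union> E7a2 \<union> E7a3 \<union> E7a4 \<union> {dynkin_E 7}.
       card (components \<Gamma>) = 1 \<and> components \<Gamma> = E_components \<Gamma> \<and>
       (\<forall>C \<in> components \<Gamma>. card C = 56 \<and> (\<forall>u\<in>C. dual_form \<Gamma> u = 3 / 2))) \<and>
     (\<forall>\<Gamma> \<in> Da 7 1 \<union> Da 7 2 \<union> {dynkin_D 7}.
       card (components \<Gamma>) = 3 \<and> components \<Gamma> = E_components \<Gamma> \<union> D_components \<Gamma> \<and>
       card (E_components \<Gamma>) = 2 \<and> card (\<Union>(E_components \<Gamma>)) = 128 \<and>
       (\<forall>C \<in> E_components \<Gamma>. card C = 64 \<and> (\<forall>u\<in>C. dual_form \<Gamma> u = 7 / 4)) \<and>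
       card (D_components \<Gamma>) = 1 \<and>
       (\<forall>C \<in> D_components \<Gamma>. card C = 14 \<and> (\<forall>u\<in>C. dual_form \<Gamma> u = 1))) \<and>
     (\<forall>l>7. (\<forall>\<Gamma> \<in> (\<Union>k\<in>{1..l - 3}. Da l k) \<union> {dynkin_D l}.
       card (components \<Gamma>) = 1 \<and> components \<Gamma> = D_components \<Gamma> \<and>
       (\<forall>C \<in> components \<Gamma>. card C = 2 * l \<and> (\<forall>u\<in>C. dual_form \<Gamma> u = 1))))"
proof -
  have p1: "\<exists>C1 C2 C3.
       distinct [C1, C2, C3] \<and> components \<Gamma> = {C1, C2, C3} \<and>
       {C1, C2} \<subseteq> E_components \<Gamma> \<inter> D_components \<Gamma> \<and> C3 \<in> D_components \<Gamma> \<and>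
       (\<Gamma> = dynkin_D 4 \<longrightarrow> C3 \<in> E_components \<Gamma>) \<and>
       card C1 = 8 \<and> card C2 = 8 \<and> card (C1 \<union> C2) = 16 \<and> card C3 = 8 \<and>
       (\<forall>u \<in> C1 \<union> C2 \<union> C3. dual_form \<Gamma> u = 1)"
    if "\<Gamma> \<in> Da 4 1 \<union> {dynkin_D 4}" for \<Gamma>
  proof -
    have "\<Gamma> = dynkin_D 4 \<or> (\<exists>k\<in>{1..4 - 3}. \<Gamma> \<in> Da 4 k)" using that by auto
    then obtain \<tau>s where "D_lattice_model \<Gamma> \<tau>s 4" using D_family by blast
    then show ?thesis by (rule D_lattice_model.linkage_rank_4) simp
  qed
  have p2: "card (components \<Gamma>) = 3 \<and> components \<Gamma> = E_components \<Gamma> \<union> D_components \<Gamma> \<and>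
       card (E_components \<Gamma>) = 2 \<and> card (\<Union>(E_components \<Gamma>)) = 32 \<and>
       (\<forall>C \<in> E_components \<Gamma>. card C = 16 \<and> (\<forall>u\<in>C. dual_form \<Gamma> u = 5 / 4)) \<and>
       card (D_components \<Gamma>) = 1 \<and>
       (\<forall>C \<in> D_components \<Gamma>. card C = 10 \<and> (\<forall>u\<in>C. dual_form \<Gamma> u = 1))"
    if "\<Gamma> \<in> Da 5 1 \<union> {dynkin_D 5}" for \<Gamma>
  proof -
    have "\<Gamma> = dynkin_D 5 \<or> (\<exists>k\<in>{1..5 - 3}. \<Gamma> \<in> Da 5 k)"
      using that by (auto intro: bexI[of _ 1] bexI[of _ 2])
    from D5_7_family[OF this, simplified] show ?thesis by (elim conjE, intro conjI) simp_all
  qed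
  have p4: "card (components \<Gamma>) = 3 \<and> components \<Gamma> = E_components \<Gamma> \<union> D_components \<Gamma> \<and>
       card (E_components \<Gamma>) = 2 \<and> card (\<Union>(E_components \<Gamma>)) = 64 \<and>
       (\<forall>C \<in> E_components \<Gamma>. card C = 32 \<and> (\<forall>u\<in>C. dual_form \<Gamma> u = 3 / 2)) \<and>
       card (D_components \<Gamma>) = 1 \<and>
       (\<forall>C \<in> D_components \<Gamma>. card C = 12 \<and> (\<forall>u\<in>C. dual_form \<Gamma> u = 1))"
    if "\<Gamma> \<in> Da 6 1 \<union> Da 6 2 \<union> {dynkin_D 6}" for \<Gamma>
  proof -
    have "\<Gamma> = dynkin_D 6 \<or> (\<exists>k\<in>{1..6 - 3}. \<Gamma> \<in> Da 6 k)"
      using that by (auto intro: bexI[of _ 1] bexI[of _ 2])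
    from D5_7_family[OF this, simplified] show ?thesis by (elim conjE, intro conjI) simp_all
  qed
  have p6: "card (components \<Gamma>) = 3 \<and> components \<Gamma> = E_components \<Gamma> \<union> D_components \<Gamma> \<and>
       card (E_components \<Gamma>) = 2 \<and> card (\<Union>(E_components \<Gamma>)) = 128 \<and>
       (\<forall>C \<in> E_components \<Gamma>. card C = 64 \<and> (\<forall>u\<in>C. dual_form \<Gamma> u = 7 / 4)) \<and>
       card (D_components \<Gamma>) = 1 \<and>
       (\<forall>C \<in> D_components \<Gamma>. card C = 14 \<and> (\<forall>u\<in>C. dual_form \<Gamma> u = 1))"
    if "\<Gamma> \<in> Da 7 1 \<union> Da 7 2 \<union> {dynkin_D 7}" for \<Gamma>
  proof -
    have "\<Gamma> = dynkin_D 7 \<or> (\<exists>k\<in>{1..7 - 3}. \<Gamma> \<in> Da 7 k)"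
      using that by (auto intro: bexI[of _ 1] bexI[of _ 2])
    from D5_7_family[OF this, simplified] show ?thesis by (elim conjE, intro conjI) simp_all
  qed
  have p7: "card (components \<Gamma>) = 1 \<and> components \<Gamma> = D_components \<Gamma> \<and>
       (\<forall>C \<in> components \<Gamma>. card C = 2 * l \<and> (\<forall>u\<in>C. dual_form \<Gamma> u = 1))"
    if "l > 7" "\<Gamma> \<in> (\<Union>k\<in>{1..l - 3}. Da l k) \<union> {dynkin_D l}" for l \<Gamma>
  proof -
    have "\<Gamma> = dynkin_D l \<or> (\<exists>k\<in>{1..l - 3}. \<Gamma> \<in> Da l k)" using that(2) by blast
    moreover have "4 \<le> l" using that(1) by simp
    ultimately obtain \<tau>s where "D_lattice_model \<Gamma> \<tau>s l" using D_family by blast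
    then show ?thesis by (rule D_lattice_model.linkage_rank_ge_8) (use that(1) in simp)
  qed
  show ?thesis
    by (intro conjI; intro ballI allI impI; rule p1 p2 E6_family p4 E7_family p6 p7; assumption)
qed

end
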